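(* Let $1\le q<\infty$, let $\Omega\subset\mathbb{R}^N$ be an open set and let $u\in BV^q(\Omega,\mathbb{R}^d)$. Then $$C_N\int_{\mathcal{J}_u}|u^+(x)-u^-(x)|^q\,d\mathcal{H}^{N-1}(x)\le \liminf_{\epsilon\to0^+}\int_{\Omega}\left(\int_{\Omega\cap B_\epsilon(x)}\frac{1}{\epsilon^N}\frac{|u(x)-u(y)|^q}{|x-y|}\,dy\right)dx .$$
   Context: $N,d$ are natural numbers ($\geq 1$). $\mathcal{H}^{s}$ is $s$-dimensional Hausdorff measure. $\fint_E$ denotes the average over $E$ with respect to Lebesgue measure. $B_\rho(x)$ is the open ball of radius $\rho$ centred at $x$. For $1\le q<\infty$, $u\in BV^q(\Omega,\mathbb{R}^d)$ means $u\in L^q(\Omega,\mathbb{R}^d)$ and $$\limsup_{\epsilon\to0^+}\int_{\Omega}\left(\int_{\Omega\cap B_\epsilon(x)}\frac{1}{\epsilon^N}\frac{|u(x)-u(y)|^q}{|x-y|}\,dy\right)dx<\infty .$$ The constant is $C_N:=\frac1N\int_{S^{N-1}}|z_1|\,d\mathcal{H}^{N-1}(z)$, where $z=(z_1,\dots,z_N)$. Approximate jump points: for $u\in L^1_{loc}(\Omega,\mathbb{R}^d)$, a point $x\in\Omega$ is an approximate jump point of $u$ if there exist $a,b\in\mathbb{R}^d$, $a\ne b$, and $\nu\in S^{N-1}$ such that $$\lim_{\rho\to0^+}\fint_{B^+_\rho(x,\nu)}|u(y)-a|\,dy=0,\qquad \lim_{\rho\to0^+}\fint_{B^-_\rho(x,\nu)}|u(y)-b|\,dy=0,$$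 where $B^{\pm}_\rho(x,\nu):=\{y\in B_\rho(x):\pm(y-x)\cdot\nu>0\}$. The triple $(a,b,\nu)$ is unique up to permutation of $(a,b)$ and change of sign of $\nu$, and is denoted $(u^+(x),u^-(x),\nu_u(x))$. The set of approximate jump points is denoted $\mathcal{J}_u$. *)

theory Defs
  imports "HOL-Analysis.Analysis"
begin

text \<open>
  Hausdorff measure with the standard normalisation (in \<open>\<real>\<^sup>N\<close> the \<open>N\<close>-dimensional one is Lebesgue
  measure): a nonempty covering set \<open>C\<close> has weight \<open>\<omega>\<^sub>s (diam C / 2)\<^sup>s\<close>, where
  \<open>\<omega>\<^sub>s = \<pi>\<^bsup>s/2\<^esup> / \<Gamma>(s/2 + 1)\<close>. For \<open>s = 0\<close> the convention is \<open>0\<^sup>0 = 1\<close>, which gives counting measure;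
  this case is separated because \<open>0 powr 0 = 0\<close> in the library.
\<close>

definition hausdorff_weight :: "real \<Rightarrow> 'a::metric_space set \<Rightarrow> ennreal" where
  "hausdorff_weight s C =
     (if C = {} then 0 else if s = 0 then 1
      else ennreal (unit_ball_vol s * (diameter C / 2) powr s))"

text \<open>Boundedness is required explicitly because \<^const>\<open>diameter\<close> is unspecified on unbounded sets.\<close>

definition hausdorff_content :: "real \<Rightarrow> real \<Rightarrow> 'a::metric_space set \<Rightarrow> ennreal" where
  "hausdorff_content s \<delta> A =
     (INF C\<in>{C :: nat \<Rightarrow> 'a set. A \<subseteq> (\<Union>i. C i) \<and> (\<forall>i. bounded (C i) \<and> diameter (C i) \<le> \<delta>)}.
        \<Sum>i. hausdorff_weight s (C i))"

definition hausdorff_outer :: "real \<Rightarrow> 'a::metric_space set \<Rightarrow> ennreal" where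
  "hausdorff_outer s A = (SUP \<delta>\<in>{0<..}. hausdorff_content s \<delta> A)"

text \<open>\<^const>\<open>lambda_system\<close> is the collection of Caratheodory-measurable sets.\<close>

definition hausdorff_measure :: "real \<Rightarrow> 'a::metric_space measure" where
  "hausdorff_measure s =
     measure_of UNIV (lambda_system UNIV UNIV (hausdorff_outer s)) (hausdorff_outer s)"

lemma hausdorff_content_le:
  assumes "A \<subseteq> (\<Union>i. C i)" "\<And>i. bounded (C i)" "\<And>i. diameter (C i) \<le> \<delta>"
  shows "hausdorff_content s \<delta> A \<le> (\<Sum>i. hausdorff_weight s (C (i::nat)))"
  unfolding hausdorff_content_def using assms by (intro INF_lower) auto

lemma hausdorff_content_countably_subadditive:
  fixes A :: "nat \<Rightarrow> 'a::metric_space set"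
  shows "hausdorff_content s \<delta> (\<Union>n. A n) \<le> (\<Sum>n. hausdorff_content s \<delta> (A n))"
proof (rule ennreal_le_epsilon)
  let ?O = "hausdorff_content s \<delta> :: 'a set \<Rightarrow> ennreal"
  fix e :: real assume "0 < e" "(\<Sum>n. ?O (A n)) < top"
  then have *: "\<And>n. ?O (A n) < ?O (A n) + e * (1/2)^Suc n"
    by (auto simp add: less_top dest!: ennreal_suminf_lessD)
  have "\<exists>B. A n \<subseteq> (\<Union>i. B i) \<and> (\<forall>i. bounded (B i) \<and> diameter (B i) \<le> \<delta>)
          \<and> (\<Sum>i. hausdorff_weight s (B (i::nat))) \<le> ?O (A n) + e * (1/2)^Suc n" for n
    using *[of n] by (subst (asm) hausdorff_content_def) (auto simp: INF_less_iff intro: less_imp_le)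
  then obtain B where B: "\<And>n. A n \<subseteq> (\<Union>i. B n i)"
      "\<And>n i. bounded (B n i)" "\<And>n i. diameter (B n i) \<le> \<delta>"
      "\<And>n. (\<Sum>i. hausdorff_weight s (B n (i::nat))) \<le> ?O (A n) + e * (1/2)^Suc n"
    by metis
  define C where "C = case_prod B o prod_decode"
  have "(\<Union>n. A n) \<subseteq> (\<Union>i. C i)"
    using B(1) by (auto simp add: C_def subset_eq) (metis prod.case prod_encode_inverse)
  then have "?O (\<Union>n. A n) \<le> (\<Sum>i. hausdorff_weight s (C i))"
    using B(2,3) by (intro hausdorff_content_le) (auto simp: C_def split_def)
  also have "\<dots> = (\<Sum>n. \<Sum>i. hausdorff_weight s (B n i))"
    unfolding C_def comp_def by (intro suminf_ennreal_2dimen) auto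
  also have "\<dots> \<le> (\<Sum>n. ?O (A n) + e * (1/2) ^ Suc n)"
    by (intro suminf_le allI B(4)) auto
  also have "\<dots> = (\<Sum>n. ?O (A n)) + (\<Sum>n. ennreal e * ennreal ((1/2) ^ Suc n))"
    using \<open>0 < e\<close> by (subst suminf_add[symmetric])
                     (auto simp del: ennreal_suminf_cmult simp add: ennreal_mult[symmetric])
  also have "\<dots> = (\<Sum>n. ?O (A n)) + e"
    unfolding ennreal_suminf_cmult
    by (subst suminf_ennreal_eq[OF zero_le_power power_half_series]) auto
  finally show "?O (\<Union>n. A n) \<le> (\<Sum>n. ?O (A n)) + e" .
qed

lemma outer_measure_space_hausdorff: "outer_measure_space UNIV (hausdorff_outer s :: 'a::metric_space set \<Rightarrow> ennreal)"
  unfolding outer_measure_space_def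
proof (intro conjI)
  have "hausdorff_content s \<delta> ({} :: 'a set) = 0" if "\<delta> > 0" for \<delta> :: real
    using hausdorff_content_le[of "{} :: 'a set" "\<lambda>_. {}" \<delta> s] that by (simp add: hausdorff_weight_def)
  then have "hausdorff_outer s ({} :: 'a set) \<le> 0"
    unfolding hausdorff_outer_def by (intro SUP_least) simp
  then show "positive UNIV (hausdorff_outer s :: 'a set \<Rightarrow> ennreal)"
    by (simp add: positive_def)
  show "increasing UNIV (hausdorff_outer s :: 'a set \<Rightarrow> ennreal)"
    unfolding increasing_def hausdorff_outer_def hausdorff_content_def
    by (intro ballI impI SUP_mono' INF_superset_mono) auto
  show "countably_subadditive UNIV (hausdorff_outer s :: 'a set \<Rightarrow> ennreal)"
    unfolding countably_subadditive_def
  proof (intro allI impI)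
    fix A :: "nat \<Rightarrow> 'a set"
    show "hausdorff_outer s (\<Union>i. A i) \<le> (\<Sum>i. hausdorff_outer s (A i))"
      unfolding hausdorff_outer_def[of s "\<Union>i. A i"]
    proof (rule SUP_least)
      fix \<delta> :: real assume "\<delta> \<in> {0<..}"
      then have "(\<Sum>i. hausdorff_content s \<delta> (A i)) \<le> (\<Sum>i. hausdorff_outer s (A i))"
        unfolding hausdorff_outer_def by (intro suminf_le SUP_upper) auto
      then show "hausdorff_content s \<delta> (\<Union>i. A i) \<le> (\<Sum>i. hausdorff_outer s (A i))"
        using hausdorff_content_countably_subadditive order_trans by blast
    qed
  qed
qed

lemma measure_space_hausdorff:
  "measure_space UNIV (lambda_system UNIV UNIV (hausdorff_outer s)) (hausdorff_outer s)"
  using sigma_algebra.caratheodory_lemma[OF sigma_algebra_Pow[of UNIV]]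
    outer_measure_space_hausdorff by auto

lemma space_hausdorff_measure [simp]: "space (hausdorff_measure s) = UNIV"
  by (simp add: hausdorff_measure_def space_measure_of_conv)

lemma sets_hausdorff_measure:
  "sets (hausdorff_measure s :: 'a::metric_space measure) = lambda_system UNIV UNIV (hausdorff_outer s)"
proof -
  have "sigma_algebra UNIV (lambda_system UNIV UNIV (hausdorff_outer s :: 'a set \<Rightarrow> ennreal))"
    using measure_space_hausdorff unfolding measure_space_def by blast
  then show ?thesis
    unfolding hausdorff_measure_def by (rule sigma_algebra.sets_measure_of_eq)
qed

lemma emeasure_hausdorff_measure:
  assumes "A \<in> sets (hausdorff_measure s)"
  shows "emeasure (hausdorff_measure s) A = hausdorff_outer s A"
  using assms measure_space_hausdorff[of s] unfolding sets_hausdorff_measure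
  unfolding hausdorff_measure_def by (intro emeasure_measure_of_sigma) (auto simp: measure_space_def)


text \<open>
  The index type \<open>'n\<close> carries no order, so the coordinate that plays the role of \<open>z\<^sub>1\<close> is a parameter \<open>k\<close>.
\<close>

definition jump_const :: "'n::finite \<Rightarrow> ennreal" where
  "jump_const k =
     ennreal (1 / real CARD('n)) *
     (\<integral>\<^sup>+z\<in>sphere 0 1. ennreal \<bar>(z :: real^'n) $ k\<bar> \<partial>hausdorff_measure (real CARD('n) - 1))"

definition BV_energy :: "real \<Rightarrow> (real^'n) set \<Rightarrow> (real^'n \<Rightarrow> real^'d) \<Rightarrow> real \<Rightarrow> ennreal" where
  "BV_energy q \<Omega> u \<epsilon> =
     (\<integral>\<^sup>+x\<in>\<Omega>. (\<integral>\<^sup>+y\<in>\<Omega> \<inter> ball x \<epsilon>.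
        ennreal (1 / \<epsilon> ^ CARD('n) * (norm (u x - u y) powr q / norm (x - y))) \<partial>lebesgue) \<partial>lebesgue)"

text \<open>
  Functions on \<open>\<Omega>\<close> are represented by total functions; the notions below depend only on the values
  on \<open>\<Omega>\<close>. The first two conditions state that \<open>u\<close> lies in \<open>L\<^sup>q(\<Omega>)\<close>.
\<close>

definition BV_space :: "real \<Rightarrow> (real^'n) set \<Rightarrow> (real^'n \<Rightarrow> real^'d) set" where
  "BV_space q \<Omega> =
     {u. u \<in> borel_measurable (lebesgue_on \<Omega>) \<and>
         (\<integral>\<^sup>+x\<in>\<Omega>. ennreal (norm (u x) powr q) \<partial>lebesgue) < \<infinity> \<and>
         Limsup (at_right 0) (BV_energy q \<Omega> u) < \<infinity>}"

definition nn_average :: "(real^'n) set \<Rightarrow> (real^'n \<Rightarrow> real) \<Rightarrow> ennreal" where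
  "nn_average E f = (\<integral>\<^sup>+y\<in>E. ennreal (f y) \<partial>lebesgue) / emeasure lebesgue E"

definition half_ball :: "real^'n \<Rightarrow> real^'n \<Rightarrow> real \<Rightarrow> (real^'n) set" where
  "half_ball x \<nu> \<rho> = {y \<in> ball x \<rho>. (y - x) \<bullet> \<nu> > 0}"

text \<open>Note that \<open>B\<^sup>-\<^sub>\<rho>(x, \<nu>) = B\<^sup>+\<^sub>\<rho>(x, -\<nu>)\<close>.\<close>

definition is_jump_triple ::
  "(real^'n \<Rightarrow> real^'d) \<Rightarrow> real^'n \<Rightarrow> (real^'d) \<times> (real^'d) \<times> (real^'n) \<Rightarrow> bool" where
  "is_jump_triple u x = (\<lambda>(a, b, \<nu>).
     a \<noteq> b \<and> \<nu> \<in> sphere 0 1 \<and>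
     ((\<lambda>\<rho>. nn_average (half_ball x \<nu> \<rho>) (\<lambda>y. norm (u y - a))) \<longlongrightarrow> 0) (at_right 0) \<and>
     ((\<lambda>\<rho>. nn_average (half_ball x (- \<nu>) \<rho>) (\<lambda>y. norm (u y - b))) \<longlongrightarrow> 0) (at_right 0))"

definition jump_set :: "(real^'n) set \<Rightarrow> (real^'n \<Rightarrow> real^'d) \<Rightarrow> (real^'n) set" where
  "jump_set \<Omega> u = {x \<in> \<Omega>. \<exists>t. is_jump_triple u x t}"

text \<open>
  At a jump point the triple is unique up to simultaneously swapping the two values and changing the
  sign of the normal; an arbitrary admissible choice is made at each point.
\<close>

definition jump_triple :: "(real^'n \<Rightarrow> real^'d) \<Rightarrow> real^'n \<Rightarrow> (real^'d) \<times> (real^'d) \<times> (real^'n)" where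
  "jump_triple u x = (SOME t. is_jump_triple u x t)"

definition trace_plus :: "(real^'n \<Rightarrow> real^'d) \<Rightarrow> real^'n \<Rightarrow> real^'d" where
  "trace_plus u x = fst (jump_triple u x)"

definition trace_minus :: "(real^'n \<Rightarrow> real^'d) \<Rightarrow> real^'n \<Rightarrow> real^'d" where
  "trace_minus u x = fst (snd (jump_triple u x))"

end

theory Submission
  imports Defs
begin

text \<open>
  At a jump point the function is, at small scales, close to a two-valued step function across a
  hyperplane. Hence, after splitting the jump set into countably many pieces on which the traces
  and the normal are nearly constant and the approximation is uniform, every piece is a subset of
  a Lipschitz graph with small constant: otherwise a small ball would lie on the positive side of
  one jump point and on the negative side of another. After the substitution \<open>y = x + \<epsilon> z\<close> the
  energy is, for fixed \<open>z\<close>, at least \<open>|a - b|\<^sup>q / (\<epsilon> |z|)\<close> times the volume of the points whose segment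
  \<open>[x, x + \<epsilon> z]\<close> crosses the piece. These points fill a prism of volume \<open>\<epsilon> |z \<bullet> \<nu>|\<close> times the
  projected area, up to a small exceptional set, which is estimated by covering the piece by
  balls of radius comparable to \<open>\<epsilon>\<close>. Integration over \<open>z\<close> produces the constant
  \<open>\<integral>\<^bsub>B\<^esub> |z \<bullet> \<nu>| / |z| dz\<close>.

  Hausdorff measure only has to be bounded from above, both for the pieces and for the sphere in
  the definition of the constant; this follows from a density theorem based on Vitali's
  covering lemma. Prisms and cones in \<open>\<real>\<^sup>N\<close> replace \<open>(N - 1)\<close>-dimensional Lebesgue measure.
\<close>

subsection \<open>Hausdorff outer measure\<close>

text \<open>The difficulty is the singular weight \<open>1 / (\<epsilon> |z|)\<close>. The layers
  beside a piece in which \<open>u\<close> is far from its traces have volume of order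
  \<open>\<epsilon> (\<eta> + \<kappa>)\<close>; after division by \<open>\<epsilon> |z|\<close>
  this error neither vanishes with \<open>\<epsilon>\<close> nor stays bounded as \<open>z\<close>
  tends to 0. Displacements with \<open>|z| < \<theta>\<close> are therefore given up, at a cost of
  order \<open>\<theta>^N\<close>; the others lose at most a multiple of
  \<open>(\<eta> + \<kappa>) / \<theta>\<close>. With \<open>\<theta> = sqrt \<kappa>\<close> and
  \<open>\<eta> \<le> \<kappa>\<close> both losses vanish with \<open>\<kappa>\<close>, after
  \<open>\<epsilon>\<close> has tended to 0. Errors are measured against the volume of a prism over
  the piece, because the energy is bounded below by that volume and it passes to Hausdorff measure
  only at the very end. This is why the exceptional layers are counted by packing balls into a
  neighbourhood of the prism. Neither measurability nor sigma-finiteness of the jump set is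
  presupposed: it is covered by countably many compact cells, each of finite measure, and the bound
  for finite families of disjoint pieces does not depend on their number.\<close>

lemma hausdorff_outer_mono: "A \<subseteq> B \<Longrightarrow> hausdorff_outer s A \<le> hausdorff_outer s B"
  using outer_measure_space_hausdorff[of s] by (auto simp: outer_measure_space_def increasing_def)

lemma hausdorff_outer_empty [simp]: "hausdorff_outer s {} = 0"
  using outer_measure_space_hausdorff[of s] by (auto simp: outer_measure_space_def positive_def)

lemma hausdorff_outer_suminf:
  fixes A :: "nat \<Rightarrow> 'a::metric_space set"
  shows "hausdorff_outer s (\<Union>i. A i) \<le> (\<Sum>i. hausdorff_outer s (A i))"
  unfolding hausdorff_outer_def[of s "\<Union>i. A i"]
proof (rule SUP_least)
  fix \<delta> :: real assume "\<delta> \<in> {0<..}"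
  then have "(\<Sum>i. hausdorff_content s \<delta> (A i)) \<le> (\<Sum>i. hausdorff_outer s (A i))"
    unfolding hausdorff_outer_def by (intro suminf_le SUP_upper) auto
  then show "hausdorff_content s \<delta> (\<Union>i. A i) \<le> (\<Sum>i. hausdorff_outer s (A i))"
    using hausdorff_content_countably_subadditive order_trans by blast
qed

lemma hausdorff_outer_Un: "hausdorff_outer s (A \<union> B) \<le> hausdorff_outer s A + hausdorff_outer s B"
proof -
  have "(\<Union>i. binaryset A B i) = A \<union> B" by (rule UN_binaryset_eq)
  then show ?thesis
    using hausdorff_outer_suminf[of s "binaryset A B"] suminf_binaryset_eq[of "hausdorff_outer s" A B]
    by simp
qed

lemma hausdorff_content_mono: "A \<subseteq> B \<Longrightarrow> hausdorff_content s \<delta> A \<le> hausdorff_content s \<delta> B"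
  unfolding hausdorff_content_def by (intro INF_superset_mono) auto

lemma hausdorff_content_antimono: "\<delta> \<le> \<delta>' \<Longrightarrow> hausdorff_content s \<delta>' A \<le> hausdorff_content s \<delta> A"
  unfolding hausdorff_content_def by (intro INF_superset_mono) (auto intro: order_trans)

lemma hausdorff_content_le_outer: "\<delta> > 0 \<Longrightarrow> hausdorff_content s \<delta> A \<le> hausdorff_outer s A"
  unfolding hausdorff_outer_def by (intro SUP_upper) auto

lemma hausdorff_weight_empty [simp]: "hausdorff_weight s {} = 0"
  by (simp add: hausdorff_weight_def)

lemma hausdorff_content_empty [simp]: "\<delta> \<ge> 0 \<Longrightarrow> hausdorff_content s \<delta> ({} :: 'a::metric_space set) = 0"
  using hausdorff_content_le[of "{} :: 'a set" "\<lambda>_. {}" \<delta> s] by (simp)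

lemma hausdorff_content_Un:
  assumes "\<delta> \<ge> 0"
  shows "hausdorff_content s \<delta> (A \<union> B) \<le> hausdorff_content s \<delta> A + hausdorff_content s \<delta> B"
proof -
  have "(\<Union>i. binaryset A B i) = A \<union> B" by (rule UN_binaryset_eq)
  then show ?thesis
    using hausdorff_content_countably_subadditive[of s \<delta> "binaryset A B"]
      suminf_binaryset_eq[of "hausdorff_content s \<delta>" A B] assms
    by simp
qed

lemma hausdorff_content_le_outer_limit:
  assumes "\<And>\<delta>. 0 < \<delta> \<Longrightarrow> \<delta> < \<delta>0 \<Longrightarrow> hausdorff_content s \<delta> A \<le> c" "\<delta>0 > 0"
  shows "hausdorff_outer s A \<le> c"
  unfolding hausdorff_outer_def
proof (rule SUP_least)
  fix \<delta> :: real assume "\<delta> \<in> {0<..}"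
  then have "hausdorff_content s \<delta> A \<le> hausdorff_content s (min \<delta> (\<delta>0/2)) A"
    by (intro hausdorff_content_antimono) auto
  also have "\<dots> \<le> c" using assms \<open>\<delta> \<in> _\<close> by auto
  finally show "hausdorff_content s \<delta> A \<le> c" .
qed

text \<open>A covering set of diameter at most \<open>\<delta>\<close> cannot meet both
  \<open>A\<close> and \<open>B\<close>, so every cover of the union splits into a cover of
  \<open>A\<close> and a cover of \<open>B\<close> that share no set.\<close>

lemma hausdorff_content_separated:
  fixes A B :: "'a::metric_space set"
  assumes sep: "\<And>x y. x \<in> A \<Longrightarrow> y \<in> B \<Longrightarrow> \<delta> < dist x y" and "0 \<le> \<delta>"
  shows "hausdorff_content s \<delta> A + hausdorff_content s \<delta> B \<le> hausdorff_content s \<delta> (A \<union> B)"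
  unfolding hausdorff_content_def[of s \<delta> "A \<union> B"]
proof (rule INF_greatest)
  fix C assume C: "C \<in> {C. A \<union> B \<subseteq> (\<Union>i::nat. C i) \<and> (\<forall>i. bounded (C i) \<and> diameter (C i) \<le> \<delta>)}"
  define CA where "CA = (\<lambda>i. C i \<inter> A)"
  define CB where "CB = (\<lambda>i. if CA i = {} then C i else {})"
  have "x \<in> (\<Union>i. CB i)" if "x \<in> B" for x
  proof -
    have "x \<in> (\<Union>i. C i)" using C that by auto
    then obtain i where i: "x \<in> C i" by auto
    have "CA i = {}"
    proof (rule ccontr)
      assume "CA i \<noteq> {}"
      then obtain y where "y \<in> C i" "y \<in> A" by (auto simp: CA_def)
      then have "dist y x \<le> \<delta>" using diameter_bounded_bound[of "C i" y x] i C
        by (metis (mono_tags, lifting) mem_Collect_eq order_trans)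
      with sep[OF \<open>y \<in> A\<close> that] show False by auto
    qed
    then show ?thesis using i by (auto simp: CB_def)
  qed
  then have B: "hausdorff_content s \<delta> B \<le> (\<Sum>i. hausdorff_weight s (CB i))"
    using C \<open>0 \<le> \<delta>\<close> by (intro hausdorff_content_le) (auto simp: CB_def)
  \<comment> \<open>Sets that meet \<open>A\<close> are kept whole instead of being cut down to
    \<open>A\<close>; together with \<open>CB\<close> they then account for every weight exactly
    once.\<close>
  define CA' where "CA' = (\<lambda>i. if CA i = {} then {} else C i)"
  have A: "hausdorff_content s \<delta> A \<le> (\<Sum>i. hausdorff_weight s (CA' i))"
    using C \<open>0 \<le> \<delta>\<close> by (intro hausdorff_content_le) (auto simp: CA_def CA'_def, blast)
  have "(\<Sum>i. hausdorff_weight s (CA' i)) + (\<Sum>i. hausdorff_weight s (CB i))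
      = (\<Sum>i. hausdorff_weight s (CA' i) + hausdorff_weight s (CB i))"
    by (rule suminf_add) auto
  also have "\<dots> = (\<Sum>i. hausdorff_weight s (C i))"
    by (intro suminf_cong) (auto simp: CA'_def CB_def)
  finally show "hausdorff_content s \<delta> A + hausdorff_content s \<delta> B \<le> (\<Sum>i. hausdorff_weight s (C i))"
    using A B by (metis add_mono)
qed

text \<open>The property that makes the outer measure metric. The two suprema run over independent
  scales; both contents are compared with those at one common scale below \<open>e\<close>, where no
  covering set can bridge the gap.\<close>

lemma hausdorff_outer_separated:
  fixes A B :: "'a::metric_space set"
  assumes sep: "\<And>x y. x \<in> A \<Longrightarrow> y \<in> B \<Longrightarrow> e \<le> dist x y" and "0 < e"
  shows "hausdorff_outer s A + hausdorff_outer s B \<le> hausdorff_outer s (A \<union> B)"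
proof -
  have *: "hausdorff_content s \<delta> A + hausdorff_content s \<delta>' B \<le> hausdorff_outer s (A \<union> B)"
    if "\<delta> > 0" "\<delta>' > 0" for \<delta> \<delta>'
  proof -
    define d where "d = min (min \<delta> \<delta>') (e/2)"
    have d: "d > 0" "d \<le> \<delta>" "d \<le> \<delta>'" "d < e" using that assms by (auto simp: d_def)
    have "hausdorff_content s \<delta> A + hausdorff_content s \<delta>' B \<le> hausdorff_content s d A + hausdorff_content s d B"
      using d by (intro add_mono hausdorff_content_antimono)
    also have "\<dots> \<le> hausdorff_content s d (A \<union> B)"
      using d sep by (intro hausdorff_content_separated) force+
    also have "\<dots> \<le> hausdorff_outer s (A \<union> B)" using d by (intro hausdorff_content_le_outer)
    finally show ?thesis .
  qed
  have "hausdorff_outer s A + hausdorff_outer s B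
     = (SUP \<delta>\<in>{0<..}. SUP \<delta>'\<in>{0<..}. hausdorff_content s \<delta> A + hausdorff_content s \<delta>' B)"
    unfolding hausdorff_outer_def[of s A] hausdorff_outer_def[of s B]
    by (subst ennreal_SUP_add_left[symmetric])
       (auto intro!: SUP_cong simp: ennreal_SUP_add_right)
  also have "\<dots> \<le> hausdorff_outer s (A \<union> B)"
    using * by (intro SUP_least) auto
  finally show ?thesis .
qed

text \<open>The gap has to be uniform in all later indices, since the induction splits
  \<open>R 0\<close> off from the union of all remaining sets at once.\<close>

lemma hausdorff_outer_separated_sum:
  fixes R :: "nat \<Rightarrow> 'a::metric_space set"
  assumes "\<And>i j. i < j \<Longrightarrow> \<exists>e>0. \<forall>k\<ge>j. \<forall>x\<in>R i. \<forall>y\<in>R k. e \<le> dist x y"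
  shows "(\<Sum>i<n. hausdorff_outer s (R i)) \<le> hausdorff_outer s (\<Union>i<n. R i)"
  using assms
proof (induction n arbitrary: R)
  case (Suc n)
  obtain e where e: "e > 0" "\<forall>k\<ge>1. \<forall>x\<in>R 0. \<forall>y\<in>R k. e \<le> dist x y" using Suc.prems[of 0 1] by auto
  have "(\<Sum>i<Suc n. hausdorff_outer s (R i)) = hausdorff_outer s (R 0) + (\<Sum>i<n. hausdorff_outer s (R (Suc i)))"
    by (rule sum.lessThan_Suc_shift)
  also have "\<dots> \<le> hausdorff_outer s (R 0) + hausdorff_outer s (\<Union>i<n. R (Suc i))"
  proof (intro add_left_mono Suc.IH)
    fix i j :: nat assume "i < j"
    then obtain e where "e > 0" "\<forall>k\<ge>Suc j. \<forall>x\<in>R (Suc i). \<forall>y\<in>R k. e \<le> dist x y"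
      using Suc.prems[of "Suc i" "Suc j"] by auto
    then show "\<exists>e>0. \<forall>k\<ge>j. \<forall>x\<in>R (Suc i). \<forall>y\<in>R (Suc k). e \<le> dist x y" by auto
  qed
  also have "\<dots> \<le> hausdorff_outer s (R 0 \<union> (\<Union>i<n. R (Suc i)))"
    using e by (intro hausdorff_outer_separated[of _ _ e]) auto
  also have "R 0 \<union> (\<Union>i<n. R (Suc i)) = (\<Union>i<Suc n. R i)"
    by (auto simp: lessThan_Suc_eq_insert_0)
  finally show ?case .
qed simp

text \<open>Caratheodory's criterion for metric outer measures. The part of \<open>T\<close> at
  distance at least \<open>1 / (n + 1)\<close> from \<open>F\<close> is separated from
  \<open>F\<close>, so the two measures add correctly; what remains outside \<open>F\<close> is a
  union of shells whose measures form the tail of a convergent series.\<close>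

lemma closed_lambda_system_hausdorff:
  fixes F :: "'a::metric_space set"
  assumes "closed F"
  shows "F \<in> lambda_system UNIV UNIV (hausdorff_outer s)"
proof (cases "F = {}")
  case True
  then show ?thesis by (simp add: lambda_system_def)
next
  case False
  let ?H = "hausdorff_outer s :: 'a set \<Rightarrow> ennreal"
  have "?H (F \<inter> T) + ?H (- F \<inter> T) \<le> ?H T" for T
  proof (cases "?H T = \<infinity>")
    case fin: False
    define d where "d x = infdist x F" for x
    have dpos: "d x > 0" if "x \<notin> F" for x
      using in_closed_iff_infdist_zero[OF assms False] that infdist_nonneg[of x F] by (auto simp: d_def order_less_le)
    define R where "R n = {x \<in> T. 1 / (real n + 2) \<le> d x \<and> d x < 1 / (real n + 1)}" for n
    define T' where "T' n = {x \<in> T. 1 / (real n + 1) \<le> d x}" for n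
    \<comment> \<open>Neighbouring shells touch, but shells whose indices differ by at least 2 have
      a positive gap. Even and odd indices are summed separately, which bounds the series by twice
      the measure of \<open>T\<close>.\<close>
    have sep: "\<exists>e>0. \<forall>k\<ge>j. \<forall>x\<in>R (2 * i + p). \<forall>y\<in>R (2 * k + p). e \<le> dist x y" if "i < j" for i j p
    proof (intro exI[of _ "1 / (real (2*i+p) + 2) - 1 / (real (2*j+p) + 1)"] conjI allI ballI impI)
      show "1 / (real (2*i+p) + 2) - 1 / (real (2*j+p) + 1) > 0"
      proof -
        have "1 / (real (2*j+p) + 1) < 1 / (real (2*i+p) + 2)"
          using that by (intro divide_strict_left_mono) auto
        then show ?thesis by simp
      qed
      fix k x y assume k: "k \<ge> j" and x: "x \<in> R (2*i+p)" and y: "y \<in> R (2*k+p)"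
      have "1 / (real (2*k+p) + 1) \<le> 1 / (real (2*j+p) + 1)"
        using k by (intro divide_left_mono) auto
      moreover have "d x \<le> d y + dist x y" unfolding d_def by (rule infdist_triangle)
      ultimately show "1 / (real (2*i+p) + 2) - 1 / (real (2*j+p) + 1) \<le> dist x y"
        using x y by (auto simp: R_def)
    qed
    have partial: "(\<Sum>i<n. ?H (R (2 * i + p))) \<le> ?H T" for n p
    proof -
      have "(\<Sum>i<n. ?H (R (2 * i + p))) \<le> ?H (\<Union>i<n. R (2 * i + p))"
        by (rule hausdorff_outer_separated_sum) (rule sep)
      also have "\<dots> \<le> ?H T" by (intro hausdorff_outer_mono) (auto simp: R_def)
      finally show ?thesis .
    qed
    have dbl: "(\<Sum>i<2*n. f i) = (\<Sum>i<n. f (2*i)) + (\<Sum>i<n. f (2*i+1))" for f :: "nat \<Rightarrow> ennreal" and n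
      by (induction n) (auto simp: algebra_simps)
    have "(\<Sum>i<n. ?H (R i)) \<le> ?H T + ?H T" for n
    proof -
      have "(\<Sum>i<n. ?H (R i)) \<le> (\<Sum>i<2*n. ?H (R i))" by (intro sum_mono2) auto
      also have "\<dots> \<le> ?H T + ?H T" unfolding dbl using partial[where n = n and p = 0] partial[where n = n and p = 1] by (intro add_mono) auto
      finally show ?thesis .
    qed
    then have "(\<Sum>i. ?H (R i)) \<le> ?H T + ?H T"
      by (rule suminf_le_const[OF summableI])
    then have sfin: "(\<Sum>i. ?H (R i)) < \<infinity>" using fin by (auto simp: top_unique less_top[symmetric])
    have tail: "(\<lambda>n. \<Sum>i. ?H (R (i + n))) \<longlonglongrightarrow> 0"
    proof -
      have "(\<lambda>n. (\<Sum>i. ?H (R i)) - (\<Sum>i<n. ?H (R i))) \<longlonglongrightarrow> (\<Sum>i. ?H (R i)) - (\<Sum>i. ?H (R i))"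
        using sfin by (intro tendsto_diff_ennreal tendsto_const summable_LIMSEQ summableI) auto
      moreover have "(\<Sum>i. ?H (R i)) - (\<Sum>i<n. ?H (R i)) = (\<Sum>i. ?H (R (i + n)))" for n
      proof -
        have "(\<Sum>i. ?H (R i)) = (\<Sum>i<n. ?H (R i)) + (\<Sum>i. ?H (R (i + n)))"
          using suminf_offset[of "\<lambda>i. ?H (R i)" n] by (simp add: add.commute)
        moreover have "(\<Sum>i<n. ?H (R i)) \<noteq> \<infinity>"
          using le_less_trans[OF sum_le_suminf[of "\<lambda>i. ?H (R i)" "{..<n}"] sfin] by (metis finite_lessThan less_irrefl summableI zero_le)
        ultimately show ?thesis by simp
      qed
      ultimately show ?thesis using sfin by simp
    qed
    have main: "?H (F \<inter> T) + ?H (- F \<inter> T) \<le> ?H T + (\<Sum>i. ?H (R (i + n)))" for n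
    proof -
      have "- F \<inter> T \<subseteq> T' n \<union> (\<Union>i. R (i + n))"
      proof
        fix x assume x: "x \<in> - F \<inter> T"
        show "x \<in> T' n \<union> (\<Union>i. R (i + n))"
        proof (cases "1 / (real n + 1) \<le> d x")
          case False
          have dx: "d x > 0" using dpos x by auto
          have lt: "1 / d x > real n + 1" using False dx by (simp add: field_simps)
          \<comment> \<open>A point lies in shell \<open>m\<close> exactly if
            \<open>m + 1 < 1 / d x \<le> m + 2\<close>, that is, if the ceiling of
            \<open>1 / d x\<close> is \<open>m + 2\<close>.\<close>
          define m where "m = nat (\<lceil>1 / d x\<rceil> - 2)"
          have c: "\<lceil>1 / d x\<rceil> \<ge> int n + 2" using lt by linarith
          have m: "real m = real_of_int \<lceil>1 / d x\<rceil> - 2" "m \<ge> n" using c by (auto simp: m_def)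
          have "1 / d x \<le> real m + 2" "real m + 1 < 1 / d x" using m by linarith+
          then have "1 / (real m + 2) \<le> d x" "d x < 1 / (real m + 1)" using dx by (auto simp: field_simps)
          then have "x \<in> R (m - n + n)" using x m by (auto simp: R_def)
          then show ?thesis by blast
        qed (use x in \<open>auto simp: T'_def\<close>)
      qed
      then have "?H (- F \<inter> T) \<le> ?H (T' n) + ?H (\<Union>i. R (i + n))"
        by (meson hausdorff_outer_mono hausdorff_outer_Un order_trans)
      also have "\<dots> \<le> ?H (T' n) + (\<Sum>i. ?H (R (i + n)))"
        by (intro add_left_mono hausdorff_outer_suminf)
      finally have "?H (F \<inter> T) + ?H (- F \<inter> T) \<le> (?H (F \<inter> T) + ?H (T' n)) + (\<Sum>i. ?H (R (i + n)))"
        by (simp add: add.assoc add_left_mono)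
      also have "?H (F \<inter> T) + ?H (T' n) \<le> ?H (F \<inter> T \<union> T' n)"
      proof (rule hausdorff_outer_separated[of _ _ "1 / (real n + 1)"])
        fix x y assume "x \<in> F \<inter> T" "y \<in> T' n"
        then have "1 / (real n + 1) \<le> d y" "d y \<le> dist y x" by (auto simp: T'_def d_def infdist_le)
        then show "1 / (real n + 1) \<le> dist x y" by (simp add: dist_commute)
      qed auto
      also have "\<dots> \<le> ?H T" by (intro hausdorff_outer_mono) (auto simp: T'_def)
      finally show ?thesis by (simp add: add_right_mono)
    qed
    have "(\<lambda>n. ?H T + (\<Sum>i. ?H (R (i + n)))) \<longlonglongrightarrow> ?H T + 0"
      by (intro tendsto_add tail tendsto_const)
    then show ?thesis using main by (intro LIMSEQ_le_const[where X = "\<lambda>n. ?H T + (\<Sum>i. ?H (R (i + n)))"]) auto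
  qed auto
  moreover have "?H T \<le> ?H (F \<inter> T) + ?H (- F \<inter> T)" for T
    using hausdorff_outer_Un[of s "F \<inter> T" "- F \<inter> T"] by (metis Int_commute Int_Un_distrib2 Compl_partition Int_UNIV_left)
  ultimately show ?thesis by (auto simp: lambda_system_def Compl_eq_Diff_UNIV[symmetric] intro!: antisym)
qed

lemma borel_subset_hausdorff:
  "sets borel \<subseteq> sets (hausdorff_measure s :: 'a::metric_space measure)"
proof -
  have "sigma_sets UNIV (Collect closed) \<subseteq> sets (hausdorff_measure s :: 'a measure)"
    using sets.sigma_sets_subset[of "Collect closed" "hausdorff_measure s :: 'a measure"]
    by (simp add: subset_iff sets_hausdorff_measure closed_lambda_system_hausdorff)
  then show ?thesis by (simp add: borel_eq_closed)
qed

lemma emeasure_hausdorff_borel: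
  "A \<in> sets borel \<Longrightarrow> emeasure (hausdorff_measure s) A = hausdorff_outer s A"
  using borel_subset_hausdorff by (intro emeasure_hausdorff_measure) auto

lemma ennreal_le_mult_INF:
  fixes f :: "'i \<Rightarrow> ennreal"
  assumes "0 < c" and le: "\<And>i. i \<in> I \<Longrightarrow> x \<le> ennreal c * f i"
  shows "x \<le> ennreal c * (INF i\<in>I. f i)"
proof -
  have inv: "ennreal c * (ennreal (1 / c) * y) = y" "ennreal (1 / c) * (ennreal c * y) = y" for y
    using \<open>0 < c\<close> by (simp_all add: mult.assoc[symmetric] ennreal_mult'[symmetric])
  have "ennreal (1 / c) * x \<le> (INF i\<in>I. f i)"
  proof (rule INF_greatest)
    fix i assume "i \<in> I"
    then show "ennreal (1 / c) * x \<le> f i" using mult_left_mono[OF le, of i "ennreal (1 / c)"] inv by simp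
  qed
  then show ?thesis using mult_left_mono[of _ _ "ennreal c"] inv by fastforce
qed

text \<open>Since \<open>f\<close> is Lipschitz on \<open>A\<close> only, every covering set is
  intersected with \<open>A\<close> before it is mapped. For \<open>s = 0\<close> the weights just
  count nonempty sets, so that case does not go through powers of diameters.\<close>

lemma hausdorff_outer_Lipschitz_image:
  fixes f :: "'a::metric_space \<Rightarrow> 'b::metric_space"
  assumes f: "\<And>x y. x \<in> A \<Longrightarrow> y \<in> A \<Longrightarrow> dist (f x) (f y) \<le> L * dist x y" and "L > 0" "s \<ge> 0"
  shows "hausdorff_outer s (f ` A) \<le> ennreal (L powr s) * hausdorff_outer s A"
proof -
  have *: "hausdorff_content (s) (L * \<delta>) (f ` A) \<le> ennreal (L powr s) * hausdorff_content s \<delta> A" if "\<delta> > 0" for \<delta>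
  proof -
    have w: "bounded (f ` (C \<inter> A)) \<and> diameter (f ` (C \<inter> A)) \<le> L * \<delta> \<and>
        hausdorff_weight s (f ` (C \<inter> A)) \<le> ennreal (L powr s) * hausdorff_weight s C"
      if C: "bounded C" "diameter C \<le> \<delta>" for C
    proof (cases "C \<inter> A = {}")
      case False
      have d: "dist (f x) (f y) \<le> L * diameter C" if "x \<in> C \<inter> A" "y \<in> C \<inter> A" for x y
      proof -
        have "dist (f x) (f y) \<le> L * dist x y" using f that by auto
        also have "\<dots> \<le> L * diameter C" using that C \<open>L > 0\<close> by (simp add: diameter_bounded_bound)
        finally show ?thesis .
      qed
      obtain x where x: "x \<in> C \<inter> A" using False by auto
      have b: "bounded (f ` (C \<inter> A))" unfolding bounded_def using d[OF x] by blast
      have dm: "diameter (f ` (C \<inter> A)) \<le> L * diameter C"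
        unfolding diameter_def[of "f ` (C \<inter> A)"] using False d by (auto intro!: cSUP_least)
      have dg: "0 \<le> diameter C" "0 \<le> diameter (f ` (C \<inter> A))" using diameter_ge_0 C b by auto
      have "hausdorff_weight s (f ` (C \<inter> A)) \<le> ennreal (L powr s) * hausdorff_weight s C"
      proof (cases "s = 0")
        case s: False
        have "(diameter (f ` (C \<inter> A)) / 2) powr s \<le> (L * (diameter C / 2)) powr s"
          using dm dg \<open>s \<ge> 0\<close> by (intro powr_mono2) auto
        also have "\<dots> = L powr s * (diameter C / 2) powr s" using dg \<open>L > 0\<close> powr_mult[of L "diameter C / 2" s] by simp
        finally have "unit_ball_vol s * (diameter (f ` (C \<inter> A)) / 2) powr s \<le> L powr s * (unit_ball_vol s * (diameter C / 2) powr s)"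
          using unit_ball_vol_nonneg[of s] \<open>s \<ge> 0\<close> by (metis mult.left_commute mult_left_mono)
        then show ?thesis using False s by (auto simp: hausdorff_weight_def ennreal_mult'[symmetric] intro!: ennreal_leI)
      qed (use False \<open>L > 0\<close> in \<open>auto simp: hausdorff_weight_def\<close>)
      moreover have "L * diameter C \<le> L * \<delta>" using C \<open>L > 0\<close> by auto
      ultimately show ?thesis using b dm by linarith
    qed (use \<open>\<delta> > 0\<close> \<open>L > 0\<close> in auto)
    have "hausdorff_content s (L * \<delta>) (f ` A) \<le> ennreal (L powr s) * (\<Sum>i. hausdorff_weight s (C i))"
      if C: "A \<subseteq> (\<Union>i. C i)" "\<forall>i. bounded (C i) \<and> diameter (C i) \<le> \<delta>" for C :: "nat \<Rightarrow> 'a set"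
    proof -
      have "hausdorff_content s (L * \<delta>) (f ` A) \<le> (\<Sum>i. hausdorff_weight s (f ` (C i \<inter> A)))"
      proof (intro hausdorff_content_le)
        show "f ` A \<subseteq> (\<Union>i. f ` (C i \<inter> A))" using C(1) by blast
      qed (use C w in auto)
      also have "\<dots> \<le> (\<Sum>i. ennreal (L powr s) * hausdorff_weight s (C i))"
        using C w by (intro suminf_le summableI) auto
      finally show ?thesis by simp
    qed
    note 1 = this
    show ?thesis
      unfolding hausdorff_content_def[of s \<delta> A]
      by (rule ennreal_le_mult_INF) (use \<open>L > 0\<close> 1 in auto)
  qed
  show ?thesis
    unfolding hausdorff_outer_def[of s "f ` A"]
  proof (rule SUP_least)
    fix \<delta> :: real assume d: "\<delta> \<in> {0<..}"
    then have "hausdorff_content s \<delta> (f ` A) \<le> ennreal (L powr s) * hausdorff_content s (\<delta> / L) A"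
      using *[of "\<delta> / L"] \<open>L > 0\<close> by auto
    also have "\<dots> \<le> ennreal (L powr s) * hausdorff_outer s A"
      using d \<open>L > 0\<close> by (intro mult_left_mono hausdorff_content_le_outer) auto
    finally show "hausdorff_content s \<delta> (f ` A) \<le> ennreal (L powr s) * hausdorff_outer s A" .
  qed
qed

subsection \<open>Upper bounds for Hausdorff measure from densities\<close>

lemma hausdorff_weight_cball:
  fixes x :: "'a::euclidean_space"
  assumes "r > 0" "s \<ge> 0"
  shows "hausdorff_weight s (cball x r) = ennreal (unit_ball_vol s * r powr s)"
  using assms by (auto simp: hausdorff_weight_def)

text \<open>The density hypothesis converts weights of small balls into \<open>\<mu>\<close>-mass.
  Finitely many disjoint balls with union \<open>W\<close> are paid for at the sharp rate
  \<open>\<kappa>\<close> but leave a remainder; the balls enlarged five times leave none but cost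
  the factor \<open>5 powr s\<close>. Both estimates refer to the same \<open>W\<close>, so that one
  can be played off against the other. Finiteness makes \<open>W\<close> closed, hence
  \<open>U - W\<close> open, as an iteration requires.\<close>

lemma vitali_selection:
  fixes B :: "'a::euclidean_space set"
  assumes \<mu>: "finite_measure \<mu>" "sets \<mu> = sets borel"
    and "0 \<le> s" "0 < \<kappa>" "0 < \<delta>" "0 < e" "open U" "B \<subseteq> U"
    and dens: "\<And>x. x \<in> B \<Longrightarrow> \<forall>\<^sub>F r in at_right 0.
          hausdorff_weight s (cball x r) \<le> ennreal \<kappa> * emeasure \<mu> (cball x r)"
  obtains W where "closed W" "W \<subseteq> U"
    "hausdorff_content s \<delta> B \<le> ennreal (\<kappa> * measure \<mu> W) + hausdorff_content s \<delta> (B - W)"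
    "hausdorff_content s \<delta> B \<le> ennreal (5 powr s * \<kappa> * (measure \<mu> W + e))"
proof -
  interpret finite_measure \<mu> by fact
  \<comment> \<open>The bound \<open>10 * r \<le> \<delta>\<close> keeps the diameter of the
    enlarged ball of radius \<open>5 * r\<close> below \<open>\<delta>\<close>.\<close>
  define K where "K = {(x,r). x \<in> B \<and> 0 < r \<and> 10 * r \<le> \<delta> \<and> cball x r \<subseteq> U \<and>
      hausdorff_weight s (cball x r) \<le> ennreal \<kappa> * emeasure \<mu> (cball x r)}"
  have cov: "B \<subseteq> (\<Union>i\<in>K. cball (fst i) (snd i))"
  proof
    fix x assume x: "x \<in> B"
    then obtain e where e: "e > 0" "cball x e \<subseteq> U" using \<open>open U\<close> \<open>B \<subseteq> U\<close> open_contains_cball by blast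
    obtain r0 where r0: "r0 > 0" "\<And>r. 0 < r \<Longrightarrow> r < r0 \<Longrightarrow>
          hausdorff_weight s (cball x r) \<le> ennreal \<kappa> * emeasure \<mu> (cball x r)"
      using dens[OF x] by (auto simp: eventually_at_right_field)
    define r where "r = min (min (r0/2) (\<delta>/10)) e"
    have "(x, r) \<in> K" using r0 e x \<open>\<delta> > 0\<close> subset_cball[of r e x] by (auto simp: K_def r_def)
    then show "x \<in> (\<Union>i\<in>K. cball (fst i) (snd i))" by (intro UN_I[of "(x,r)"]) (auto simp: K_def)
  qed
  have bd: "0 < snd i \<and> snd i \<le> \<delta>" if "i \<in> K" for i using that by (auto simp: K_def)
  obtain C where C: "countable C" "C \<subseteq> K"
      "pairwise (\<lambda>i j. disjnt (cball (fst i) (snd i)) (cball (fst j) (snd j))) C"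
      "B \<subseteq> (\<Union>i\<in>C. cball (fst i) (5 * snd i))"
    by (rule Vitali_covering_lemma_cballs[OF cov bd])
  define g where "g = to_nat_on C"
  have g: "inj_on g C" unfolding g_def using C(1) by (rule inj_on_to_nat_on)
  \<comment> \<open>The selected family may be finite, so its enumeration is padded with empty sets,
    which have weight 0.\<close>
  define c where "c n = (if n \<in> g ` C then cball (fst (inv_into C g n)) (snd (inv_into C g n)) else {})" for n
  define c5 where "c5 n = (if n \<in> g ` C then cball (fst (inv_into C g n)) (5 * snd (inv_into C g n)) else {})" for n
  have cg: "c (g i) = cball (fst i) (snd i)" "c5 (g i) = cball (fst i) (5 * snd i)" if "i \<in> C" for i
    using that g by (auto simp: c_def c5_def)
  have cases: "(\<exists>i\<in>C. n = g i) \<or> (c n = {} \<and> c5 n = {})" for n by (auto simp: c_def c5_def)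
  have KD: "fst i \<in> B" "0 < snd i" "10 * snd i \<le> \<delta>" "cball (fst i) (snd i) \<subseteq> U"
      "hausdorff_weight s (cball (fst i) (snd i)) \<le> ennreal \<kappa> * emeasure \<mu> (cball (fst i) (snd i))" if "i \<in> C" for i
  proof -
    have "i \<in> K" using C(2) that by auto
    then show "fst i \<in> B" "0 < snd i" "10 * snd i \<le> \<delta>" "cball (fst i) (snd i) \<subseteq> U"
      "hausdorff_weight s (cball (fst i) (snd i)) \<le> ennreal \<kappa> * emeasure \<mu> (cball (fst i) (snd i))"
      by (simp_all add: K_def case_prod_unfold)
  qed
  have closed_c: "closed (c n)" for n using cases[of n] by (auto simp: cg)
  have sets_c [measurable]: "c n \<in> sets \<mu>" for n using closed_c \<mu> by auto
  have disj: "disjoint_family c"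
  proof (unfold disjoint_family_on_def, intro ballI impI)
    fix m n :: nat assume "m \<noteq> n"
    show "c m \<inter> c n = {}"
    proof (cases "c m = {} \<or> c n = {}")
      case False
      then obtain i j where ij: "i \<in> C" "j \<in> C" "m = g i" "n = g j" using cases[of m] cases[of n] by auto
      then have "i \<noteq> j" using \<open>m \<noteq> n\<close> by auto
      then show ?thesis using pairwiseD[OF C(3) ij(1,2)] ij by (simp add: cg disjnt_def)
    qed auto
  qed
  have w: "hausdorff_weight s (c n) \<le> ennreal \<kappa> * emeasure \<mu> (c n)"
     "hausdorff_weight s (c5 n) \<le> ennreal (5 powr s) * (ennreal \<kappa> * emeasure \<mu> (c n))"
     "bounded (c n)" "bounded (c5 n)" "diameter (c n) \<le> \<delta>" "diameter (c5 n) \<le> \<delta>" "c n \<subseteq> U" for n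
  proof -
    show w1: "hausdorff_weight s (c n) \<le> ennreal \<kappa> * emeasure \<mu> (c n)"
      using cases[of n] KD by (auto simp: cg)
    have "hausdorff_weight s (c5 n) = ennreal (5 powr s) * hausdorff_weight s (c n)"
      using cases[of n] KD \<open>0 \<le> s\<close>
      by (auto simp: cg hausdorff_weight_cball ennreal_mult'[symmetric] powr_mult ac_simps)
    then show "hausdorff_weight s (c5 n) \<le> ennreal (5 powr s) * (ennreal \<kappa> * emeasure \<mu> (c n))"
      using w1 by (simp add: mult_left_mono)
    have "bounded (c n) \<and> bounded (c5 n) \<and> diameter (c n) \<le> \<delta> \<and> diameter (c5 n) \<le> \<delta> \<and> c n \<subseteq> U"
    proof (cases "\<exists>i\<in>C. n = g i")
      case True
      then obtain i where i: "i \<in> C" "n = g i" by auto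
      show "bounded (c n) \<and> bounded (c5 n) \<and> diameter (c n) \<le> \<delta> \<and> diameter (c5 n) \<le> \<delta> \<and> c n \<subseteq> U"
        using KD(2-4)[OF i(1)] by (simp add: i cg)
    next
      case False
      then have "c n = {}" "c5 n = {}" using cases[of n] by auto
      then show "bounded (c n) \<and> bounded (c5 n) \<and> diameter (c n) \<le> \<delta> \<and> diameter (c5 n) \<le> \<delta> \<and> c n \<subseteq> U"
        using \<open>0 < \<delta>\<close> by simp
    qed
    then show "bounded (c n)" "bounded (c5 n)" "diameter (c n) \<le> \<delta>" "diameter (c5 n) \<le> \<delta>" "c n \<subseteq> U"
      by auto
  qed
  define WW where "WW n = (\<Union>i<n. c i)" for n
  \<comment> \<open>A finite subfamily already carries all but \<open>e\<close> of the mass of the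
    disjoint balls.\<close>
  have "(\<lambda>n. measure \<mu> (WW n)) \<longlonglongrightarrow> measure \<mu> (\<Union>n. WW n)"
    by (rule finite_Lim_measure_incseq) (auto simp: WW_def incseq_def intro: less_le_trans)
  moreover have "(\<Union>n. WW n) = (\<Union>i. c i)" by (auto simp: WW_def)
  ultimately have "\<forall>\<^sub>F n in sequentially. measure \<mu> (\<Union>i. c i) - e < measure \<mu> (WW n)"
    using \<open>0 < e\<close> by (intro order_tendstoD) auto
  then obtain n where n: "measure \<mu> (\<Union>i. c i) - e < measure \<mu> (WW n)"
    by (auto simp: eventually_sequentially)
  show ?thesis
  proof (rule that[of "WW n"])
    show "closed (WW n)" by (auto simp: WW_def closed_c)
    show "WW n \<subseteq> U" using w(7) by (fastforce simp: WW_def)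
    have "hausdorff_content s \<delta> (WW n) \<le> (\<Sum>i. hausdorff_weight s (if i < n then c i else {}))"
      using w \<open>0 < \<delta>\<close> by (intro hausdorff_content_le) (auto simp: WW_def)
    also have "\<dots> = (\<Sum>i<n. hausdorff_weight s (c i))"
      by (subst suminf_finite[of "{..<n}"]) auto
    also have "\<dots> \<le> (\<Sum>i<n. ennreal \<kappa> * emeasure \<mu> (c i))" by (intro sum_mono w)
    also have "\<dots> = ennreal \<kappa> * emeasure \<mu> (WW n)"
      unfolding WW_def sum_distrib_left[symmetric]
      by (subst sum_emeasure) (use disj in \<open>auto simp: disjoint_family_on_def\<close>)
    also have "\<dots> = ennreal (\<kappa> * measure \<mu> (WW n))"
      using \<open>0 < \<kappa>\<close> by (simp add: emeasure_eq_measure ennreal_mult')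
    finally have 1: "hausdorff_content s \<delta> (WW n) \<le> ennreal (\<kappa> * measure \<mu> (WW n))" .
    have "hausdorff_content s \<delta> B \<le> hausdorff_content s \<delta> (WW n \<union> (B - WW n))"
      by (intro hausdorff_content_mono) auto
    also have "\<dots> \<le> hausdorff_content s \<delta> (WW n) + hausdorff_content s \<delta> (B - WW n)"
      using \<open>0 < \<delta>\<close> by (intro hausdorff_content_Un) auto
    finally show "hausdorff_content s \<delta> B \<le> ennreal (\<kappa> * measure \<mu> (WW n)) + hausdorff_content s \<delta> (B - WW n)"
      using 1 by (meson add_right_mono order_trans)
    have "B \<subseteq> (\<Union>n. c5 n)"
      using C(4) by (auto simp: cg[symmetric])
    then have "hausdorff_content s \<delta> B \<le> (\<Sum>i. hausdorff_weight s (c5 i))"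
      using w by (intro hausdorff_content_le) auto
    also have "\<dots> \<le> (\<Sum>i. ennreal (5 powr s) * (ennreal \<kappa> * emeasure \<mu> (c i)))"
      using w by (intro suminf_le summableI) auto
    also have "\<dots> = ennreal (5 powr s) * (ennreal \<kappa> * emeasure \<mu> (\<Union>i. c i))"
    proof -
      have "(\<Sum>i. emeasure \<mu> (c i)) = emeasure \<mu> (\<Union>i. c i)"
        using disj by (intro suminf_emeasure) auto
      then show ?thesis by simp
    qed
    also have "\<dots> = ennreal (5 powr s * \<kappa> * measure \<mu> (\<Union>i. c i))"
      using \<open>0 < \<kappa>\<close> by (simp add: emeasure_eq_measure ennreal_mult' mult.assoc)
    also have "\<dots> \<le> ennreal (5 powr s * \<kappa> * (measure \<mu> (WW n) + e))"
      using n \<open>0 < \<kappa>\<close> by (intro ennreal_leI mult_left_mono) auto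
    finally show "hausdorff_content s \<delta> B \<le> ennreal (5 powr s * \<kappa> * (measure \<mu> (WW n) + e))" .
  qed
qed

text \<open>The factor \<open>5 powr s\<close> is removed by self-improvement: an admissible
  constant above \<open>\<kappa>\<close> can always be lowered, and the infimum of the admissible
  constants is itself admissible, so it equals \<open>\<kappa>\<close>.\<close>

theorem hausdorff_outer_le_density_open:
  fixes A :: "'a::euclidean_space set"
  assumes \<mu>: "finite_measure \<mu>" "sets \<mu> = sets borel"
    and s: "0 \<le> s" "0 < \<kappa>" and U: "open U" "A \<subseteq> U"
    and dens: "\<And>x. x \<in> A \<Longrightarrow> \<forall>\<^sub>F r in at_right 0.
          hausdorff_weight s (cball x r) \<le> ennreal \<kappa> * emeasure \<mu> (cball x r)"
  shows "hausdorff_outer s A \<le> ennreal (\<kappa> * measure \<mu> U)"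
proof -
  interpret finite_measure \<mu> by fact
  have "hausdorff_content s \<delta> A \<le> ennreal (\<kappa> * measure \<mu> U)" if \<delta>: "0 < \<delta>" for \<delta>
  proof -
    \<comment> \<open>All subsets \<open>B\<close> and all open supersets \<open>U\<close> are
      included so that the bound can be applied again to \<open>B - W\<close> inside
      \<open>U - W\<close>.\<close>
    define P where "P c \<longleftrightarrow> \<kappa> \<le> c \<and> (\<forall>B U. B \<subseteq> A \<longrightarrow> open U \<longrightarrow> B \<subseteq> U \<longrightarrow>
        hausdorff_content s \<delta> B \<le> ennreal (c * measure \<mu> U))" for c
    define K where "K = 5 powr s"
    have K: "K \<ge> 1" using s by (simp add: K_def ge_one_powr_ge_zero)
    have sel: "\<exists>W. closed W \<and> W \<subseteq> U \<and>
        hausdorff_content s \<delta> B \<le> ennreal (\<kappa> * measure \<mu> W) + hausdorff_content s \<delta> (B - W) \<and>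
        hausdorff_content s \<delta> B \<le> ennreal (K * \<kappa> * (measure \<mu> W + e))"
      if "B \<subseteq> A" "open U" "B \<subseteq> U" "e > 0" for B U e
      unfolding K_def
      by (rule vitali_selection[OF \<mu> s \<delta> that(4,2,3) dens]) (use that(1) in blast)+
    have measW: "measure \<mu> W \<le> measure \<mu> U" if "W \<subseteq> U" "open U" for W U
      using that \<mu> by (intro finite_measure_mono) auto
    have PK: "P (K * \<kappa>)"
      unfolding P_def
    proof (intro conjI allI impI)
      show "\<kappa> \<le> K * \<kappa>" using K s by simp
      fix B U assume *: "B \<subseteq> A" "open U" "B \<subseteq> U"
      show "hausdorff_content s \<delta> B \<le> ennreal (K * \<kappa> * measure \<mu> U)"
      proof (rule ennreal_le_epsilon)
        fix e :: real assume "0 < e"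
        obtain W where W: "W \<subseteq> U" "hausdorff_content s \<delta> B \<le> ennreal (K * \<kappa> * (measure \<mu> W + e / (K * \<kappa>)))"
          using sel[OF *, of "e / (K * \<kappa>)"] \<open>0 < e\<close> K s by auto
        note W(2)
        also have "\<dots> \<le> ennreal (K * \<kappa> * (measure \<mu> U + e / (K * \<kappa>)))"
          using measW[OF W(1) *(2)] K s by (intro ennreal_leI mult_left_mono) auto
        also have "\<dots> = ennreal (K * \<kappa> * measure \<mu> U) + ennreal e"
        proof -
          have "K * \<kappa> * (measure \<mu> U + e / (K * \<kappa>)) = K * \<kappa> * measure \<mu> U + e"
            using K s by (simp add: field_simps)
          then show ?thesis using K s \<open>0 < e\<close> by simp
        qed
        finally show "hausdorff_content s \<delta> B \<le> ennreal (K * \<kappa> * measure \<mu> U) + ennreal e" .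
      qed
    qed
    \<comment> \<open>Applying \<open>P c\<close> to the remainder gives
      \<open>x \<le> c \<mu>(U) - (c - \<kappa>) \<mu>(W)\<close>, and the enlarged balls give
      \<open>x \<le> K \<kappa> (\<mu>(W) + e')\<close>. The first is good if \<open>W\<close>
      carries much mass, the second if it carries little; eliminating \<open>\<mu>(W)\<close> yields
      the new constant.\<close>
    have improve: "P (c * (K * \<kappa>) / (K * \<kappa> + (c - \<kappa>)))" if c: "P c" for c
      unfolding P_def
    proof (intro conjI allI impI)
      have cl: "\<kappa> \<le> c" using c by (simp add: P_def)
      have "0 \<le> (K - 1) * \<kappa> * (c - \<kappa>)" using K s cl by simp
      moreover have "\<kappa> * (K * \<kappa> + (c - \<kappa>)) = c * (K * \<kappa>) - (K - 1) * \<kappa> * (c - \<kappa>)"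
        by (simp add: algebra_simps)
      moreover have "0 < K * \<kappa> + (c - \<kappa>)" using K s cl by (intro add_pos_nonneg) auto
      ultimately show "\<kappa> \<le> c * (K * \<kappa>) / (K * \<kappa> + (c - \<kappa>))"
        by (simp add: pos_le_divide_eq)
      fix B U assume *: "B \<subseteq> A" "open U" "B \<subseteq> U"
      define x where "x = enn2real (hausdorff_content s \<delta> B)"
      have "hausdorff_content s \<delta> B \<le> ennreal (K * \<kappa> * measure \<mu> U)" using PK * by (auto simp: P_def)
      then have x: "hausdorff_content s \<delta> B = ennreal x" "0 \<le> x"
        unfolding x_def using le_less_trans[OF _ ennreal_less_top] by (auto simp: ennreal_enn2real)
      have "x * (1 + (c - \<kappa>) / (K * \<kappa>)) \<le> c * measure \<mu> U"
      proof (rule field_le_epsilon)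
        fix e :: real assume "0 < e"
        define e' where "e' = e / (c - \<kappa> + 1)"
        have "0 < e'" using \<open>0 < e\<close> cl by (simp add: e'_def)
        obtain W where W: "closed W" "W \<subseteq> U"
          "hausdorff_content s \<delta> B \<le> ennreal (\<kappa> * measure \<mu> W) + hausdorff_content s \<delta> (B - W)"
          "hausdorff_content s \<delta> B \<le> ennreal (K * \<kappa> * (measure \<mu> W + e'))"
          using sel[OF * \<open>0 < e'\<close>] by auto
        have "B - W \<subseteq> A" "open (U - W)" "B - W \<subseteq> U - W" using * W(1) by auto
        then have "hausdorff_content s \<delta> (B - W) \<le> ennreal (c * measure \<mu> (U - W))"
          using c unfolding P_def by blast
        then have "ennreal x \<le> ennreal (\<kappa> * measure \<mu> W) + ennreal (c * measure \<mu> (U - W))"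
          using W(3) x by (metis add_left_mono order_trans)
        also have "\<dots> = ennreal (\<kappa> * measure \<mu> W + c * measure \<mu> (U - W))"
          using s cl by (intro ennreal_plus[symmetric]) auto
        finally have "x \<le> \<kappa> * measure \<mu> W + c * measure \<mu> (U - W)"
          using s cl by (subst (asm) ennreal_le_iff) auto
        moreover have "measure \<mu> (U - W) = measure \<mu> U - measure \<mu> W"
          using W * \<mu> by (intro finite_measure_Diff) auto
        ultimately have 1: "x \<le> c * measure \<mu> U - (c - \<kappa>) * measure \<mu> W" by (simp add: algebra_simps)
        have "x \<le> K * \<kappa> * (measure \<mu> W + e')"
          using W(4) x K s \<open>0 < e'\<close> by (subst (asm) x, subst (asm) ennreal_le_iff) auto
        then have "x / (K * \<kappa>) \<le> measure \<mu> W + e'" using K s by (simp add: field_simps)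
        then have "(c - \<kappa>) * (x / (K * \<kappa>)) \<le> (c - \<kappa>) * (measure \<mu> W + e')" using cl by (intro mult_left_mono) auto
        moreover have "(c - \<kappa>) * e' \<le> e" using cl \<open>0 < e\<close> by (simp add: e'_def field_simps)
        ultimately show "x * (1 + (c - \<kappa>) / (K * \<kappa>)) \<le> c * measure \<mu> U + e"
          using 1 by (simp add: algebra_simps)
      qed
      moreover have "0 < 1 + (c - \<kappa>) / (K * \<kappa>)" using cl K s by (simp add: add_pos_nonneg)
      ultimately have "x \<le> c * measure \<mu> U / (1 + (c - \<kappa>) / (K * \<kappa>))" by (simp add: pos_le_divide_eq)
      also have "\<dots> = c * (K * \<kappa>) / (K * \<kappa> + (c - \<kappa>)) * measure \<mu> U"
        using K s cl by (simp add: field_simps)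
      finally show "hausdorff_content s \<delta> B \<le> ennreal (c * (K * \<kappa>) / (K * \<kappa> + (c - \<kappa>)) * measure \<mu> U)"
        unfolding x by (rule ennreal_leI)
    qed
    define c0 where "c0 = Inf {c. P c}"
    have bdd: "bdd_below {c. P c}" by (rule bdd_belowI[of _ \<kappa>]) (auto simp: P_def)
    have ne: "{c. P c} \<noteq> {}" using PK by auto
    have c0: "\<kappa> \<le> c0" unfolding c0_def using ne by (intro cInf_greatest) (auto simp: P_def)
    have P0: "P c0"
      unfolding P_def
    proof (intro conjI allI impI c0)
      fix B U assume *: "B \<subseteq> A" "open U" "B \<subseteq> U"
      define x where "x = enn2real (hausdorff_content s \<delta> B)"
      have "hausdorff_content s \<delta> B \<le> ennreal (K * \<kappa> * measure \<mu> U)" using PK * by (auto simp: P_def)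
      then have x: "hausdorff_content s \<delta> B = ennreal x" "0 \<le> x"
        unfolding x_def using le_less_trans[OF _ ennreal_less_top] by (auto simp: ennreal_enn2real)
      have xc: "x \<le> c * measure \<mu> U" if "P c" for c
      proof -
        have "ennreal x \<le> ennreal (c * measure \<mu> U)" using that * x by (auto simp: P_def)
        moreover have "0 \<le> c * measure \<mu> U" using that s by (auto simp: P_def)
        ultimately show ?thesis by (simp add: ennreal_le_iff)
      qed
      have "x \<le> c0 * measure \<mu> U"
      proof (cases "measure \<mu> U = 0")
        case True
        then show ?thesis using xc[OF PK] by simp
      next
        case False
        then have "measure \<mu> U > 0" by (simp add: zero_less_measure_iff)
        then have "x / measure \<mu> U \<le> c" if "P c" for c using xc[OF that] by (simp add: field_simps)
        then have "x / measure \<mu> U \<le> c0" unfolding c0_def using ne by (intro cInf_greatest) auto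
        then show ?thesis using \<open>measure \<mu> U > 0\<close> by (simp add: field_simps)
      qed
      then show "hausdorff_content s \<delta> B \<le> ennreal (c0 * measure \<mu> U)" unfolding x by (rule ennreal_leI)
    qed
    \<comment> \<open>Improving \<open>c0\<close> would give an admissible constant below the
      infimum unless \<open>c0 = \<kappa>\<close>.\<close>
    have "c0 \<le> \<kappa>"
    proof (rule ccontr)
      assume "\<not> c0 \<le> \<kappa>"
      then have "0 < K * \<kappa> + (c0 - \<kappa>)" "0 < c0 * (c0 - \<kappa>)" using K s c0 by (auto intro!: add_pos_pos mult_pos_pos)
      then have "c0 * (K * \<kappa>) / (K * \<kappa> + (c0 - \<kappa>)) < c0"
        by (simp add: pos_divide_less_eq distrib_left)
      moreover have "c0 \<le> c0 * (K * \<kappa>) / (K * \<kappa> + (c0 - \<kappa>))"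
        unfolding c0_def using improve[OF P0] bdd by (intro cInf_lower) (auto simp: c0_def)
      ultimately show False by simp
    qed
    then show ?thesis using P0 c0 U by (auto simp: P_def)
  qed
  then show ?thesis by (intro hausdorff_content_le_outer_limit[OF _ zero_less_one]) auto
qed

text \<open>Outer regularity of a finite Borel measure replaces the open superset by
  \<open>A\<close> itself.\<close>

corollary hausdorff_outer_le_density:
  fixes A :: "'a::euclidean_space set"
  assumes \<mu>: "finite_measure \<mu>" "sets \<mu> = sets borel" and "0 \<le> s" "0 < \<kappa>" "A \<in> sets borel"
    and dens: "\<And>x. x \<in> A \<Longrightarrow> \<forall>\<^sub>F r in at_right 0.
          hausdorff_weight s (cball x r) \<le> ennreal \<kappa> * emeasure \<mu> (cball x r)"
  shows "hausdorff_outer s A \<le> ennreal \<kappa> * emeasure \<mu> A"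
proof -
  interpret finite_measure \<mu> by fact
  have *: "hausdorff_outer s A \<le> ennreal \<kappa> * emeasure \<mu> U" if "A \<subseteq> U" "open U" for U
  proof -
    have "hausdorff_outer s A \<le> ennreal (\<kappa> * measure \<mu> U)"
      using assms that by (intro hausdorff_outer_le_density_open) auto
    also have "\<dots> = ennreal \<kappa> * emeasure \<mu> U"
      using \<open>0 < \<kappa>\<close> by (simp add: emeasure_eq_measure ennreal_mult')
    finally show ?thesis .
  qed
  have "emeasure \<mu> (space \<mu>) \<noteq> \<infinity>" by (simp add: emeasure_eq_measure)
  show ?thesis
    by (subst outer_regular[OF \<mu>(2) _ \<open>A \<in> sets borel\<close>], fact, rule ennreal_le_mult_INF)
       (use * \<open>0 < \<kappa>\<close> in auto)
qed

subsection \<open>Rotation invariance and solids of revolution\<close>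

lemma lborel_distr_translation:
  fixes a :: "'a::euclidean_space"
  shows "distr lborel borel (\<lambda>x. a + x) = lborel"
  using lborel_affine[of 1 a] by (simp add: density_1 one_ennreal_def[symmetric])

lemma nn_integral_translation:
  fixes a :: "'a::euclidean_space"
  assumes [measurable]: "f \<in> borel_measurable borel"
  shows "(\<integral>\<^sup>+x. f (a + x) \<partial>lborel) = (\<integral>\<^sup>+x. f x \<partial>lborel)"
  by (subst (2) lborel_distr_translation[of a, symmetric], subst nn_integral_distr) auto

text \<open>Uniqueness of the translation-invariant measure, normalised on the unit ball rather than
  a cube because orthogonal maps preserve the ball. The ball is also symmetric about 0, which turns
  \<open>x - y\<close> into \<open>y - x\<close> when the inner integral is evaluated.\<close>

lemma translation_invariant_eq_lborel:
  fixes M :: "'a::euclidean_space measure"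
  assumes M: "sigma_finite_measure M" "sets M = sets borel"
    and inv: "\<And>a. distr M borel (\<lambda>x. a + x) = M"
    and unit: "emeasure M (cball 0 1) = emeasure lborel (cball 0 (1::real) :: 'a set)"
  shows "M = lborel"
proof (rule measure_eqI)
  interpret M: sigma_finite_measure M by fact
  interpret pair_sigma_finite M lborel ..
  note [measurable_cong] = M(2)
  let ?B = "cball 0 1 :: 'a set"
  have sB: "?B \<in> sets borel" by simp
  have inv': "(\<integral>\<^sup>+x. f (a + x) \<partial>M) = (\<integral>\<^sup>+x. f x \<partial>M)" if [measurable]: "f \<in> borel_measurable borel" for f a
    by (subst (2) inv[of a, symmetric], subst nn_integral_distr) auto
  fix A assume "A \<in> sets M"
  then have A: "A \<in> sets borel" using M by simp
  have mA[measurable]: "(indicator A :: 'a \<Rightarrow> ennreal) \<in> borel_measurable borel" using A by (rule borel_measurable_indicator)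
  have mB[measurable]: "(indicator ?B :: 'a \<Rightarrow> ennreal) \<in> borel_measurable borel" using sB by (rule borel_measurable_indicator)
  \<comment> \<open>Both translation invariances are applied to the integral of \<open>1\<^sub>A(x + y) 1\<^sub>B(x)\<close>.\<close>
  have "emeasure M A * emeasure lborel ?B = (\<integral>\<^sup>+x. (\<integral>\<^sup>+y. indicator A y * indicator ?B x \<partial>M) \<partial>lborel)"
    using A M(2) by (simp add: nn_integral_multc nn_integral_cmult)
  also have "\<dots> = (\<integral>\<^sup>+x. (\<integral>\<^sup>+y. indicator A (x + y) * indicator ?B x \<partial>M) \<partial>lborel)"
    by (intro nn_integral_cong inv'[symmetric, of "\<lambda>y. indicator A y * indicator ?B _"]) measurable
  also have "\<dots> = (\<integral>\<^sup>+y. (\<integral>\<^sup>+x. indicator A (x + y) * indicator ?B x \<partial>lborel) \<partial>M)"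
    by (rule Fubini') measurable
  also have "\<dots> = (\<integral>\<^sup>+y. (\<integral>\<^sup>+x. indicator A x * indicator ?B (x - y) \<partial>lborel) \<partial>M)"
  proof (rule nn_integral_cong)
    fix y
    show "(\<integral>\<^sup>+x. indicator A (x + y) * indicator ?B x \<partial>lborel) = (\<integral>\<^sup>+x. indicator A x * indicator ?B (x - y) \<partial>lborel)"
      using nn_integral_translation[of "\<lambda>x. indicator A x * indicator ?B (x - y) :: ennreal" y]
      by (simp add: add.commute)
  qed
  also have "\<dots> = (\<integral>\<^sup>+x. (\<integral>\<^sup>+y. indicator A x * indicator ?B (x - y) \<partial>M) \<partial>lborel)"
    by (rule Fubini'[symmetric]) measurable
  also have "\<dots> = (\<integral>\<^sup>+x. indicator A x * emeasure M ?B \<partial>lborel)"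
  proof (rule nn_integral_cong)
    fix x
    have "(\<integral>\<^sup>+y. indicator A x * indicator ?B (x - y) \<partial>M) = indicator A x * (\<integral>\<^sup>+y. indicator ?B (x - y) \<partial>M)"
      by (rule nn_integral_cmult) measurable
    also have "(\<integral>\<^sup>+y. indicator ?B (x - y) \<partial>M) = (\<integral>\<^sup>+y. indicator ?B (- x + y) \<partial>M)"
      by (intro nn_integral_cong) (auto simp: indicator_def norm_minus_commute)
    also have "\<dots> = (\<integral>\<^sup>+y. indicator ?B y \<partial>M)" by (rule inv') measurable
    also have "\<dots> = emeasure M ?B" using sB M(2) by simp
    finally show "(\<integral>\<^sup>+y. indicator A x * indicator ?B (x - y) \<partial>M) = indicator A x * emeasure M ?B" .
  qed
  also have "\<dots> = emeasure lborel A * emeasure M ?B" using A by (simp add: nn_integral_multc)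
  finally have "emeasure M A * emeasure lborel ?B = emeasure lborel A * emeasure lborel ?B"
    by (simp add: unit)
  moreover have "emeasure lborel ?B \<noteq> 0" "emeasure lborel ?B \<noteq> top"
    using content_cball_pos[of 1 "0::'a"] emeasure_compact_finite[of ?B]
    by (auto simp: measure_def)
  ultimately show "emeasure M A = emeasure lborel A"
    by (metis mult.commute ennreal_mult_cancel_left infinity_ennreal_def)
qed (use assms in auto)

text \<open>The image measure is again translation invariant, since a shift by \<open>T b\<close>
  after \<open>T\<close> is a shift by \<open>b\<close> before it, and it agrees with Lebesgue
  measure on the unit ball.\<close>

lemma lborel_distr_orthogonal:
  fixes T :: "'a::euclidean_space \<Rightarrow> 'a"
  assumes T: "orthogonal_transformation T"
  shows "distr lborel borel T = lborel"
proof (rule translation_invariant_eq_lborel)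
  have lin: "linear T" using T by (rule orthogonal_transformation_linear)
  then have [measurable]: "T \<in> borel_measurable borel"
    by (intro borel_measurable_continuous_onI linear_continuous_on linear_conv_bounded_linear[THEN iffD1])
  have T_ball: "T -` cball 0 r = cball 0 r" for r
    using orthogonal_transformation_norm[OF T] by auto
  show unit: "emeasure (distr lborel borel T) (cball 0 1) = emeasure lborel (cball 0 1 :: 'a set)"
    by (subst emeasure_distr) (auto simp: T_ball)
  show "sigma_finite_measure (distr lborel borel T)"
  proof (intro sigma_finite_measure.intro exI[of _ "range (\<lambda>n. cball 0 (real n))"] conjI ballI)
    show "\<Union> (range (\<lambda>n. cball (0::'a) (real n))) = space (distr lborel borel T)"
      by (auto simp: real_arch_simple)
    fix A :: "'a set" assume "A \<in> range (\<lambda>n. cball 0 (real n))"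
    then obtain n where "A = cball 0 (real n)" by auto
    then show "emeasure (distr lborel borel T) A \<noteq> \<infinity>"
      using emeasure_compact_finite[of "cball (0::'a) (real n)"] by (subst emeasure_distr) (auto simp: T_ball)
  qed auto
  fix a
  obtain b where b: "a = T b" using orthogonal_transformation_surj[OF T] by (metis surjD)
  have "distr (distr lborel borel T) borel (\<lambda>x. a + x) = distr lborel borel (\<lambda>x. T (b + x))"
    by (subst distr_distr) (auto simp: b linear_add[OF lin] comp_def)
  also have "\<dots> = distr (distr lborel borel (\<lambda>x. b + x)) borel T"
    by (subst distr_distr) (auto simp: comp_def)
  finally show "distr (distr lborel borel T) borel (\<lambda>x. a + x) = distr lborel borel T"
    by (simp add: lborel_distr_translation)
qed auto

section \<open>Projection along a unit vector and Cavalieri's principle\<close>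

definition proj_perp :: "'a::real_inner \<Rightarrow> 'a \<Rightarrow> 'a" where
  "proj_perp \<nu> y = y - (y \<bullet> \<nu>) *\<^sub>R \<nu>"

lemma continuous_on_proj_perp [continuous_intros]:
  "continuous_on S f \<Longrightarrow> continuous_on S (\<lambda>x. proj_perp \<nu> (f x))"
  unfolding proj_perp_def by (intro continuous_intros)

lemma measurable_proj_perp [measurable]:
  "proj_perp (\<nu> :: 'a::euclidean_space) \<in> borel_measurable borel"
  by (intro borel_measurable_continuous_onI continuous_intros)

lemma linear_proj_perp: "linear (proj_perp \<nu>)"
  by (rule linearI) (auto simp: proj_perp_def algebra_simps)

text \<open>Cavalieri's principle: the coordinate along \<open>b\<close> is integrated last, and the
  slice at height \<open>t\<close> is a ball of radius \<open>\<rho> t\<close> in the remaining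
  coordinates.\<close>

lemma emeasure_solid_of_revolution_Basis:
  fixes b :: "'a::euclidean_space"
  assumes b: "b \<in> Basis" and [measurable]: "I \<in> sets borel" "\<rho> \<in> borel_measurable borel"
    and pos: "\<And>t. t \<in> I \<Longrightarrow> 0 < \<rho> t"
  shows "emeasure lborel {y. y \<bullet> b \<in> I \<and> norm (proj_perp b y) \<le> \<rho> (y \<bullet> b)} =
    (\<integral>\<^sup>+t\<in>I. ennreal (unit_ball_vol (real (DIM('a) - 1)) * \<rho> t ^ (DIM('a) - 1)) \<partial>lborel)"
proof -
  let ?A = "Basis - {b}"
  let ?S = "{y. y \<bullet> b \<in> I \<and> norm (proj_perp b y) \<le> \<rho> (y \<bullet> b)}"
  have ins: "insert b ?A = Basis" using b by auto
  have card: "card ?A = DIM('a) - 1" using b by (simp add: card_Diff_singleton)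
  have S[measurable]: "?S \<in> sets borel" by measurable
  interpret product_sigma_finite "\<lambda>_::'a. lborel :: real measure" by standard
  let ?P = "\<lambda>B. Pi\<^sub>M B (\<lambda>_::'a. lborel :: real measure)"
  define \<Phi> where "\<Phi> f = (\<Sum>i\<in>Basis. f i *\<^sub>R i)" for f :: "'a \<Rightarrow> real"
  have \<Phi>[measurable]: "\<Phi> \<in> measurable (?P Basis) borel" unfolding \<Phi>_def by measurable
  have inner: "\<Phi> f \<bullet> i = f i" if "i \<in> Basis" for f i
    using that by (simp add: \<Phi>_def inner_sum_left inner_Basis if_distrib cong: if_cong)
  have nrm: "norm (proj_perp b (\<Phi> f)) = sqrt (\<Sum>i\<in>?A. (f i)\<^sup>2)" for f
  proof -
    have "proj_perp b (\<Phi> f) \<bullet> i = (if i = b then 0 else f i)" if "i \<in> Basis" for i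
      using that b by (auto simp: proj_perp_def inner_diff_left inner inner_Basis)
    then have "norm (proj_perp b (\<Phi> f)) = sqrt (\<Sum>i\<in>Basis. (if i = b then 0 else f i)\<^sup>2)"
      by (subst norm_eq_sqrt_inner, subst euclidean_inner) (simp add: power2_eq_square cong: sum.cong)
    also have "(\<Sum>i\<in>Basis. (if i = b then 0 else f i)\<^sup>2) = (\<Sum>i\<in>?A. (f i)\<^sup>2)"
      by (rule sum.mono_neutral_cong_right) auto
    finally show ?thesis .
  qed
  have "emeasure lborel ?S = (\<integral>\<^sup>+f. indicator ?S (\<Phi> f) \<partial>?P Basis)"
    using S by (subst lborel_eq, subst nn_integral_indicator[symmetric], simp,
        subst nn_integral_distr) (auto simp: \<Phi>_def)
  also have "\<dots> = (\<integral>\<^sup>+f. indicator ?S (\<Phi> f) \<partial>?P (insert b ?A))" by (simp only: ins)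
  also have "\<dots> = (\<integral>\<^sup>+t. (\<integral>\<^sup>+f. indicator ?S (\<Phi> (f(b := t))) \<partial>?P ?A) \<partial>lborel)"
    by (rule product_nn_integral_insert_rev) (simp, simp, unfold ins, measurable)
  also have "\<dots> = (\<integral>\<^sup>+t. indicator I t * ennreal (unit_ball_vol (real (card ?A)) * \<rho> t ^ card ?A) \<partial>lborel)"
  proof (rule nn_integral_cong)
    fix t
    show "(\<integral>\<^sup>+f. indicator ?S (\<Phi> (f(b := t))) \<partial>?P ?A) = indicator I t * ennreal (unit_ball_vol (real (card ?A)) * \<rho> t ^ card ?A)"
    proof (cases "t \<in> I")
      case True
      have "(\<integral>\<^sup>+f. indicator ?S (\<Phi> (f(b := t))) \<partial>?P ?A)
         = (\<integral>\<^sup>+f. indicator ({f. sqrt (\<Sum>i\<in>?A. (f i)\<^sup>2) \<le> \<rho> t} \<inter> space (?P ?A)) f \<partial>?P ?A)"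
        using True by (intro nn_integral_cong) (auto simp: indicator_def nrm inner[OF b])
      also have "\<dots> = ennreal (unit_ball_vol (real (card ?A)) * \<rho> t ^ card ?A)"
        using emeasure_cball_aux[of ?A "\<rho> t"] pos[OF True] by (subst nn_integral_indicator) auto
      finally show ?thesis using True by simp
    qed (auto simp: inner[OF b])
  qed
  finally show ?thesis by (simp add: card mult.commute)
qed

lemma emeasure_solid_of_revolution:
  fixes \<nu> :: "real^'n"
  assumes \<nu>: "norm \<nu> = 1" and [measurable]: "I \<in> sets borel" "\<rho> \<in> borel_measurable borel"
    and pos: "\<And>t. t \<in> I \<Longrightarrow> 0 < \<rho> t"
  shows "emeasure lborel {y. y \<bullet> \<nu> \<in> I \<and> norm (proj_perp \<nu> y) \<le> \<rho> (y \<bullet> \<nu>)} =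
    (\<integral>\<^sup>+t\<in>I. ennreal (unit_ball_vol (real (CARD('n) - 1)) * \<rho> t ^ (CARD('n) - 1)) \<partial>lborel)"
proof -
  obtain b :: "real^'n" where b: "b \<in> Basis" using nonempty_Basis by blast
  then have "norm b = norm \<nu>" using \<nu> by simp
  then obtain T where T: "orthogonal_transformation T" "T b = \<nu>" by (rule orthogonal_transformation_exists)
  let ?S = "\<lambda>\<nu>. {y. y \<bullet> \<nu> \<in> I \<and> norm (proj_perp \<nu> y) \<le> \<rho> (y \<bullet> \<nu>)}"
  have lin: "linear T" using T by (rule_tac orthogonal_transformation_linear)
  then have [measurable]: "T \<in> borel_measurable borel"
    by (intro borel_measurable_continuous_onI linear_continuous_on linear_conv_bounded_linear[THEN iffD1])
  have ip: "T y \<bullet> \<nu> = y \<bullet> b" for y using T by (metis orthogonal_transformation_def)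
  have pp: "norm (proj_perp \<nu> (T y)) = norm (proj_perp b y)" for y
  proof -
    have "proj_perp \<nu> (T y) = T (proj_perp b y)"
      by (simp add: proj_perp_def ip linear_diff[OF lin] linear_scale[OF lin] T(2))
    then show ?thesis using orthogonal_transformation_norm[OF T(1)] by simp
  qed
  have "emeasure lborel (?S \<nu>) = emeasure (distr lborel borel T) (?S \<nu>)"
    by (simp add: lborel_distr_orthogonal[OF T(1)])
  also have "\<dots> = emeasure lborel (T -` ?S \<nu>)" by (subst emeasure_distr) auto
  also have "T -` ?S \<nu> = ?S b" by (auto simp: ip pp)
  also have "emeasure lborel (?S b) = (\<integral>\<^sup>+t\<in>I. ennreal (unit_ball_vol (real (DIM(real^'n) - 1)) * \<rho> t ^ (DIM(real^'n) - 1)) \<partial>lborel)"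
    by (rule emeasure_solid_of_revolution_Basis[OF b]) (use pos in auto)
  finally show ?thesis by simp
qed

subsection \<open>Prisms over nearly flat sets\<close>

text \<open>The image under the identity cuts the Caratheodory sigma-algebra, which may be larger,
  down to the Borel sets. Regularity theorems and the comparison of measures then apply.\<close>

definition hausdorff_on :: "real \<Rightarrow> 'a::metric_space set \<Rightarrow> 'a measure" where
  "hausdorff_on s S = distr (density (hausdorff_measure s) (indicator S)) borel (\<lambda>x. x)"

lemma sets_hausdorff_on [simp, measurable_cong]: "sets (hausdorff_on s S) = sets borel"
  by (simp add: hausdorff_on_def)

lemma measurable_hausdorff_borel:
  "f \<in> borel_measurable borel \<Longrightarrow> f \<in> borel_measurable (hausdorff_measure s :: 'a::metric_space measure)"
  using borel_subset_hausdorff[of s] measurable_sets_borel[of f borel]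
  by (intro measurableI) auto

lemma emeasure_hausdorff_on:
  fixes S :: "'a::metric_space set"
  assumes S: "S \<in> sets borel" and A: "A \<in> sets borel"
  shows "emeasure (hausdorff_on s S) A = hausdorff_outer s (S \<inter> A)"
proof -
  have S': "S \<in> sets (hausdorff_measure s)" and A': "A \<in> sets (hausdorff_measure s)"
    using S A borel_subset_hausdorff[of s] by auto
  have id: "(\<lambda>x. x) \<in> measurable (density (hausdorff_measure s) (indicator S)) (borel :: 'a measure)"
    using measurable_hausdorff_borel[of "\<lambda>x. x" s] by simp
  have "emeasure (hausdorff_on s S) A = emeasure (density (hausdorff_measure s) (indicator S)) A"
    unfolding hausdorff_on_def by (subst emeasure_distr[OF id]) (auto simp: A)
  also have "\<dots> = (\<integral>\<^sup>+x. indicator S x * indicator A x \<partial>hausdorff_measure s)"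
    by (rule emeasure_density) (use S' A' in auto)
  also have "\<dots> = (\<integral>\<^sup>+x. indicator (S \<inter> A) x \<partial>hausdorff_measure s)"
    by (intro nn_integral_cong) (auto simp: indicator_def)
  also have "\<dots> = emeasure (hausdorff_measure s) (S \<inter> A)"
    using S' A' by (intro nn_integral_indicator) auto
  also have "\<dots> = hausdorff_outer s (S \<inter> A)"
    using S A by (intro emeasure_hausdorff_borel) auto
  finally show ?thesis .
qed

lemma nn_integral_hausdorff_on:
  fixes S :: "'a::metric_space set"
  assumes S: "S \<in> sets borel" and g: "g \<in> borel_measurable borel"
  shows "(\<integral>\<^sup>+x\<in>S. g x \<partial>hausdorff_measure s) = (\<integral>\<^sup>+x. g x \<partial>hausdorff_on s S)"
proof -
  have S': "S \<in> sets (hausdorff_measure s)"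
    using S borel_subset_hausdorff[of s] by auto
  have id: "(\<lambda>x. x) \<in> measurable (density (hausdorff_measure s) (indicator S)) (borel :: 'a measure)"
    using measurable_hausdorff_borel[of "\<lambda>x. x" s] by simp
  show ?thesis
    unfolding hausdorff_on_def
    by (subst nn_integral_distr[OF id], simp add: g, subst nn_integral_density)
       (use S' measurable_hausdorff_borel[OF g] in \<open>auto simp: mult.commute\<close>)
qed

lemma emeasure_lborel_translation:
  fixes S :: "'a::euclidean_space set"
  assumes "S \<in> sets borel"
  shows "emeasure lborel ((+) a ` S) = emeasure lborel S"
proof -
  have "(+) a ` S = (\<lambda>x. - a + x) -` S"
    by (auto simp: image_iff) (metis add.commute add.left_neutral add_uminus_conv_diff diff_add_cancel)
  moreover have "emeasure lborel S = emeasure (distr lborel borel (\<lambda>x. - a + x)) S"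
    by (simp only: lborel_distr_translation)
  ultimately show ?thesis using assms by (simp add: emeasure_distr)
qed

text \<open>If \<open>\<nu>\<close> is a unit vector and distinct points of \<open>C\<close> have
  distinct projections along it, the volume of the prism is \<open>s\<close> times the area of the
  projection. Volumes of prisms thus play the part of projected areas.\<close>

definition prism :: "'a::real_normed_vector \<Rightarrow> real \<Rightarrow> 'a set \<Rightarrow> 'a set" where
  "prism \<nu> s C = (\<lambda>(c, t). c + t *\<^sub>R \<nu>) ` (C \<times> {0..s})"

lemma compact_prism [intro]: "compact C \<Longrightarrow> compact (prism \<nu> s C)"
  unfolding prism_def case_prod_beta
  by (intro compact_continuous_image compact_Times compact_Icc continuous_intros)

lemma mem_prism: "y \<in> prism \<nu> s C \<longleftrightarrow> (\<exists>c\<in>C. \<exists>t. 0 \<le> t \<and> t \<le> s \<and> y = c + t *\<^sub>R \<nu>)"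
proof
  assume "y \<in> prism \<nu> s C"
  then show "\<exists>c\<in>C. \<exists>t. 0 \<le> t \<and> t \<le> s \<and> y = c + t *\<^sub>R \<nu>" unfolding prism_def by fastforce
next
  assume "\<exists>c\<in>C. \<exists>t. 0 \<le> t \<and> t \<le> s \<and> y = c + t *\<^sub>R \<nu>"
  then obtain c t where "c \<in> C" "0 \<le> t" "t \<le> s" "y = c + t *\<^sub>R \<nu>" by blast
  then show "y \<in> prism \<nu> s C" unfolding prism_def by (intro image_eqI[of _ _ "(c, t)"]) auto
qed

lemma prism_borel [measurable]:
  fixes C :: "'a::euclidean_space set"
  shows "compact C \<Longrightarrow> prism \<nu> s C \<in> sets borel"
  using compact_prism by (intro borel_closed compact_imp_closed)

lemma translation_borel:
  fixes S :: "'a::euclidean_space set"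
  assumes "S \<in> sets borel" shows "(+) a ` S \<in> sets borel"
proof -
  have "(+) a ` S = (\<lambda>x. - a + x) -` S"
    by (auto simp: image_iff) (metis add.commute add.left_neutral add_uminus_conv_diff diff_add_cancel)
  moreover have "(\<lambda>x. - a + x) -` S \<in> sets borel"
    by (rule measurable_sets_borel[OF _ assms]) measurable
  ultimately show ?thesis by simp
qed

text \<open>A tall prism is covered by \<open>\<lfloor>h / s\<rfloor> + 1\<close> translates of a
  low one. The surplus translate is harmless because the estimate is used where \<open>h / s\<close>
  tends to infinity.\<close>

lemma emeasure_prism_le:
  fixes C :: "'a::euclidean_space set"
  assumes "compact C" "0 < s" "0 \<le> h"
  shows "emeasure lborel (prism \<nu> h C) \<le> ennreal (h / s + 1) * emeasure lborel (prism \<nu> s C)"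
proof -
  define n where "n = nat \<lfloor>h / s\<rfloor> + 1"
  have bor: "prism \<nu> s C \<in> sets borel" using compact_prism[OF assms(1), of \<nu> s] by (intro borel_closed compact_imp_closed)
  have "prism \<nu> h C \<subseteq> (\<Union>i<n. (+) ((real i * s) *\<^sub>R \<nu>) ` prism \<nu> s C)"
  proof
    fix y assume "y \<in> prism \<nu> h C"
    then obtain c t where ct: "c \<in> C" "0 \<le> t" "t \<le> h" "y = c + t *\<^sub>R \<nu>" by (auto simp: mem_prism)
    define i where "i = nat \<lfloor>t / s\<rfloor>"
    have "real i = of_int \<lfloor>t / s\<rfloor>" using ct \<open>0 < s\<close> by (simp add: i_def)
    then have "real i \<le> t / s" "t / s \<le> real i + 1" by linarith+
    then have i: "real i * s \<le> t" "t \<le> real i * s + s" using \<open>0 < s\<close> by (auto simp: field_simps)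
    have "t / s \<le> h / s" using ct \<open>0 < s\<close> by (simp add: divide_right_mono)
    then have "i < n" unfolding i_def n_def by (simp add: floor_mono nat_mono less_Suc_eq_le)
    moreover have "c + (t - real i * s) *\<^sub>R \<nu> \<in> prism \<nu> s C"
      unfolding mem_prism using ct i by (intro bexI[of _ c] exI[of _ "t - real i * s"]) auto
    then have "(real i * s) *\<^sub>R \<nu> + (c + (t - real i * s) *\<^sub>R \<nu>) \<in> (+) ((real i * s) *\<^sub>R \<nu>) ` prism \<nu> s C" by (rule imageI)
    moreover have "y = (real i * s) *\<^sub>R \<nu> + (c + (t - real i * s) *\<^sub>R \<nu>)" by (simp add: ct algebra_simps)
    ultimately show "y \<in> (\<Union>i<n. (+) ((real i * s) *\<^sub>R \<nu>) ` prism \<nu> s C)" by auto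
  qed
  moreover have tr: "(+) a ` prism \<nu> s C \<in> sets borel" for a
    using compact_translation[OF compact_prism[OF assms(1), of \<nu> s], of a] by (intro borel_closed compact_imp_closed)
  ultimately have "emeasure lborel (prism \<nu> h C) \<le> emeasure lborel (\<Union>i<n. (+) ((real i * s) *\<^sub>R \<nu>) ` prism \<nu> s C)"
    by (intro emeasure_mono) auto
  also have "\<dots> \<le> (\<Sum>i<n. emeasure lborel ((+) ((real i * s) *\<^sub>R \<nu>) ` prism \<nu> s C))"
    using tr by (intro emeasure_subadditive_finite) auto
  also have "\<dots> = ennreal (real n) * emeasure lborel (prism \<nu> s C)"
    using bor by (simp add: emeasure_lborel_translation ennreal_of_nat_eq_real_of_nat)
  also have "\<dots> \<le> ennreal (h / s + 1) * emeasure lborel (prism \<nu> s C)"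
    using assms by (intro mult_right_mono ennreal_leI) (auto simp: n_def)
  finally show ?thesis .
qed

lemma inner_proj_perp: "norm \<nu> = 1 \<Longrightarrow> proj_perp \<nu> y \<bullet> \<nu> = 0"
  by (simp add: proj_perp_def inner_diff_left dot_square_norm)

lemma norm_proj_perp_sq:
  assumes "norm \<nu> = 1" shows "(norm y)\<^sup>2 = (norm (proj_perp \<nu> y))\<^sup>2 + (y \<bullet> \<nu>)\<^sup>2"
proof -
  define t where "t = y \<bullet> \<nu>"
  define w where "w = proj_perp \<nu> y"
  have y: "y = w + t *\<^sub>R \<nu>" by (simp add: w_def t_def proj_perp_def)
  have "w \<bullet> \<nu> = 0" "\<nu> \<bullet> w = 0" "\<nu> \<bullet> \<nu> = 1"
    using inner_proj_perp[OF assms, of y] assms by (auto simp: w_def inner_commute norm_eq_1)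
  then have "(norm y)\<^sup>2 = (norm w)\<^sup>2 + t\<^sup>2"
    unfolding power2_norm_eq_inner by (subst (1 2) y) (simp add: inner_add_left inner_add_right power2_eq_square)
  then show ?thesis by (simp add: w_def t_def)
qed

lemma norm_proj_perp_le: "norm \<nu> = 1 \<Longrightarrow> norm (proj_perp \<nu> y) \<le> norm y"
  by (rule power2_le_imp_le) (simp_all add: norm_proj_perp_sq[of \<nu> y])

lemma proj_perp_add_scaleR: "norm \<nu> = 1 \<Longrightarrow> proj_perp \<nu> (y + t *\<^sub>R \<nu>) = proj_perp \<nu> y"
  by (simp add: proj_perp_def inner_add_left dot_square_norm scaleR_add_left)

lemma emeasure_cylinder:
  fixes \<nu> :: "real^'n"
  assumes "norm \<nu> = 1" "0 < r" "a \<le> b"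
  shows "emeasure lborel {y. y \<bullet> \<nu> \<in> {a..b} \<and> norm (proj_perp \<nu> y) \<le> r} =
    ennreal ((b - a) * (unit_ball_vol (real (CARD('n) - 1)) * r ^ (CARD('n) - 1)))"
proof -
  let ?c = "unit_ball_vol (real (CARD('n) - 1)) * r ^ (CARD('n) - 1)"
  have "emeasure lborel {y. y \<bullet> \<nu> \<in> {a..b} \<and> norm (proj_perp \<nu> y) \<le> r} = (\<integral>\<^sup>+t\<in>{a..b}. ennreal ?c \<partial>lborel)"
    using assms by (intro emeasure_solid_of_revolution[of \<nu> "{a..b}" "\<lambda>_. r"]) auto
  also have "\<dots> = ennreal ?c * ennreal (b - a)"
    using assms by (subst nn_integral_cmult_indicator) auto
  also have "\<dots> = ennreal ((b - a) * ?c)"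
    using assms by (subst ennreal_mult'[symmetric]) (auto simp: mult.commute)
  finally show ?thesis .
qed

text \<open>The density theorem is applied to Lebesgue measure on a cylinder of height
  \<open>h\<close>, pushed to the hyperplane by the projection and divided by \<open>h\<close>:
  small balls centred on the projection of \<open>C\<close> then carry at least their Hausdorff
  weight. The part of the cylinder over the projection of \<open>C\<close> lies in a translated
  prism of height \<open>h + 2 * R\<close> over \<open>C\<close>, and
  \<open>(h + 2 * R + 1) / h\<close> tends to 1.\<close>

lemma hausdorff_outer_proj_le_prism:
  fixes \<nu> :: "real^'n"
  assumes \<nu>: "norm \<nu> = 1" and C: "compact C"
  shows "hausdorff_outer (real CARD('n) - 1) (proj_perp \<nu> ` C) \<le> emeasure lborel (prism \<nu> 1 C)"
proof -
  let ?P = "proj_perp \<nu>" and ?s = "real CARD('n) - 1" and ?m = "CARD('n) - 1"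
  have s: "?s = real ?m" by (simp add: of_nat_diff Suc_leI)
  obtain R where R: "R > 0" "\<And>c. c \<in> C \<Longrightarrow> norm c \<le> R"
    using compact_imp_bounded[OF C] bounded_pos by metis
  have PC: "compact (?P ` C)" by (intro compact_continuous_image C continuous_intros)
  then have PCb[measurable]: "?P ` C \<in> sets borel" by (intro borel_closed compact_imp_closed)
  let ?\<phi> = "emeasure lborel (prism \<nu> 1 C)"
  have "hausdorff_outer ?s (?P ` C) \<le> ennreal ((h + 2 * R + 1) / h) * ?\<phi>" if h: "h > 0" for h
  proof -
    \<comment> \<open>Truncation at radius \<open>R + 1\<close> makes the measure finite and still
      keeps all columns over balls of radius less than 1 about points of the projection.\<close>
    define Z where "Z = {y. y \<bullet> \<nu> \<in> {0..h} \<and> norm (?P y) \<le> R + 1}"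
    have Z[measurable]: "Z \<in> sets borel" unfolding Z_def by measurable
    define M where "M = distr (density lborel (indicator Z)) borel ?P"
    have M: "emeasure M B = emeasure lborel (Z \<inter> ?P -` B)" if [measurable]: "B \<in> sets borel" for B
    proof -
      have "emeasure M B = emeasure (density lborel (indicator Z)) (?P -` B)"
        unfolding M_def by (subst emeasure_distr) auto
      also have "\<dots> = (\<integral>\<^sup>+y. indicator Z y * indicator (?P -` B) y \<partial>lborel)"
        by (subst emeasure_density) (auto intro!: measurable_sets_borel[OF measurable_proj_perp])
      also have "\<dots> = (\<integral>\<^sup>+y. indicator (Z \<inter> ?P -` B) y \<partial>lborel)"
        by (intro nn_integral_cong) (auto simp: indicator_def)
      also have "\<dots> = emeasure lborel (Z \<inter> ?P -` B)"
        by (subst nn_integral_indicator) (auto intro!: measurable_sets_borel[OF measurable_proj_perp])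
      finally show ?thesis .
    qed
    have "hausdorff_outer ?s (?P ` C) \<le> ennreal (1 / h) * emeasure M (?P ` C)"
    proof (rule hausdorff_outer_le_density)
      have "emeasure M UNIV < \<infinity>"
        using emeasure_cylinder[OF \<nu>, of "R + 1" 0 h] R h by (simp add: M Z_def)
      then show "finite_measure M" by (intro finite_measureI) (auto simp: M_def)
      show "sets M = sets borel" by (simp add: M_def)
      fix x assume x: "x \<in> ?P ` C"
      then have x0: "x \<bullet> \<nu> = 0" and nx: "norm x \<le> R"
        using inner_proj_perp[OF \<nu>] norm_proj_perp_le[OF \<nu>] R(2) by (auto intro: order_trans)
      have "hausdorff_weight ?s (cball x r) \<le> ennreal (1 / h) * emeasure M (cball x r)" if r: "0 < r" "r < 1" for r
      proof -
        let ?S = "{y. y \<bullet> \<nu> \<in> {0..h} \<and> norm (?P y) \<le> r}"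
        have Px: "?P x = x" using x0 by (simp add: proj_perp_def)
        have "(+) x ` ?S \<subseteq> Z \<inter> ?P -` cball x r"
        proof
          fix y assume "y \<in> (+) x ` ?S"
          then obtain w where w: "y = x + w" "w \<bullet> \<nu> \<in> {0..h}" "norm (?P w) \<le> r" by auto
          have Py: "?P y = x + ?P w" by (simp add: w(1) linear_add[OF linear_proj_perp] Px)
          then have "norm (?P y) \<le> R + 1" using norm_triangle_ineq[of x "?P w"] nx w r by simp
          then show "y \<in> Z \<inter> ?P -` cball x r" using w x0 Py by (simp add: Z_def inner_add_left dist_norm)
        qed
        then have "emeasure lborel ((+) x ` ?S) \<le> emeasure M (cball x r)"
          by (subst M, simp) (rule emeasure_mono, auto intro!: measurable_sets_borel[OF measurable_proj_perp])
        also have "emeasure lborel ((+) x ` ?S) = emeasure lborel ?S"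
          by (rule emeasure_lborel_translation) measurable
        finally have "ennreal (1 / h) * emeasure lborel ?S \<le> ennreal (1 / h) * emeasure M (cball x r)"
          by (rule mult_left_mono) simp
        moreover have "ennreal (1 / h) * emeasure lborel ?S = hausdorff_weight ?s (cball x r)"
          using emeasure_cylinder[OF \<nu>, of r 0 h] r h
          by (simp add: s hausdorff_weight_cball ennreal_mult'[symmetric] powr_realpow del: of_nat_diff)
        ultimately show ?thesis by simp
      qed
      then show "\<forall>\<^sub>F r in at_right 0. hausdorff_weight ?s (cball x r) \<le> ennreal (1 / h) * emeasure M (cball x r)"
        unfolding eventually_at_right_field by (intro exI[of _ 1]) auto
    qed (use h PCb s in auto)
    also have "emeasure M (?P ` C) \<le> ennreal (h + 2 * R + 1) * ?\<phi>"
    proof -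
    have "emeasure M (?P ` C) \<le> emeasure lborel ((+) ((- R) *\<^sub>R \<nu>) ` prism \<nu> (h + 2 * R) C)"
    proof (subst M)
      have "Z \<inter> ?P -` ?P ` C \<subseteq> (+) ((- R) *\<^sub>R \<nu>) ` prism \<nu> (h + 2 * R) C"
      proof
        fix y assume "y \<in> Z \<inter> ?P -` ?P ` C"
        then obtain c where c: "c \<in> C" "?P y = ?P c" and y: "0 \<le> y \<bullet> \<nu>" "y \<bullet> \<nu> \<le> h" by (auto simp: Z_def)
        \<comment> \<open>Heights in \<open>C\<close> lie between \<open>- R\<close> and
          \<open>R\<close>, so raising the difference of heights by \<open>R\<close> makes it
          nonnegative.\<close>
        define t where "t = y \<bullet> \<nu> - c \<bullet> \<nu> + R"
        have "\<bar>c \<bullet> \<nu>\<bar> \<le> R" using Cauchy_Schwarz_ineq2[of c \<nu>] R(2)[OF c(1)] \<nu> by simp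
        then have "0 \<le> t" "t \<le> h + 2 * R" using y by (auto simp: t_def)
        then have "c + t *\<^sub>R \<nu> \<in> prism \<nu> (h + 2 * R) C" using c by (auto simp: mem_prism)
        moreover have "y = (- R) *\<^sub>R \<nu> + (c + t *\<^sub>R \<nu>)" using c(2) by (simp add: proj_perp_def t_def algebra_simps)
        ultimately show "y \<in> (+) ((- R) *\<^sub>R \<nu>) ` prism \<nu> (h + 2 * R) C" by blast
      qed
      then show "emeasure lborel (Z \<inter> ?P -` ?P ` C) \<le> emeasure lborel ((+) ((- R) *\<^sub>R \<nu>) ` prism \<nu> (h + 2 * R) C)"
        by (rule emeasure_mono) (simp only: sets_lborel, rule translation_borel[OF prism_borel[OF C]])
    qed simp_all
    also have "\<dots> = emeasure lborel (prism \<nu> (h + 2 * R) C)"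
      by (rule emeasure_lborel_translation) (rule prism_borel[OF C])
    also have "\<dots> \<le> ennreal (h + 2 * R + 1) * ?\<phi>"
      using emeasure_prism_le[OF C, of 1 "h + 2 * R" \<nu>] h R by simp
    finally show ?thesis .
    qed
    then have "ennreal (1 / h) * emeasure M (?P ` C) \<le> ennreal (1 / h) * (ennreal (h + 2 * R + 1) * ?\<phi>)"
      by (rule mult_left_mono) simp
    also have "\<dots> = ennreal ((h + 2 * R + 1) / h) * ?\<phi>"
      using h R by (subst mult.assoc[symmetric], subst ennreal_mult'[symmetric]) auto
    finally show ?thesis .
  qed
  then have "hausdorff_outer ?s (?P ` C) \<le> ennreal ((real (Suc n) + 2 * R + 1) / real (Suc n)) * ?\<phi>" for n
    by (simp del: of_nat_Suc)
  moreover have "(\<lambda>n. ?\<phi> * ennreal ((real (Suc n) + 2 * R + 1) / real (Suc n))) \<longlonglongrightarrow> ?\<phi> * ennreal 1"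
  proof (rule ennreal_tendsto_cmult)
    have "(\<lambda>n. 1 + (2 * R + 1) * inverse (real (Suc n))) \<longlonglongrightarrow> 1 + (2 * R + 1) * 0"
      by (intro tendsto_add tendsto_mult tendsto_const LIMSEQ_inverse_real_of_nat)
    moreover have "1 + (2 * R + 1) * inverse (real (Suc n)) = (real (Suc n) + 2 * R + 1) / real (Suc n)" for n
      by (simp add: field_simps del: of_nat_Suc)
    ultimately have "(\<lambda>n. (real (Suc n) + 2 * R + 1) / real (Suc n)) \<longlonglongrightarrow> 1"
      by (simp del: of_nat_Suc)
    then show "(\<lambda>n. ennreal ((real (Suc n) + 2 * R + 1) / real (Suc n))) \<longlonglongrightarrow> ennreal 1"
      by (rule tendsto_ennrealI)
    show "?\<phi> < top"
      using emeasure_compact_finite[OF compact_prism[OF C, of \<nu> 1]] by (simp add: less_top)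
  qed
  ultimately show ?thesis
    by (intro LIMSEQ_le_const[where X = "\<lambda>n. ?\<phi> * ennreal ((real (Suc n) + 2 * R + 1) / real (Suc n))"])
       (auto simp: mult.commute)
qed

text \<open>For \<open>\<kappa> < 1\<close> and a unit vector \<open>\<nu>\<close> this says that
  \<open>C\<close> is a graph over the hyperplane orthogonal to \<open>\<nu>\<close> with Lipschitz
  constant \<open>\<kappa> / sqrt (1 - \<kappa>\<^sup>2)\<close>. In this form the condition passes
  to subsets and to \<open>- \<nu>\<close> at once.\<close>

definition flat_set :: "real \<Rightarrow> 'a::real_inner \<Rightarrow> 'a set \<Rightarrow> bool" where
  "flat_set \<kappa> \<nu> C \<longleftrightarrow> (\<forall>x\<in>C. \<forall>y\<in>C. \<bar>(x - y) \<bullet> \<nu>\<bar> \<le> \<kappa> * norm (x - y))"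

lemma flat_set_proj_perp:
  assumes "norm \<nu> = 1" "flat_set \<kappa> \<nu> C" "x \<in> C" "y \<in> C"
  shows "(1 - \<kappa>\<^sup>2) * (norm (x - y))\<^sup>2 \<le> (norm (proj_perp \<nu> x - proj_perp \<nu> y))\<^sup>2"
proof -
  have "((x - y) \<bullet> \<nu>)\<^sup>2 \<le> (\<kappa> * norm (x - y))\<^sup>2"
  proof -
    have "\<bar>(x - y) \<bullet> \<nu>\<bar> \<le> \<bar>\<kappa> * norm (x - y)\<bar>"
      using assms(2-4) unfolding flat_set_def by (meson abs_ge_self order_trans)
    then show ?thesis by (simp only: abs_le_square_iff)
  qed
  then show ?thesis
    using norm_proj_perp_sq[OF assms(1), of "x - y"]
    by (simp add: linear_diff[OF linear_proj_perp] power_mult_distrib algebra_simps)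
qed

text \<open>On a flat set the projection is injective and its inverse is Lipschitz with constant
  \<open>1 / sqrt (1 - \<kappa>\<^sup>2)\<close>, so the bound for the projection lifts to
  \<open>C\<close> with a factor close to 1 for small \<open>\<kappa>\<close>.\<close>

lemma hausdorff_outer_flat_le_prism:
  fixes \<nu> :: "real^'n"
  assumes \<nu>: "norm \<nu> = 1" and C: "compact C" and flat: "flat_set \<kappa> \<nu> C" and \<kappa>: "0 \<le> \<kappa>" "\<kappa> < 1"
  shows "hausdorff_outer (real CARD('n) - 1) C
    \<le> ennreal ((1 / sqrt (1 - \<kappa>\<^sup>2)) powr (real CARD('n) - 1)) * emeasure lborel (prism \<nu> 1 C)"
proof -
  let ?P = "proj_perp \<nu>"
  define L where "L = 1 / sqrt (1 - \<kappa>\<^sup>2)"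
  have k1: "1 - \<kappa>\<^sup>2 > 0" using \<kappa> by (simp add: power_less_one_iff)
  have lip: "norm (x - y) \<le> L * norm (?P x - ?P y)" if "x \<in> C" "y \<in> C" for x y
  proof -
    have "sqrt ((1 - \<kappa>\<^sup>2) * (norm (x - y))\<^sup>2) \<le> norm (?P x - ?P y)"
      using flat_set_proj_perp[OF \<nu> flat that] by (intro real_le_lsqrt) auto
    moreover have "sqrt ((1 - \<kappa>\<^sup>2) * (norm (x - y))\<^sup>2) = sqrt (1 - \<kappa>\<^sup>2) * norm (x - y)"
      by (subst real_sqrt_mult) simp
    ultimately show ?thesis using k1 by (simp add: L_def pos_le_divide_eq mult.commute)
  qed
  have L: "L > 0" using k1 by (simp add: L_def)
  define f where "f = inv_into C ?P"
  have inj: "inj_on ?P C"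
  proof (rule inj_onI)
    fix x y assume *: "x \<in> C" "y \<in> C" "?P x = ?P y"
    have "norm (x - y) \<le> 0" using lip[OF *(1,2)] *(3) by simp
    then show "x = y" by simp
  qed
  have fP: "f (?P c) = c" if "c \<in> C" for c using inj that by (simp add: f_def)
  have "f ` ?P ` C = C" by (auto simp: fP image_iff)
  then have "hausdorff_outer (real CARD('n) - 1) C = hausdorff_outer (real CARD('n) - 1) (f ` ?P ` C)" by simp
  also have "\<dots> \<le> ennreal (L powr (real CARD('n) - 1)) * hausdorff_outer (real CARD('n) - 1) (?P ` C)"
    using lip L by (intro hausdorff_outer_Lipschitz_image) (auto simp: fP dist_norm Suc_leI)
  also have "\<dots> \<le> ennreal (L powr (real CARD('n) - 1)) * emeasure lborel (prism \<nu> 1 C)"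
    by (intro mult_left_mono hausdorff_outer_proj_le_prism \<nu> C) auto
  finally show ?thesis by (simp add: L_def)
qed

subsection \<open>The constant in polar coordinates\<close>

lemma emeasure_cone:
  fixes \<nu> :: "real^'n"
  assumes "norm \<nu> = 1" "0 < \<gamma>" "0 < \<tau>"
  shows "ennreal (real CARD('n)) * emeasure lborel {y. y \<bullet> \<nu> \<in> {0<..<\<gamma>} \<and> norm (proj_perp \<nu> y) \<le> \<tau> * (y \<bullet> \<nu>)} =
    ennreal (unit_ball_vol (real (CARD('n) - 1)) * \<tau> ^ (CARD('n) - 1) * \<gamma> ^ CARD('n))"
proof -
  let ?m = "CARD('n) - 1"
  let ?\<omega> = "unit_ball_vol (real ?m)"
  have "emeasure lborel {y. y \<bullet> \<nu> \<in> {0<..<\<gamma>} \<and> norm (proj_perp \<nu> y) \<le> \<tau> * (y \<bullet> \<nu>)}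
      = (\<integral>\<^sup>+t\<in>{0<..<\<gamma>}. ennreal (?\<omega> * (\<tau> * t) ^ ?m) \<partial>lborel)"
    using assms by (intro emeasure_solid_of_revolution[of \<nu> "{0<..<\<gamma>}" "\<lambda>t. \<tau> * t"]) auto
  \<comment> \<open>The open interval left out the apex, where the slice has radius 0; its end
    points are null and are restored for the fundamental theorem of calculus.\<close>
  also have "\<dots> = (\<integral>\<^sup>+t. ennreal (?\<omega> * (\<tau> * t) ^ ?m) * indicator {0..\<gamma>} t \<partial>lborel)"
    by (rule nn_integral_cong_AE, use AE_lborel_singleton[of 0] AE_lborel_singleton[of \<gamma>] in eventually_elim)
       (auto simp: indicator_def)
  also have "\<dots> = ennreal (?\<omega> * \<tau> ^ ?m * \<gamma> ^ CARD('n) / CARD('n) - ?\<omega> * \<tau> ^ ?m * 0 ^ CARD('n) / CARD('n))"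
  proof (rule nn_integral_FTC_Icc)
    fix t :: real assume t: "t \<in> {0..\<gamma>}"
    show "((\<lambda>t. ?\<omega> * \<tau> ^ ?m * t ^ CARD('n) / CARD('n)) has_real_derivative ?\<omega> * (\<tau> * t) ^ ?m) (at t)"
      by (auto intro!: derivative_eq_intros simp: power_mult_distrib)
    show "0 \<le> ?\<omega> * (\<tau> * t) ^ ?m" using t assms by (intro mult_nonneg_nonneg) auto
  qed (use assms in auto)
  finally show ?thesis
    using assms by (subst (asm) power_0_left) (simp add: ennreal_mult'[symmetric])
qed

text \<open>A solid cone about the axis \<open>x\<close> is inscribed in the sector of the unit ball
  over the cap. If \<alpha> is the angle whose chord has length \<open>r\<close>, then
  \<open>\<gamma>\<close> is its cosine and gives the height of the cone, and \<open>\<tau>\<close>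
  is its tangent and gives the slope; the bound follows from \<open>r \<le> \<tau>\<close>.\<close>

lemma spherical_cap_lower_bound:
  fixes x :: "real^'n"
  assumes x: "norm x = 1" and r: "0 < r" "r < 1"
  shows "ennreal (unit_ball_vol (real (CARD('n) - 1)) * r ^ (CARD('n) - 1) * (1 - r\<^sup>2 / 2) ^ CARD('n))
    \<le> ennreal (real CARD('n)) * emeasure lborel {y \<in> ball 0 1 - {0}. norm (sgn y - x) \<le> r}"
proof -
  let ?m = "CARD('n) - 1"
  let ?\<omega> = "unit_ball_vol (real ?m)"
  define \<gamma> where "\<gamma> = 1 - r\<^sup>2 / 2"
  have r2: "r\<^sup>2 < 1" using r by (simp add: power_less_one_iff)
  have \<gamma>: "1/2 < \<gamma>" "\<gamma> < 1" using r r2 by (auto simp: \<gamma>_def)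
  define \<tau> where "\<tau> = sqrt (1 / \<gamma>\<^sup>2 - 1)"
  have g2: "\<gamma>\<^sup>2 < 1" "0 < \<gamma>\<^sup>2" using \<gamma> by (auto simp: power_less_one_iff)
  then have \<tau>: "\<tau> > 0" "\<tau>\<^sup>2 = 1 / \<gamma>\<^sup>2 - 1" by (auto simp: \<tau>_def)
  let ?S = "{y. y \<bullet> x \<in> {0<..<\<gamma>} \<and> norm (proj_perp x y) \<le> \<tau> * (y \<bullet> x)}"
  have sub: "?S \<subseteq> {y \<in> ball 0 1 - {0}. norm (sgn y - x) \<le> r}"
  proof
    fix y assume y: "y \<in> ?S"
    define t where "t = y \<bullet> x"
    have t: "0 < t" "t < \<gamma>" "norm (proj_perp x y) \<le> \<tau> * t" using y by (auto simp: t_def)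
    have "(norm y)\<^sup>2 = (norm (proj_perp x y))\<^sup>2 + t\<^sup>2" by (simp add: norm_proj_perp_sq[OF x, of y] t_def)
    also have "\<dots> \<le> (\<tau> * t)\<^sup>2 + t\<^sup>2" using t by (intro add_right_mono power_mono) auto
    also have "\<dots> = (t / \<gamma>)\<^sup>2" using \<gamma> by (simp add: power_mult_distrib \<tau>(2) power_divide algebra_simps)
    finally have ny: "norm y \<le> t / \<gamma>" by (rule power2_le_imp_le) (use t \<gamma> in auto)
    have "t / \<gamma> < 1" using t \<gamma> by (simp add: field_simps)
    then have y1: "norm y < 1" using ny by simp
    have y0: "y \<noteq> 0" using t by (auto simp: t_def)
    have sy: "sgn y \<bullet> x = t / norm y" by (simp add: sgn_div_norm t_def divide_inverse mult.commute)
    have "(norm (sgn y - x))\<^sup>2 = sgn y \<bullet> sgn y - 2 * (sgn y \<bullet> x) + x \<bullet> x"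
      by (simp add: power2_norm_eq_inner inner_diff_left inner_diff_right inner_commute[of x "sgn y"])
    then have "(norm (sgn y - x))\<^sup>2 = 2 - 2 * (t / norm y)"
      using y0 x by (simp add: sy dot_square_norm norm_sgn)
    moreover have "\<gamma> \<le> t / norm y" using ny y0 \<gamma> by (simp add: field_simps)
    ultimately have "(norm (sgn y - x))\<^sup>2 \<le> r\<^sup>2" by (simp add: \<gamma>_def)
    then have "norm (sgn y - x) \<le> r" by (rule power2_le_imp_le) (use r in simp)
    then show "y \<in> {y \<in> ball 0 1 - {0}. norm (sgn y - x) \<le> r}" using y0 y1 by simp
  qed
  \<comment> \<open>With the angle \<alpha> of chord \<open>r\<close> this reads
    \<open>r * cos \<alpha> \<le> sin \<alpha>\<close>, where
    \<open>sin \<alpha> = r * sqrt (1 - r\<^sup>2 / 4)\<close>.\<close>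
  have "r * \<gamma> \<le> \<tau> * \<gamma>"
  proof (rule power2_le_imp_le)
    have "(\<tau> * \<gamma>)\<^sup>2 = 1 - \<gamma>\<^sup>2" using g2 by (simp add: power_mult_distrib \<tau>(2) field_simps)
    also have "1 - \<gamma>\<^sup>2 = r\<^sup>2 * (1 - r\<^sup>2 / 4)" by (simp add: \<gamma>_def power2_eq_square algebra_simps)
    finally have eq: "(\<tau> * \<gamma>)\<^sup>2 = r\<^sup>2 * (1 - r\<^sup>2 / 4)" .
    have "\<gamma>\<^sup>2 \<le> \<gamma> * 1" unfolding power2_eq_square using \<gamma> by (intro mult_left_mono) auto
    moreover have "\<gamma> \<le> 1 - r\<^sup>2 / 4" by (simp add: \<gamma>_def)
    ultimately have "\<gamma>\<^sup>2 \<le> 1 - r\<^sup>2 / 4" by linarith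
    then have "r\<^sup>2 * \<gamma>\<^sup>2 \<le> r\<^sup>2 * (1 - r\<^sup>2 / 4)" by (intro mult_left_mono) auto
    then show "(r * \<gamma>)\<^sup>2 \<le> (\<tau> * \<gamma>)\<^sup>2" unfolding eq by (simp add: power_mult_distrib)
  qed (use \<tau> \<gamma> in auto)
  then have "r \<le> \<tau>" using \<gamma> by simp
  then have "?\<omega> * r ^ ?m * \<gamma> ^ CARD('n) \<le> ?\<omega> * \<tau> ^ ?m * \<gamma> ^ CARD('n)"
    using r \<gamma> by (intro mult_right_mono mult_left_mono power_mono) auto
  then have "ennreal (?\<omega> * r ^ ?m * \<gamma> ^ CARD('n)) \<le> ennreal (?\<omega> * \<tau> ^ ?m * \<gamma> ^ CARD('n))"
    by (rule ennreal_leI)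
  also have "\<dots> = ennreal (real CARD('n)) * emeasure lborel ?S"
    using \<gamma> \<tau> by (intro emeasure_cone[symmetric] x) auto
  also have "\<dots> \<le> ennreal (real CARD('n)) * emeasure lborel {y \<in> ball 0 1 - {0}. norm (sgn y - x) \<le> r}"
    using sub by (intro mult_left_mono emeasure_mono) measurable
  finally show ?thesis by (simp add: \<gamma>_def)
qed

text \<open>Surface measure of the sphere expressed by volumes: the cone over a set of directions
  has \<open>1 / N\<close> times the area of that set, because the radial integral of
  \<open>t ^ (N - 1)\<close> over the unit interval is \<open>1 / N\<close>.\<close>

definition cone_measure :: "(real^'n) measure" where
  "cone_measure = distr (density lborel (\<lambda>y. ennreal (real CARD('n)) * indicator (ball 0 1 - {0}) y)) borel sgn"

lemma sets_cone_measure [simp, measurable_cong]: "sets cone_measure = sets borel"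
  by (simp add: cone_measure_def)

lemma nn_integral_cone_measure:
  assumes [measurable]: "g \<in> borel_measurable borel"
  shows "(\<integral>\<^sup>+x. g x \<partial>(cone_measure :: (real^'n) measure)) =
    ennreal (real CARD('n)) * (\<integral>\<^sup>+y\<in>ball 0 1 - {0}. g (sgn y) \<partial>lborel)"
proof -
  have [measurable]: "(ball 0 1 - {0} :: (real^'n) set) \<in> sets borel" by simp
  have "(\<integral>\<^sup>+x. g x \<partial>(cone_measure :: (real^'n) measure))
     = (\<integral>\<^sup>+y. ennreal (real CARD('n)) * (g (sgn y) * indicator (ball 0 1 - {0}) y) \<partial>lborel)"
    unfolding cone_measure_def
    by (subst nn_integral_distr, measurable, subst nn_integral_density, measurable) (simp add: mult_ac)
  also have "\<dots> = ennreal (real CARD('n)) * (\<integral>\<^sup>+y\<in>ball 0 1 - {0}. g (sgn y) \<partial>lborel)"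
    by (rule nn_integral_cmult) measurable
  finally show ?thesis .
qed

lemma emeasure_cone_measure:
  assumes [measurable]: "A \<in> sets borel"
  shows "emeasure (cone_measure :: (real^'n) measure) A =
    ennreal (real CARD('n)) * emeasure lborel {y \<in> ball 0 1 - {0}. sgn y \<in> A}"
proof -
  have "emeasure (cone_measure :: (real^'n) measure) A = (\<integral>\<^sup>+x. indicator A x \<partial>(cone_measure :: (real^'n) measure))"
    using assms by (subst nn_integral_indicator) auto
  also have "\<dots> = ennreal (real CARD('n)) * (\<integral>\<^sup>+y\<in>ball 0 1 - {0}. indicator A (sgn y) \<partial>lborel)"
    by (rule nn_integral_cone_measure) simp
  also have "(\<integral>\<^sup>+y\<in>ball 0 1 - {0}. indicator A (sgn y) \<partial>lborel) = (\<integral>\<^sup>+y. indicator {y \<in> ball 0 1 - {0} :: (real^'n) set. sgn y \<in> A} y \<partial>lborel)"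
    by (intro nn_integral_cong) (auto simp: indicator_def)
  also have "\<dots> = emeasure lborel {y \<in> ball 0 1 - {0} :: (real^'n) set. sgn y \<in> A}"
    by (rule nn_integral_indicator) measurable
  finally show ?thesis .
qed

text \<open>The cone measure of a small cap falls short of the Hausdorff weight of the ball by at
  most the factor \<open>(1 - r\<^sup>2 / 2) ^ N\<close>, which tends to 1; any
  \<open>\<kappa> > 1\<close> makes up for it.\<close>

lemma hausdorff_outer_sphere_le:
  fixes A :: "(real^'n) set"
  assumes A: "A \<in> sets borel" "A \<subseteq> sphere 0 1" and \<kappa>: "1 < \<kappa>"
  shows "hausdorff_outer (real CARD('n) - 1) A \<le> ennreal \<kappa> * emeasure cone_measure A"
proof (rule hausdorff_outer_le_density)
  let ?m = "CARD('n) - 1"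
  have s: "real CARD('n) - 1 = real ?m" by (simp add: of_nat_diff Suc_leI)
  have "emeasure (cone_measure :: (real^'n) measure) UNIV \<le> ennreal (real CARD('n)) * emeasure lborel (ball 0 1 :: (real^'n) set)"
    by (subst emeasure_cone_measure) (auto intro!: mult_left_mono emeasure_mono)
  also have "\<dots> < \<infinity>"
    using emeasure_bounded_finite[of "ball 0 1 :: (real^'n) set"] by (simp add: ennreal_mult_less_top)
  finally show "finite_measure (cone_measure :: (real^'n) measure)"
    by (intro finite_measureI) (auto simp: cone_measure_def)
  fix x assume "x \<in> A"
  then have x: "norm x = 1" using A by auto
  have "((\<lambda>r. \<kappa> * (1 - r\<^sup>2 / 2) ^ CARD('n)) \<longlongrightarrow> \<kappa> * (1 - 0\<^sup>2 / 2) ^ CARD('n)) (at_right 0)"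
    by (intro tendsto_intros) auto
  then have "\<forall>\<^sub>F r in at_right 0. 1 < \<kappa> * (1 - r\<^sup>2 / 2) ^ CARD('n)"
    using \<kappa> by (intro order_tendstoD) auto
  moreover have "\<forall>\<^sub>F r :: real in at_right 0. 0 < r \<and> r < 1"
    unfolding eventually_at_right_field by (intro exI[of _ 1]) auto
  ultimately show "\<forall>\<^sub>F r in at_right 0. hausdorff_weight (real CARD('n) - 1) (cball x r) \<le> ennreal \<kappa> * emeasure cone_measure (cball x r)"
  proof eventually_elim
    fix r :: real assume *: "1 < \<kappa> * (1 - r\<^sup>2 / 2) ^ CARD('n)" "0 < r \<and> r < 1"
    have "hausdorff_weight (real CARD('n) - 1) (cball x r) = ennreal (unit_ball_vol (real ?m) * r ^ ?m)"
      unfolding s using * by (simp add: hausdorff_weight_cball powr_realpow del: of_nat_diff)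
    also have "\<dots> \<le> ennreal (\<kappa> * (unit_ball_vol (real ?m) * r ^ ?m * (1 - r\<^sup>2 / 2) ^ CARD('n)))"
    proof (intro ennreal_leI)
      have "(unit_ball_vol (real ?m) * r ^ ?m) * 1 \<le> (unit_ball_vol (real ?m) * r ^ ?m) * (\<kappa> * (1 - r\<^sup>2 / 2) ^ CARD('n))"
        using * by (intro mult_left_mono mult_nonneg_nonneg) auto
      then show "unit_ball_vol (real ?m) * r ^ ?m \<le> \<kappa> * (unit_ball_vol (real ?m) * r ^ ?m * (1 - r\<^sup>2 / 2) ^ CARD('n))"
        by (simp add: mult_ac)
    qed
    also have "\<dots> \<le> ennreal \<kappa> * emeasure cone_measure (cball x r)"
      using spherical_cap_lower_bound[OF x, of r] * \<kappa>
      by (subst ennreal_mult') (auto simp: emeasure_cone_measure dist_norm norm_minus_commute intro!: mult_left_mono)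
    finally show "hausdorff_weight (real CARD('n) - 1) (cball x r) \<le> ennreal \<kappa> * emeasure cone_measure (cball x r)" .
  qed
qed (use A \<kappa> in \<open>auto simp: Suc_leI\<close>)

text \<open>In polar coordinates this is \<open>1 / N\<close> times the integral of
  \<open>\<bar>z \<bullet> \<nu>\<bar>\<close> over the unit sphere, so for a unit vector it is the
  constant of the theorem written without Hausdorff measure. Integrating the slice estimates over
  \<open>z\<close> produces it in this form.\<close>

definition crossing_const :: "'a::euclidean_space \<Rightarrow> ennreal" where
  "crossing_const \<nu> = (\<integral>\<^sup>+z\<in>ball 0 1. ennreal (\<bar>z \<bullet> \<nu>\<bar> / norm z) \<partial>lborel)"

lemma jump_const_le_crossing_const:
  "jump_const (k :: 'n::finite) \<le> crossing_const (axis k 1 :: real^'n)"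
proof -
  let ?g = "\<lambda>z :: real^'n. ennreal \<bar>z $ k\<bar>"
  let ?H = "hausdorff_on (real CARD('n) - 1) (sphere 0 1 :: (real^'n) set)"
  have "(\<integral>\<^sup>+z\<in>sphere 0 1. ?g z \<partial>hausdorff_measure (real CARD('n) - 1)) = (\<integral>\<^sup>+z. ?g z \<partial>?H)"
    by (rule nn_integral_hausdorff_on) auto
  moreover have "(\<integral>\<^sup>+z. ?g z \<partial>?H) \<le> ennreal \<kappa> * (\<integral>\<^sup>+z. ?g z \<partial>cone_measure)" if \<kappa>: "1 < \<kappa>" for \<kappa>
  proof -
    have "?H \<le> scale_measure (ennreal \<kappa>) cone_measure"
    proof (subst le_measure, simp, rule ballI)
      fix A :: "(real^'n) set"
      show "emeasure ?H A \<le> emeasure (scale_measure (ennreal \<kappa>) cone_measure) A"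
      proof (cases "A \<in> sets borel")
        case True
        then have "emeasure ?H A \<le> ennreal \<kappa> * emeasure cone_measure (sphere 0 1 \<inter> A)"
          using \<kappa> by (subst emeasure_hausdorff_on) (auto intro!: hausdorff_outer_sphere_le)
        also have "\<dots> \<le> ennreal \<kappa> * emeasure cone_measure A"
          using True by (intro mult_left_mono emeasure_mono) auto
        finally show ?thesis by simp
      qed (simp add: emeasure_notin_sets)
    qed
    then have "(\<integral>\<^sup>+z. ?g z \<partial>?H) \<le> (\<integral>\<^sup>+z. ?g z \<partial>scale_measure (ennreal \<kappa>) cone_measure)"
      by (intro nn_integral_mono_measure) auto
    also have "\<dots> = ennreal \<kappa> * (\<integral>\<^sup>+z. ?g z \<partial>cone_measure)"
      by (rule nn_integral_scale_measure) measurable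
    finally show ?thesis .
  qed
  then have "(\<integral>\<^sup>+z. ?g z \<partial>?H) \<le> (\<integral>\<^sup>+z. ?g z \<partial>cone_measure)"
  proof -
    assume *: "\<And>\<kappa>. 1 < \<kappa> \<Longrightarrow> (\<integral>\<^sup>+z. ?g z \<partial>?H) \<le> ennreal \<kappa> * (\<integral>\<^sup>+z. ?g z \<partial>cone_measure)"
    let ?I = "\<integral>\<^sup>+z. ?g z \<partial>cone_measure"
    show ?thesis
    proof (cases "?I = top")
      case False
      have "(\<lambda>n. ?I * ennreal (1 + inverse (real (Suc n)))) \<longlonglongrightarrow> ?I * ennreal 1"
        using LIMSEQ_inverse_real_of_nat_add[of 1] False
        by (intro ennreal_tendsto_cmult tendsto_ennrealI) (auto simp: less_top)
      moreover have "(\<integral>\<^sup>+z. ?g z \<partial>?H) \<le> ?I * ennreal (1 + inverse (real (Suc n)))" for n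
        using *[of "1 + inverse (real (Suc n))"] by (simp add: mult.commute)
      ultimately have "(\<integral>\<^sup>+z. ?g z \<partial>?H) \<le> ?I * ennreal 1"
        by (intro LIMSEQ_le_const) auto
      then show ?thesis by simp
    qed simp
  qed
  moreover have "(\<integral>\<^sup>+z. ?g z \<partial>cone_measure) = ennreal (real CARD('n)) * crossing_const (axis k 1 :: real^'n)"
  proof -
    \<comment> \<open>The quotient \<open>\<bar>z \<bullet> \<nu>\<bar> / norm z\<close> depends
      only on the direction of \<open>z\<close>.\<close>
    have "(\<integral>\<^sup>+y\<in>ball 0 1 - {0}. ?g (sgn y) \<partial>lborel) = crossing_const (axis k 1 :: real^'n)"
      unfolding crossing_const_def
      by (intro nn_integral_cong)
         (auto simp: indicator_def sgn_div_norm inner_axis divide_inverse abs_mult mult.commute)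
    then show ?thesis by (subst nn_integral_cone_measure) auto
  qed
  ultimately have "(\<integral>\<^sup>+z\<in>sphere 0 1. ?g z \<partial>hausdorff_measure (real CARD('n) - 1))
      \<le> ennreal (real CARD('n)) * crossing_const (axis k 1 :: real^'n)" by simp
  then have "jump_const k \<le> ennreal (1 / real CARD('n)) * (ennreal (real CARD('n)) * crossing_const (axis k 1 :: real^'n))"
    unfolding jump_const_def by (rule mult_left_mono) simp
  also have "\<dots> = crossing_const (axis k 1 :: real^'n)"
    by (subst mult.assoc[symmetric], subst ennreal_mult'[symmetric]) auto
  finally show ?thesis .
qed

text \<open>Pieces of the jump set have arbitrary normals, while the constant of the theorem refers
  to one coordinate direction; rotation invariance identifies the two.\<close>

lemma crossing_const_rotation:
  fixes \<nu> \<mu> :: "real^'n"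
  assumes "norm \<nu> = norm \<mu>"
  shows "crossing_const \<nu> = crossing_const \<mu>"
proof -
  obtain T where T: "orthogonal_transformation T" "T \<nu> = \<mu>" using orthogonal_transformation_exists[OF assms] .
  have lin: "linear T" using T by (rule_tac orthogonal_transformation_linear)
  then have [measurable]: "T \<in> borel_measurable borel"
    by (intro borel_measurable_continuous_onI linear_continuous_on linear_conv_bounded_linear[THEN iffD1])
  have [measurable]: "(ball 0 1 :: (real^'n) set) \<in> sets borel" by simp
  have "crossing_const \<mu> = (\<integral>\<^sup>+z\<in>ball 0 1. ennreal (\<bar>z \<bullet> \<mu>\<bar> / norm z) \<partial>distr lborel borel T)"
    by (simp add: crossing_const_def lborel_distr_orthogonal[OF T(1)])
  also have "\<dots> = (\<integral>\<^sup>+z. ennreal (\<bar>T z \<bullet> T \<nu>\<bar> / norm (T z)) * indicator (ball 0 1) (T z) \<partial>lborel)"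
    by (subst nn_integral_distr, measurable) (simp only: T(2))
  also have "\<dots> = crossing_const \<nu>"
    unfolding crossing_const_def using T(1)
    by (intro nn_integral_cong) (auto simp: orthogonal_transformation_norm indicator_def, simp add: orthogonal_transformation_def)
  finally show ?thesis by simp
qed

lemma crossing_const_le_ball:
  fixes \<nu> :: "'a::euclidean_space"
  assumes "norm \<nu> = 1"
  shows "crossing_const \<nu> \<le> emeasure lborel (ball 0 1 :: 'a set)"
proof -
  have "\<bar>z \<bullet> \<nu>\<bar> / norm z \<le> 1" for z
    using Cauchy_Schwarz_ineq2[of z \<nu>] assms by (cases "z = 0") (auto simp: field_simps)
  then have "crossing_const \<nu> \<le> (\<integral>\<^sup>+z. indicator (ball 0 1 :: 'a set) z \<partial>lborel)"
    unfolding crossing_const_def by (intro nn_integral_mono) (auto simp: indicator_def ennreal_le_1)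
  then show ?thesis by simp
qed

subsection \<open>Thin sets and flatness at jump points\<close>

text \<open>\<open>A\<close> will be the set where a function is far from one of its traces. A
  single \<open>\<rho>0\<close> governs all smaller radii, which makes the approximation uniform on
  a set of points; the inequality for the volume is weak so that it passes to limits in
  \<open>x\<close>.\<close>

definition thin_at :: "(real^'n) set \<Rightarrow> real^'n \<Rightarrow> real \<Rightarrow> real \<Rightarrow> real^'n \<Rightarrow> bool" where
  "thin_at A \<nu> \<eta> \<rho>0 x \<longleftrightarrow>
     (\<forall>\<rho>. 0 < \<rho> \<longrightarrow> \<rho> < \<rho>0 \<longrightarrow> emeasure lborel (A \<inter> half_ball x \<nu> \<rho>) \<le> ennreal (\<eta> * \<rho> ^ CARD('n)))"

lemma half_ball_borel [measurable]: "half_ball x \<nu> \<rho> \<in> sets borel"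
  unfolding half_ball_def by measurable

text \<open>
  If \<open>y - x\<close> were far from orthogonal to \<open>\<nu>\<close>, a ball near \<open>y\<close> would lie on the positive side of \<open>x\<close>
  and on the negative side of \<open>y\<close>, so that \<open>A\<close> and \<open>B\<close> would both be small in it although they cover the space.
\<close>

lemma thin_at_imp_flat_set:
  fixes C :: "(real^'n) set"
  assumes [measurable]: "A \<in> sets borel" "B \<in> sets borel" and AB: "A \<union> B = UNIV"
    and \<nu>: "norm \<nu> = 1" and \<kappa>: "0 < \<kappa>" "\<kappa> \<le> 1" and "0 \<le> \<eta>"
    and thin: "\<And>x. x \<in> C \<Longrightarrow> thin_at A \<nu> \<eta> \<rho>0 x" "\<And>x. x \<in> C \<Longrightarrow> thin_at B (- \<nu>) \<eta> \<rho>0 x"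
    and diam: "\<And>x y. x \<in> C \<Longrightarrow> y \<in> C \<Longrightarrow> 2 * dist x y < \<rho>0"
    and \<eta>: "2 * 4 ^ CARD('n) * \<eta> < unit_ball_vol (real CARD('n)) * \<kappa> ^ CARD('n)"
  shows "flat_set \<kappa> \<nu> C"
proof -
  let ?N = "CARD('n)"
  have key: "(y - x) \<bullet> \<nu> \<le> \<kappa> * norm (y - x)" if xy: "x \<in> C" "y \<in> C" for x y
  proof (rule ccontr)
    define r where "r = norm (y - x)"
    assume "\<not> ?thesis"
    then have far: "\<kappa> * r < (y - x) \<bullet> \<nu>" by (simp add: r_def)
    then have "y - x \<noteq> 0" by (auto simp: r_def)
    then have r: "0 < r" by (simp add: r_def)
    have kr: "0 < \<kappa> * r" "\<kappa> * r \<le> r" using r \<kappa> by auto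
    have r2: "2 * r < \<rho>0" using diam[OF xy] by (simp add: r_def dist_norm norm_minus_commute)
    \<comment> \<open>The ball about \<open>?z\<close> touches the hyperplane through
      \<open>y\<close> from the negative side. It stays within \<open>\<kappa> * r\<close> of
      \<open>y\<close>, which by \<open>far\<close> is less than the height of \<open>y\<close>
      above the hyperplane through \<open>x\<close>.\<close>
    let ?z = "y - (\<kappa> * r / 2) *\<^sub>R \<nu>"
    let ?U = "ball ?z (\<kappa> * r / 2)"
    have CS: "\<bar>v \<bullet> \<nu>\<bar> \<le> norm v" for v using Cauchy_Schwarz_ineq2[of v \<nu>] \<nu> by simp
    have "?U \<subseteq> half_ball y (- \<nu>) (\<kappa> * r) \<inter> half_ball x \<nu> (2 * r)"
    proof
      fix p assume "p \<in> ?U"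
      then have p: "norm (p - ?z) < \<kappa> * r / 2" by (simp add: dist_norm norm_minus_commute)
      have py: "p - y = (p - ?z) - (\<kappa> * r / 2) *\<^sub>R \<nu>" by simp
      have "norm (p - y) \<le> norm (p - ?z) + \<kappa> * r / 2"
        unfolding py using norm_triangle_ineq4[of "p - ?z" "(\<kappa> * r / 2) *\<^sub>R \<nu>"] \<nu> kr by simp
      then have npy: "norm (p - y) < \<kappa> * r" using p by simp
      have "(p - y) \<bullet> \<nu> = (p - ?z) \<bullet> \<nu> - \<kappa> * r / 2"
        by (subst py, subst inner_diff_left) (simp add: \<nu> dot_square_norm)
      then have neg: "(p - y) \<bullet> \<nu> < 0" using CS[of "p - ?z"] p by linarith
      have "(p - x) \<bullet> \<nu> = (p - y) \<bullet> \<nu> + (y - x) \<bullet> \<nu>" by (simp add: inner_diff_left)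
      then have pos: "0 < (p - x) \<bullet> \<nu>" using CS[of "p - y"] npy far by linarith
      have "norm (p - x) \<le> norm (p - y) + norm (y - x)" using norm_triangle_ineq[of "p - y" "y - x"] by simp
      then have "norm (p - x) < 2 * r" using npy kr by (simp add: r_def)
      then show "p \<in> half_ball y (- \<nu>) (\<kappa> * r) \<inter> half_ball x \<nu> (2 * r)"
        using neg pos npy by (auto simp: half_ball_def dist_norm norm_minus_commute)
    qed
    then have "?U \<subseteq> (A \<inter> half_ball x \<nu> (2 * r)) \<union> (B \<inter> half_ball y (- \<nu>) (\<kappa> * r))" using AB by blast
    then have "emeasure lborel ?U \<le> emeasure lborel ((A \<inter> half_ball x \<nu> (2 * r)) \<union> (B \<inter> half_ball y (- \<nu>) (\<kappa> * r)))"
      by (rule emeasure_mono) measurable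
    also have "\<dots> \<le> emeasure lborel (A \<inter> half_ball x \<nu> (2 * r)) + emeasure lborel (B \<inter> half_ball y (- \<nu>) (\<kappa> * r))"
      by (rule emeasure_subadditive) auto
    also have "\<dots> \<le> ennreal (\<eta> * (2 * r) ^ ?N) + ennreal (\<eta> * (\<kappa> * r) ^ ?N)"
      using thin(1)[OF xy(1), unfolded thin_at_def, rule_format, of "2 * r"]
        thin(2)[OF xy(2), unfolded thin_at_def, rule_format, of "\<kappa> * r"] r r2 kr
      by (intro add_mono) linarith+
    also have "\<dots> = ennreal (\<eta> * (2 * r) ^ ?N + \<eta> * (\<kappa> * r) ^ ?N)"
      using \<open>0 \<le> \<eta>\<close> r kr by (intro ennreal_plus[symmetric]) auto
    also have "\<dots> \<le> ennreal (2 * (\<eta> * (2 * r) ^ ?N))"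
    proof (rule ennreal_leI)
      have "\<eta> * (\<kappa> * r) ^ ?N \<le> \<eta> * (2 * r) ^ ?N"
        using \<open>0 \<le> \<eta>\<close> r kr \<kappa> by (intro mult_left_mono power_mono) auto
      then show "\<eta> * (2 * r) ^ ?N + \<eta> * (\<kappa> * r) ^ ?N \<le> 2 * (\<eta> * (2 * r) ^ ?N)" by linarith
    qed
    finally have "unit_ball_vol (real ?N) * (\<kappa> * r / 2) ^ ?N \<le> 2 * (\<eta> * (2 * r) ^ ?N)"
      using kr \<open>0 \<le> \<eta>\<close> r by (subst (asm) emeasure_ball) (auto simp: ennreal_le_iff)
    \<comment> \<open>Multiplication by \<open>2 ^ N\<close> clears the denominator in the radius
      \<open>\<kappa> * r / 2\<close>; combined with \<open>(2 * r) ^ N\<close> it is the origin of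
      \<open>4 ^ N\<close> in the smallness condition on \<open>\<eta>\<close>.\<close>
    then have le: "(unit_ball_vol (real ?N) * (\<kappa> * r / 2) ^ ?N) * 2 ^ ?N \<le> 2 * (\<eta> * (2 * r) ^ ?N) * 2 ^ ?N" (is "?l \<le> ?r")
      by (rule mult_right_mono) simp
    have "(\<kappa> * r / 2) ^ ?N * 2 ^ ?N = (\<kappa> * r / 2 * 2) ^ ?N" by (rule power_mult_distrib[symmetric])
    then have "(\<kappa> * r / 2) ^ ?N * 2 ^ ?N = (\<kappa> * r) ^ ?N" by simp
    then have e1: "(\<kappa> * r / 2) ^ ?N * 2 ^ ?N = \<kappa> ^ ?N * r ^ ?N" by (simp only: power_mult_distrib)
    have "(2 * r) ^ ?N * 2 ^ ?N = (2 * r * 2) ^ ?N" by (rule power_mult_distrib[symmetric])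
    then have "(2 * r) ^ ?N * 2 ^ ?N = (4 * r) ^ ?N" by (simp add: mult.commute)
    then have e2: "(2 * r) ^ ?N * 2 ^ ?N = 4 ^ ?N * r ^ ?N" by (simp only: power_mult_distrib)
    have "?l = unit_ball_vol (real ?N) * ((\<kappa> * r / 2) ^ ?N * 2 ^ ?N)" "?r = 2 * \<eta> * ((2 * r) ^ ?N * 2 ^ ?N)"
      by (simp_all only: mult.assoc)
    with le have "(unit_ball_vol (real ?N) * \<kappa> ^ ?N) * r ^ ?N \<le> (2 * 4 ^ ?N * \<eta>) * r ^ ?N"
      unfolding e1 e2 by (simp only: mult_ac)
    then have "unit_ball_vol (real ?N) * \<kappa> ^ ?N \<le> 2 * 4 ^ ?N * \<eta>" using r by simp
    then show False using \<eta> by simp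
  qed
  show ?thesis
    unfolding flat_set_def
  proof (intro ballI)
    fix x y assume "x \<in> C" "y \<in> C"
    then show "\<bar>(x - y) \<bullet> \<nu>\<bar> \<le> \<kappa> * norm (x - y)"
      using key[of x y] key[of y x] by (simp add: inner_diff_left norm_minus_commute)
  qed
qed

section \<open>Neighbourhoods and one-sided layers of compact sets\<close>

definition thicken :: "'a::metric_space set \<Rightarrow> real \<Rightarrow> 'a set" where
  "thicken E \<epsilon> = (\<Union>x\<in>E. ball x \<epsilon>)"

lemma open_thicken [simp]: "open (thicken E \<epsilon>)" by (auto simp: thicken_def)

lemma thicken_borel [measurable, simp]: "thicken E \<epsilon> \<in> sets borel" by (intro borel_open open_thicken)

lemma eventually_thicken_subset:
  assumes "compact E" "open U" "E \<subseteq> U"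
  shows "\<forall>\<^sub>F \<epsilon> in at_right 0. thicken E \<epsilon> \<subseteq> U"
proof -
  obtain e where e: "e > 0" "(\<Union>x\<in>E. ball x e) \<subseteq> U" using compact_subset_open_imp_ball_epsilon_subset[OF assms] .
  have "thicken E \<epsilon> \<subseteq> U" if "\<epsilon> < e" for \<epsilon>
    using e(2) that unfolding thicken_def by (force simp: subset_iff)
  then show ?thesis unfolding eventually_at_right_field using e by blast
qed

text \<open>By outer regularity a compact set lies in an open set of almost the same measure, and
  small neighbourhoods fit into that open set.\<close>

lemma eventually_emeasure_thicken_le:
  fixes E :: "'a::euclidean_space set"
  assumes E: "compact E" and "0 < \<delta>"
  shows "\<forall>\<^sub>F \<epsilon> in at_right 0. emeasure lborel (thicken E \<epsilon>) \<le> emeasure lborel E + ennreal \<delta>"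
proof -
  have EB: "E \<in> sets borel" using E by (intro borel_closed compact_imp_closed)
  then have "E \<in> sets lebesgue" by simp
  then obtain U where U: "open U" "E \<subseteq> U" "U - E \<in> lmeasurable" "emeasure lebesgue (U - E) < ennreal \<delta>"
    by (rule sets_lebesgue_outer_open) (use \<open>0 < \<delta>\<close> in auto)
  have UB: "U \<in> sets borel" using U by simp
  have "emeasure lborel U = emeasure lborel E + emeasure lborel (U - E)"
    using EB UB U(2) by (subst plus_emeasure) (auto simp: Un_absorb1)
  also have "emeasure lborel (U - E) \<le> ennreal \<delta>" using U(4) EB UB by (simp add: less_imp_le)
  finally have le: "emeasure lborel U \<le> emeasure lborel E + ennreal \<delta>" by (simp add: add_left_mono)
  show ?thesis
    using eventually_thicken_subset[OF E U(1,2)]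
  proof eventually_elim
    case (elim \<epsilon>)
    then show ?case using le UB by (intro order_trans[OF emeasure_mono le]) auto
  qed
qed

text \<open>A displacement that crosses a piece starts in the layer for \<open>- \<nu>\<close> and
  ends in the layer for \<open>\<nu>\<close>. As the sum of \<open>C\<close> and a closed half ball
  the layer of a compact set is compact.\<close>

definition upper_layer :: "'a::real_inner \<Rightarrow> real \<Rightarrow> 'a set \<Rightarrow> 'a set" where
  "upper_layer \<nu> \<epsilon> C = {c + v | c v. c \<in> C \<and> v \<in> {v. norm v \<le> \<epsilon> \<and> 0 \<le> v \<bullet> \<nu>}}"

lemma upper_layer_borel:
  fixes C :: "'a::euclidean_space set"
  assumes "compact C" shows "upper_layer \<nu> \<epsilon> C \<in> sets borel"
proof -
  have "{v. norm v \<le> \<epsilon> \<and> 0 \<le> v \<bullet> \<nu>} = cball 0 \<epsilon> \<inter> {v. 0 \<le> v \<bullet> \<nu>}" by auto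
  moreover have "closed {v. 0 \<le> v \<bullet> \<nu>}" by (intro closed_Collect_le continuous_intros)
  ultimately have "compact {v. norm v \<le> \<epsilon> \<and> 0 \<le> v \<bullet> \<nu>}" by (simp add: compact_Int_closed)
  then show ?thesis unfolding upper_layer_def
    by (intro borel_closed compact_imp_closed compact_sums assms)
qed

text \<open>Packing bound: over each point of \<open>F\<close> about \<open>1 / \<epsilon>\<close>
  balls of radius \<open>\<epsilon> / 4\<close> are stacked along \<open>\<nu>\<close>, and flatness
  keeps the stacks apart. Packing the prism instead of the piece bounds the number of points by a
  volume, with the rate expected of a set of dimension \<open>N - 1\<close>.\<close>

lemma emeasure_finite_separated_prism:
  fixes C F :: "(real^'n) set"
  assumes \<nu>: "norm \<nu> = 1" and flat: "flat_set \<kappa> \<nu> C" and \<kappa>: "0 \<le> \<kappa>" "\<kappa> \<le> 1/2"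
    and F: "finite F" "F \<subseteq> C" and \<epsilon>: "0 < \<epsilon>"
    and sep: "\<And>c d. c \<in> F \<Longrightarrow> d \<in> F \<Longrightarrow> c \<noteq> d \<Longrightarrow> \<epsilon> \<le> dist c d"
  shows "ennreal (real (card F) * (unit_ball_vol (real CARD('n)) * (\<epsilon> / 4) ^ CARD('n) / \<epsilon>))
    \<le> emeasure lborel (thicken (prism \<nu> 1 C) \<epsilon>)"
proof -
  let ?\<omega> = "unit_ball_vol (real CARD('n)) * (\<epsilon> / 4) ^ CARD('n)"
  \<comment> \<open>The indices \<open>j < n\<close> are exactly those for which the height
    \<open>j * \<epsilon>\<close> does not exceed 1.\<close>
  define n where "n = nat \<lfloor>1 / \<epsilon>\<rfloor> + 1"
  have "real (nat \<lfloor>1 / \<epsilon>\<rfloor>) = of_int \<lfloor>1 / \<epsilon>\<rfloor>" using \<epsilon> by simp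
  then have n: "1 / \<epsilon> \<le> real n" "real (n - 1) \<le> 1 / \<epsilon>" unfolding n_def by linarith+
  define I where "I = F \<times> {..<n}"
  define p where "p = (\<lambda>(c, j). c + (real j * \<epsilon>) *\<^sub>R \<nu>)"
  have fin: "finite I" using F by (simp add: I_def)
  have dist: "\<epsilon> / 2 \<le> dist (p i) (p j)" if ij: "i \<in> I" "j \<in> I" "i \<noteq> j" for i j
  proof -
    obtain c k where i: "i = (c, k)" "c \<in> F" by (cases i) (use ij in \<open>auto simp: I_def\<close>)
    obtain d l where j: "j = (d, l)" "d \<in> F" by (cases j) (use ij in \<open>auto simp: I_def\<close>)
    show ?thesis
    proof (cases "c = d")
      case True
      then have "k \<noteq> l" using i j ij by auto
      then have "1 \<le> \<bar>real k - real l\<bar>" by linarith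
      then have "1 * \<epsilon> \<le> \<bar>real k - real l\<bar> * \<epsilon>" using \<epsilon> by (intro mult_right_mono) auto
      moreover have "p i - p j = ((real k - real l) * \<epsilon>) *\<^sub>R \<nu>"
        using True by (simp add: i j p_def scaleR_diff_left algebra_simps)
      then have "dist (p i) (p j) = \<bar>real k - real l\<bar> * \<epsilon>"
        using \<nu> \<epsilon> by (simp add: dist_norm abs_mult)
      ultimately show ?thesis using \<epsilon> by linarith
    next
      case False
      \<comment> \<open>Projection multiplies distances within \<open>C\<close> by at least
        \<open>sqrt (3/4)\<close>, which exceeds \<open>1/2\<close>; centres over different points
        therefore stay \<open>\<epsilon> / 2\<close> apart whatever their heights.\<close>
      have "\<kappa>\<^sup>2 \<le> (1/2)\<^sup>2" using \<kappa> by (intro power_mono) auto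
      then have "3/4 \<le> 1 - \<kappa>\<^sup>2" by (simp add: power2_eq_square)
      moreover have "\<epsilon>\<^sup>2 \<le> (norm (c - d))\<^sup>2" using sep[OF i(2) j(2) False] \<epsilon> by (intro power_mono) (auto simp: dist_norm)
      ultimately have "3/4 * \<epsilon>\<^sup>2 \<le> (1 - \<kappa>\<^sup>2) * (norm (c - d))\<^sup>2" by (intro mult_mono) auto
      also have "\<dots> \<le> (norm (proj_perp \<nu> c - proj_perp \<nu> d))\<^sup>2"
        using flat_set_proj_perp[OF \<nu> flat] i j F by auto
      also have "proj_perp \<nu> c - proj_perp \<nu> d = proj_perp \<nu> (p i - p j)"
        by (simp add: linear_diff[OF linear_proj_perp] i j p_def proj_perp_add_scaleR[OF \<nu>])
      also have "(norm \<dots>)\<^sup>2 \<le> (norm (p i - p j))\<^sup>2"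
        using norm_proj_perp_le[OF \<nu>] by (intro power_mono) auto
      finally have "3/4 * \<epsilon>\<^sup>2 \<le> (norm (p i - p j))\<^sup>2" .
      moreover have "(\<epsilon> / 2)\<^sup>2 \<le> 3/4 * \<epsilon>\<^sup>2" by (simp add: power_divide)
      ultimately have "(\<epsilon> / 2)\<^sup>2 \<le> (norm (p i - p j))\<^sup>2" by linarith
      then show ?thesis unfolding dist_norm by (rule power2_le_imp_le) simp
    qed
  qed
  have "disjoint_family_on (\<lambda>i. ball (p i) (\<epsilon> / 4)) I"
  proof (unfold disjoint_family_on_def, intro ballI impI)
    fix i j assume "i \<in> I" "j \<in> I" "i \<noteq> j"
    from dist[OF this] show "ball (p i) (\<epsilon> / 4) \<inter> ball (p j) (\<epsilon> / 4) = {}"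
      by (intro disjoint_ballI) simp
  qed
  then have "(\<Sum>i\<in>I. emeasure lborel (ball (p i) (\<epsilon> / 4))) = emeasure lborel (\<Union>i\<in>I. ball (p i) (\<epsilon> / 4))"
    using fin by (intro sum_emeasure) auto
  also have "\<dots> \<le> emeasure lborel (thicken (prism \<nu> 1 C) \<epsilon>)"
  proof (rule emeasure_mono)
    have "p i \<in> prism \<nu> 1 C" if iI: "i \<in> I" for i
    proof -
      obtain c k where i: "i = (c, k)" "c \<in> F" "k < n" by (cases i) (use iI in \<open>auto simp: I_def\<close>)
      have "real k \<le> 1 / \<epsilon>" using i n by simp
      then have "real k * \<epsilon> \<le> 1" using \<epsilon> by (simp add: field_simps)
      then show ?thesis unfolding mem_prism using i F \<epsilon>
        by (intro bexI[of _ c] exI[of _ "real k * \<epsilon>"]) (auto simp: p_def)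
    qed
    moreover have "ball (p i) (\<epsilon> / 4) \<subseteq> ball (p i) \<epsilon>" for i using \<epsilon> by (intro subset_ball) auto
    ultimately show "(\<Union>i\<in>I. ball (p i) (\<epsilon> / 4)) \<subseteq> thicken (prism \<nu> 1 C) \<epsilon>"
      unfolding thicken_def by blast
  qed simp
  also have "(\<Sum>i\<in>I. emeasure lborel (ball (p i) (\<epsilon> / 4))) = ennreal (real (card I) * ?\<omega>)"
    using \<epsilon> by (simp add: emeasure_ball ennreal_mult' ennreal_of_nat_eq_real_of_nat)
  finally have *: "ennreal (real (card I) * ?\<omega>) \<le> emeasure lborel (thicken (prism \<nu> 1 C) \<epsilon>)" .
  have "real (card F) * (1 / \<epsilon>) \<le> real (card I)"
    using mult_left_mono[OF n(1), of "real (card F)"] F by (simp add: I_def card_cartesian_product)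
  then have "real (card F) * (1 / \<epsilon>) * ?\<omega> \<le> real (card I) * ?\<omega>"
    using \<epsilon> by (intro mult_right_mono mult_nonneg_nonneg) auto
  then have "ennreal (real (card F) * (?\<omega> / \<epsilon>)) \<le> ennreal (real (card I) * ?\<omega>)"
    by (intro ennreal_leI) (simp add: field_simps)
  then show ?thesis using * by (rule order_trans)
qed

text \<open>An \<open>\<epsilon>\<close>-separated subset of \<open>C\<close> whose balls of radius
  \<open>5 * \<epsilon>\<close> cover \<open>C\<close> reduces the estimate to balls of radius
  \<open>6 * \<epsilon>\<close>. In such a ball a point of the layer is either on the positive side
  of the centre, where \<open>A\<close> is thin, or in a slab below the centre, whose thickness
  \<open>5 * \<kappa> * \<epsilon>\<close> comes from flatness. The packing bound controls the
  number of centres; 24 is the product of 6 with the 4 from the packed radius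
  \<open>\<epsilon> / 4\<close>.\<close>

lemma emeasure_thin_upper_layer_le:
  fixes C :: "(real^'n) set"
  assumes [measurable]: "A \<in> sets borel" and C: "compact C"
    and \<nu>: "norm \<nu> = 1" and flat: "flat_set \<kappa> \<nu> C" and \<kappa>: "0 \<le> \<kappa>" "\<kappa> \<le> 1/2" and "0 \<le> \<eta>"
    and thin: "\<And>x. x \<in> C \<Longrightarrow> thin_at A \<nu> \<eta> \<rho>0 x" and \<epsilon>: "0 < \<epsilon>" "6 * \<epsilon> < \<rho>0"
  shows "emeasure lborel (A \<inter> upper_layer \<nu> \<epsilon> C)
    \<le> ennreal (\<epsilon> * (24 ^ CARD('n) / unit_ball_vol (real CARD('n)) * (\<eta> + unit_ball_vol (real (CARD('n) - 1)) * \<kappa>)))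
       * emeasure lborel (thicken (prism \<nu> 1 C) \<epsilon>)"
proof -
  let ?N = "CARD('n)"
  let ?m = "?N - 1"
  let ?W = "unit_ball_vol (real ?m)"
  have N: "Suc ?m = ?N" using zero_less_card_finite[where 'a = 'n] by simp
  obtain F0 where F0: "F0 \<subseteq> C" "finite F0" "C \<subseteq> (\<Union>c\<in>F0. ball c \<epsilon>)"
    using compactE_image[OF C, of C "\<lambda>c. ball c \<epsilon>"] \<epsilon> by (metis UN_I centre_in_ball open_ball subsetI)
  have bd: "0 < \<epsilon> \<and> \<epsilon> \<le> \<epsilon>" if "c \<in> F0" for c using \<epsilon> by simp
  obtain F where "countable F" and F: "F \<subseteq> F0" "pairwise (\<lambda>i j. disjnt (ball i \<epsilon>) (ball j \<epsilon>)) F" "C \<subseteq> (\<Union>c\<in>F. ball c (5 * \<epsilon>))"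
    by (rule Vitali_covering_lemma_balls[where a = "\<lambda>c. c" and r = "\<lambda>_. \<epsilon>", OF F0(3) bd])
  have fin: "finite F" using F F0 finite_subset by blast
  have FC: "F \<subseteq> C" using F F0 by blast
  have sep: "\<epsilon> \<le> dist c d" if "c \<in> F" "d \<in> F" "c \<noteq> d" for c d
  proof (rule ccontr)
    assume "\<not> \<epsilon> \<le> dist c d"
    then have "d \<in> ball c \<epsilon>" "d \<in> ball d \<epsilon>" using \<epsilon> by auto
    then show False using pairwiseD[OF F(2) that] by (auto simp: disjnt_def)
  qed
  define S where "S c = {y. y \<bullet> \<nu> \<in> {-(5 * \<kappa> * \<epsilon>)..0} \<and> norm (proj_perp \<nu> y) \<le> 6 * \<epsilon>}" for c :: "real^'n"
  have S[measurable]: "S c \<in> sets borel" for c unfolding S_def by measurable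
  have cov: "A \<inter> upper_layer \<nu> \<epsilon> C \<subseteq> (\<Union>c\<in>F. (A \<inter> half_ball c \<nu> (6 * \<epsilon>)) \<union> (+) c ` S c)"
  proof
    fix y assume y: "y \<in> A \<inter> upper_layer \<nu> \<epsilon> C"
    then obtain c v where cv: "y = c + v" "c \<in> C" "norm v \<le> \<epsilon>" "0 \<le> v \<bullet> \<nu>" by (auto simp: upper_layer_def)
    then obtain d where d: "d \<in> F" "dist d c < 5 * \<epsilon>" using F(3) by auto
    have nd: "norm (c - d) < 5 * \<epsilon>" using d by (simp add: dist_norm norm_minus_commute)
    have "\<bar>(c - d) \<bullet> \<nu>\<bar> \<le> \<kappa> * norm (c - d)" using flat cv d FC by (auto simp: flat_set_def)
    also have "\<dots> \<le> \<kappa> * (5 * \<epsilon>)" using nd \<kappa> by (intro mult_left_mono) auto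
    finally have low: "- (5 * \<kappa> * \<epsilon>) \<le> (y - d) \<bullet> \<nu>" using cv by (simp add: inner_diff_left inner_add_left)
    have "norm (y - d) \<le> norm v + norm (c - d)" using norm_triangle_ineq[of v "c - d"] by (simp add: cv(1) algebra_simps)
    then have nyd: "norm (y - d) < 6 * \<epsilon>" using cv nd by simp
    show "y \<in> (\<Union>c\<in>F. (A \<inter> half_ball c \<nu> (6 * \<epsilon>)) \<union> (+) c ` S c)"
    proof (cases "0 < (y - d) \<bullet> \<nu>")
      case True
      then have "y \<in> half_ball d \<nu> (6 * \<epsilon>)" using nyd by (simp add: half_ball_def dist_norm norm_minus_commute)
      then show ?thesis using d y by blast
    next
      case False
      have "norm (proj_perp \<nu> (y - d)) \<le> 6 * \<epsilon>" using norm_proj_perp_le[OF \<nu>, of "y - d"] nyd by linarith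
      then have "y - d \<in> S d" using False low by (simp add: S_def)
      then have "d + (y - d) \<in> (+) d ` S d" by (rule imageI)
      then show ?thesis using d by auto
    qed
  qed
  have SS: "(+) c ` S c \<in> sets borel" for c using S by (rule translation_borel)
  have each: "emeasure lborel ((A \<inter> half_ball c \<nu> (6 * \<epsilon>)) \<union> (+) c ` S c) \<le> ennreal (6 ^ ?N * \<epsilon> ^ ?N * (\<eta> + ?W * \<kappa>))"
    if c: "c \<in> F" for c
  proof -
    have "emeasure lborel ((A \<inter> half_ball c \<nu> (6 * \<epsilon>)) \<union> (+) c ` S c)
       \<le> emeasure lborel (A \<inter> half_ball c \<nu> (6 * \<epsilon>)) + emeasure lborel ((+) c ` S c)"
      using SS by (intro emeasure_subadditive) auto
    also have "emeasure lborel ((+) c ` S c) = emeasure lborel (S c)"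
      by (rule emeasure_lborel_translation) (rule S)
    also have "\<dots> = ennreal (5 * \<kappa> * \<epsilon> * (?W * (6 * \<epsilon>) ^ ?m))"
      using emeasure_cylinder[OF \<nu>, of "6 * \<epsilon>" "-(5 * \<kappa> * \<epsilon>)" 0] \<epsilon> \<kappa> by (simp add: S_def)
    also have "emeasure lborel (A \<inter> half_ball c \<nu> (6 * \<epsilon>)) \<le> ennreal (\<eta> * (6 * \<epsilon>) ^ ?N)"
      using thin[of c, unfolded thin_at_def, rule_format, of "6 * \<epsilon>"] c FC \<epsilon> by auto
    finally have "emeasure lborel ((A \<inter> half_ball c \<nu> (6 * \<epsilon>)) \<union> (+) c ` S c)
       \<le> ennreal (\<eta> * (6 * \<epsilon>) ^ ?N) + ennreal (5 * \<kappa> * \<epsilon> * (?W * (6 * \<epsilon>) ^ ?m))"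
      by (simp add: add_right_mono)
    also have "\<dots> = ennreal (\<eta> * (6 * \<epsilon>) ^ ?N + 5 * \<kappa> * \<epsilon> * (?W * (6 * \<epsilon>) ^ ?m))"
      using \<open>0 \<le> \<eta>\<close> \<epsilon> \<kappa> by (intro ennreal_plus[symmetric]) auto
    also have "\<dots> \<le> ennreal (6 ^ ?N * \<epsilon> ^ ?N * (\<eta> + ?W * \<kappa>))"
    proof (rule ennreal_leI)
      \<comment> \<open>Enlarging 5 to 6 gives both contributions the common factor
        \<open>(6 * \<epsilon>) ^ N\<close>.\<close>
      have "5 * \<kappa> * \<epsilon> * (?W * (6 * \<epsilon>) ^ ?m) \<le> 6 * \<kappa> * \<epsilon> * (?W * (6 * \<epsilon>) ^ ?m)"
        using \<epsilon> \<kappa> by (intro mult_right_mono mult_nonneg_nonneg) auto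
      also have "\<dots> = (6 * \<epsilon>) ^ Suc ?m * (?W * \<kappa>)" by (simp only: power_Suc mult_ac)
      also have "\<dots> = (6 * \<epsilon>) ^ ?N * (?W * \<kappa>)" by (simp only: N)
      finally show "\<eta> * (6 * \<epsilon>) ^ ?N + 5 * \<kappa> * \<epsilon> * (?W * (6 * \<epsilon>) ^ ?m) \<le> 6 ^ ?N * \<epsilon> ^ ?N * (\<eta> + ?W * \<kappa>)"
        by (simp add: power_mult_distrib algebra_simps)
    qed
    finally show ?thesis .
  qed
  let ?\<omega> = "unit_ball_vol (real ?N)"
  have \<omega>: "0 < ?\<omega>" by simp
  have W: "0 \<le> ?W" by simp
  have "emeasure lborel (A \<inter> upper_layer \<nu> \<epsilon> C) \<le> emeasure lborel (\<Union>c\<in>F. (A \<inter> half_ball c \<nu> (6 * \<epsilon>)) \<union> (+) c ` S c)"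
    using fin SS by (intro emeasure_mono cov) (auto intro!: sets.finite_UN)
  also have "\<dots> \<le> (\<Sum>c\<in>F. emeasure lborel ((A \<inter> half_ball c \<nu> (6 * \<epsilon>)) \<union> (+) c ` S c))"
    using fin SS by (intro emeasure_subadditive_finite) auto
  also have "\<dots> \<le> (\<Sum>c\<in>F. ennreal (6 ^ ?N * \<epsilon> ^ ?N * (\<eta> + ?W * \<kappa>)))" by (intro sum_mono each)
  also have "\<dots> = ennreal (real (card F) * (6 ^ ?N * \<epsilon> ^ ?N * (\<eta> + ?W * \<kappa>)))"
    by (simp add: ennreal_mult' ennreal_of_nat_eq_real_of_nat)
  also have "real (card F) * (6 ^ ?N * \<epsilon> ^ ?N * (\<eta> + ?W * \<kappa>))
     = (\<epsilon> * (24 ^ ?N / ?\<omega> * (\<eta> + ?W * \<kappa>))) * (real (card F) * (?\<omega> * (\<epsilon> / 4) ^ ?N / \<epsilon>))"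
  proof -
    have "24 ^ ?N * (\<epsilon> / 4) ^ ?N = (24 * (\<epsilon> / 4)) ^ ?N" by (rule power_mult_distrib[symmetric])
    also have "24 * (\<epsilon> / 4) = 6 * \<epsilon>" by simp
    finally have "24 ^ ?N * (\<epsilon> / 4) ^ ?N = 6 ^ ?N * \<epsilon> ^ ?N" by (simp only: power_mult_distrib)
    moreover have "(\<epsilon> * (X / w * c)) * (k * (w * Y / \<epsilon>)) = k * ((X * Y) * c)" if "w \<noteq> 0" for w X Y c k :: real
      using \<epsilon> that by (simp add: divide_simps)
    ultimately show ?thesis using \<omega> by (metis less_irrefl)
  qed
  also have "ennreal ((\<epsilon> * (24 ^ ?N / ?\<omega> * (\<eta> + ?W * \<kappa>))) * (real (card F) * (?\<omega> * (\<epsilon> / 4) ^ ?N / \<epsilon>)))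
     = ennreal (\<epsilon> * (24 ^ ?N / ?\<omega> * (\<eta> + ?W * \<kappa>))) * ennreal (real (card F) * (?\<omega> * (\<epsilon> / 4) ^ ?N / \<epsilon>))"
    using \<epsilon> \<omega> W \<kappa> \<open>0 \<le> \<eta>\<close> by (intro ennreal_mult) auto
  also have "\<dots> \<le> ennreal (\<epsilon> * (24 ^ ?N / ?\<omega> * (\<eta> + ?W * \<kappa>))) * emeasure lborel (thicken (prism \<nu> 1 C) \<epsilon>)"
    by (intro mult_left_mono emeasure_finite_separated_prism[OF \<nu> flat \<kappa> fin FC \<epsilon>(1) sep]) auto
  finally show ?thesis .
qed

section \<open>Differences of the function along one fixed displacement\<close>

definition slice_energy :: "real \<Rightarrow> ('a::euclidean_space \<Rightarrow> 'b::euclidean_space) \<Rightarrow> 'a set \<Rightarrow> real \<Rightarrow> 'a \<Rightarrow> ennreal" where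
  "slice_energy q w S \<epsilon> z =
     (\<integral>\<^sup>+x\<in>S. indicator S (x + \<epsilon> *\<^sub>R z) * ennreal (norm (w x - w (x + \<epsilon> *\<^sub>R z)) powr q) \<partial>lborel)"

text \<open>Points \<open>c - t \<nu>\<close> with
  \<open>0 \<le> t \<le> \<epsilon> (z \<bullet> \<nu>)\<close> are on the negative side of
  \<open>c\<close> and are carried to its nonnegative side by \<open>\<epsilon> z\<close>; they form
  the prism in direction \<open>- \<nu>\<close>. If the start is \<open>\<tau>\<close>-close to
  \<open>b\<close> and the end \<open>\<tau>\<close>-close to \<open>a\<close>, the difference is at
  least \<open>norm (a - b) - 2 * \<tau>\<close>. The other starting points are counted in the two
  layers, those with a bad end after a translation.\<close>

lemma crossing_slice_lower_bound:
  fixes w :: "'a::euclidean_space \<Rightarrow> 'b::euclidean_space" and z :: 'a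
  assumes w[measurable]: "w \<in> borel_measurable borel" and C: "compact C" and "norm \<nu> = 1" "0 < \<epsilon>" "norm z < 1" "0 \<le> z \<bullet> \<nu>"
    and \<tau>: "2 * \<tau> \<le> norm (a - b)" and q: "0 \<le> q"
  defines "v \<equiv> ennreal ((norm (a - b) - 2 * \<tau>) powr q)"
  shows "v * emeasure lborel (prism (- \<nu>) (\<epsilon> * (z \<bullet> \<nu>)) C)
    \<le> slice_energy q w (thicken C \<epsilon>) \<epsilon> z
     + v * (emeasure lborel ({y. \<tau> < norm (w y - b)} \<inter> upper_layer (- \<nu>) \<epsilon> C)
          + emeasure lborel ({y. \<tau> < norm (w y - a)} \<inter> upper_layer \<nu> \<epsilon> C))"
proof -
  let ?X = "prism (- \<nu>) (\<epsilon> * (z \<bullet> \<nu>)) C"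
  let ?A = "{y. \<tau> < norm (w y - a)} \<inter> upper_layer \<nu> \<epsilon> C"
  let ?B = "{y. \<tau> < norm (w y - b)} \<inter> upper_layer (- \<nu>) \<epsilon> C"
  let ?G = "{x \<in> ?X. norm (a - b) - 2 * \<tau> \<le> norm (w x - w (x + \<epsilon> *\<^sub>R z))}"
  have zn: "z \<bullet> \<nu> \<le> norm z" using Cauchy_Schwarz_ineq2[of z \<nu>] \<open>norm \<nu> = 1\<close> by simp
  have X[measurable]: "?X \<in> sets borel" by (rule prism_borel[OF C])
  have [measurable]: "upper_layer \<nu> \<epsilon> C \<in> sets borel" "upper_layer (- \<nu>) \<epsilon> C \<in> sets borel"
    using upper_layer_borel[OF C] by auto
  have AB[measurable]: "?A \<in> sets borel" "?B \<in> sets borel" by measurable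
  have tA: "(+) (- (\<epsilon> *\<^sub>R z)) ` ?A \<in> sets borel" using AB(1) by (rule translation_borel)
  have G[measurable]: "?G \<in> sets borel" by measurable
  have loc: "x \<in> thicken C \<epsilon> \<and> x + \<epsilon> *\<^sub>R z \<in> thicken C \<epsilon> \<and> x \<in> upper_layer (- \<nu>) \<epsilon> C \<and> x + \<epsilon> *\<^sub>R z \<in> upper_layer \<nu> \<epsilon> C"
    if x: "x \<in> ?X" for x
  proof -
    obtain c t where c: "c \<in> C" "0 \<le> t" "t \<le> \<epsilon> * (z \<bullet> \<nu>)" "x = c + t *\<^sub>R (- \<nu>)" using x by (auto simp: mem_prism)
    have "\<epsilon> * (z \<bullet> \<nu>) < \<epsilon> * 1" using zn \<open>norm z < 1\<close> \<open>0 < \<epsilon>\<close> by (intro mult_strict_left_mono) auto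
    then have t1: "t < \<epsilon>" using c by simp
    have xb: "x \<in> ball c \<epsilon>" using c t1 \<open>norm \<nu> = 1\<close> by (simp add: dist_norm)
    have lo: "x \<in> upper_layer (- \<nu>) \<epsilon> C"
      unfolding upper_layer_def using c t1 \<open>norm \<nu> = 1\<close>
      by (intro CollectI exI[of _ c] exI[of _ "t *\<^sub>R (- \<nu>)"] conjI) (auto simp: dot_square_norm)
    have eq: "x + \<epsilon> *\<^sub>R z = c + (\<epsilon> *\<^sub>R z - t *\<^sub>R \<nu>)" using c by simp
    have "(norm (\<epsilon> *\<^sub>R z - t *\<^sub>R \<nu>))\<^sup>2 =
        (norm (\<epsilon> *\<^sub>R z))\<^sup>2 - 2 * ((\<epsilon> *\<^sub>R z) \<bullet> (t *\<^sub>R \<nu>)) + (norm (t *\<^sub>R \<nu>))\<^sup>2"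
      unfolding power2_norm_eq_inner inner_diff_left inner_diff_right
      by (subst inner_commute[of "t *\<^sub>R \<nu>" "\<epsilon> *\<^sub>R z"]) linarith
    then have "(norm (\<epsilon> *\<^sub>R z - t *\<^sub>R \<nu>))\<^sup>2 = (\<epsilon> * norm z)\<^sup>2 - 2 * (t * (\<epsilon> * (z \<bullet> \<nu>))) + t\<^sup>2"
      using \<open>norm \<nu> = 1\<close> by (simp add: power_mult_distrib mult_ac)
    \<comment> \<open>Since \<open>t\<close> does not exceed the normal component of
      \<open>\<epsilon> z\<close>, removing \<open>t \<nu>\<close> does not lengthen the vector, and
      the end point is still within \<open>\<epsilon>\<close> of \<open>c\<close>.\<close>
    moreover have "t\<^sup>2 \<le> t * (\<epsilon> * (z \<bullet> \<nu>))" unfolding power2_eq_square using c by (intro mult_left_mono) auto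
    moreover have "0 \<le> t * (\<epsilon> * (z \<bullet> \<nu>))" using c by auto
    ultimately have "(norm (\<epsilon> *\<^sub>R z - t *\<^sub>R \<nu>))\<^sup>2 \<le> (\<epsilon> * norm z)\<^sup>2" by linarith
    then have "norm (\<epsilon> *\<^sub>R z - t *\<^sub>R \<nu>) \<le> \<epsilon> * norm z" by (rule power2_le_imp_le) (use \<open>0 < \<epsilon>\<close> in auto)
    moreover have "\<epsilon> * norm z < \<epsilon> * 1" using \<open>norm z < 1\<close> \<open>0 < \<epsilon>\<close> by (intro mult_strict_left_mono) auto
    ultimately have nl: "norm (\<epsilon> *\<^sub>R z - t *\<^sub>R \<nu>) < \<epsilon>" by simp
    have "0 \<le> (\<epsilon> *\<^sub>R z - t *\<^sub>R \<nu>) \<bullet> \<nu>" using c \<open>norm \<nu> = 1\<close> by (simp add: inner_diff_left dot_square_norm)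
    then have up: "x + \<epsilon> *\<^sub>R z \<in> upper_layer \<nu> \<epsilon> C" unfolding upper_layer_def eq using c(1) nl by (auto intro: less_imp_le)
    have "x + \<epsilon> *\<^sub>R z \<in> ball c \<epsilon>" unfolding eq using nl by (simp add: dist_norm norm_minus_commute)
    then show ?thesis using c(1) xb lo up unfolding thicken_def by blast
  qed
  have cov: "?X \<subseteq> ?G \<union> (?B \<union> (+) (- (\<epsilon> *\<^sub>R z)) ` ?A)"
  proof
    fix x assume x: "x \<in> ?X"
    show "x \<in> ?G \<union> (?B \<union> (+) (- (\<epsilon> *\<^sub>R z)) ` ?A)"
    proof (cases "norm (w x - b) \<le> \<tau> \<and> norm (w (x + \<epsilon> *\<^sub>R z) - a) \<le> \<tau>")
      case True
      have "norm (a - b) = norm ((a - w (x + \<epsilon> *\<^sub>R z)) + (w (x + \<epsilon> *\<^sub>R z) - w x) + (w x - b))" by simp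
      also have "\<dots> \<le> norm (a - w (x + \<epsilon> *\<^sub>R z)) + norm (w (x + \<epsilon> *\<^sub>R z) - w x) + norm (w x - b)"
        by (meson norm_triangle_ineq norm_triangle_mono order_refl)
      finally show ?thesis using True x by (simp add: norm_minus_commute)
    next
      case False
      then consider "x \<in> ?B" | "x + \<epsilon> *\<^sub>R z \<in> ?A" using loc[OF x] by fastforce
      then show ?thesis
      proof cases
        case 2
        then have "- (\<epsilon> *\<^sub>R z) + (x + \<epsilon> *\<^sub>R z) \<in> (+) (- (\<epsilon> *\<^sub>R z)) ` ?A" by (rule imageI)
        then show ?thesis by simp
      qed blast
    qed
  qed
  have "emeasure lborel ?X \<le> emeasure lborel (?G \<union> (?B \<union> (+) (- (\<epsilon> *\<^sub>R z)) ` ?A))"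
    using tA AB G by (intro emeasure_mono cov) auto
  also have "\<dots> \<le> emeasure lborel ?G + emeasure lborel (?B \<union> (+) (- (\<epsilon> *\<^sub>R z)) ` ?A)"
    using tA AB G by (intro emeasure_subadditive) auto
  also have "\<dots> \<le> emeasure lborel ?G + (emeasure lborel ?B + emeasure lborel ((+) (- (\<epsilon> *\<^sub>R z)) ` ?A))"
    using tA AB by (intro add_left_mono emeasure_subadditive) auto
  also have "emeasure lborel ((+) (- (\<epsilon> *\<^sub>R z)) ` ?A) = emeasure lborel ?A"
    using AB(1) by (rule emeasure_lborel_translation)
  finally have "v * emeasure lborel ?X \<le> v * (emeasure lborel ?G + (emeasure lborel ?B + emeasure lborel ?A))"
    by (rule mult_left_mono) simp
  also have "\<dots> = v * emeasure lborel ?G + v * (emeasure lborel ?B + emeasure lborel ?A)" by (rule distrib_left)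
  also have "v * emeasure lborel ?G = (\<integral>\<^sup>+x. v * indicator ?G x \<partial>lborel)"
    using G by (subst nn_integral_cmult_indicator) auto
  also have "\<dots> \<le> slice_energy q w (thicken C \<epsilon>) \<epsilon> z"
    unfolding slice_energy_def
  proof (rule nn_integral_mono)
    fix x
    show "v * indicator ?G x \<le> indicator (thicken C \<epsilon>) (x + \<epsilon> *\<^sub>R z) * ennreal (norm (w x - w (x + \<epsilon> *\<^sub>R z)) powr q) * indicator (thicken C \<epsilon>) x"
    proof (cases "x \<in> ?G")
      case True
      then have "v \<le> ennreal (norm (w x - w (x + \<epsilon> *\<^sub>R z)) powr q)"
        unfolding v_def using \<tau> q by (intro ennreal_leI powr_mono2) auto
      then show ?thesis using True loc[of x] by simp
    qed simp
  qed
  finally show ?thesis by (simp add: add_right_mono)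
qed

subsection \<open>Energy near one piece of the jump set\<close>

text \<open>The energy after the substitution \<open>y = x + \<epsilon> z\<close>, with the integral
  over \<open>z\<close> outside. A pair of points counts only if both lie in \<open>S\<close>; this
  makes the energy superadditive over disjoint sets.\<close>

definition local_energy :: "real \<Rightarrow> ('a::euclidean_space \<Rightarrow> 'b::euclidean_space) \<Rightarrow> 'a set \<Rightarrow> real \<Rightarrow> ennreal" where
  "local_energy q w S \<epsilon> =
    (\<integral>\<^sup>+z\<in>ball 0 1. ennreal (1 / (\<epsilon> * norm z)) *
       slice_energy q w S \<epsilon> z \<partial>lborel)"

lemma measurable_slice_integrand:
  fixes w :: "'a::euclidean_space \<Rightarrow> 'b::euclidean_space"
  assumes w: "w \<in> borel_measurable borel" and S: "S \<in> sets borel"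
  shows "(\<lambda>(z, x). indicator S (x + \<epsilon> *\<^sub>R z) * ennreal (norm (w x - w (x + \<epsilon> *\<^sub>R z)) powr q) * indicator S x)
    \<in> borel_measurable (borel \<Otimes>\<^sub>M borel)"
proof -
  have T: "(\<lambda>p. snd p + \<epsilon> *\<^sub>R fst p) \<in> (borel :: 'a measure) \<Otimes>\<^sub>M (borel :: 'a measure) \<rightarrow>\<^sub>M borel"
    unfolding borel_prod by (intro borel_measurable_continuous_onI continuous_intros)
  have ind: "(indicator S :: 'a \<Rightarrow> ennreal) \<in> borel_measurable borel"
    using S by (rule borel_measurable_indicator)
  note [measurable] = measurable_compose[OF T ind] measurable_compose[OF T w]
    measurable_compose[OF measurable_snd ind] measurable_compose[OF measurable_snd w]
  show ?thesis unfolding case_prod_beta by measurable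
qed

lemma measurable_slice_energy:
  fixes w :: "'a::euclidean_space \<Rightarrow> 'b::euclidean_space"
  assumes "w \<in> borel_measurable borel" "S \<in> sets borel"
  shows "slice_energy q w S \<epsilon> \<in> borel_measurable borel"
  unfolding slice_energy_def
proof (rule lborel.borel_measurable_nn_integral)
  have "sets ((borel :: 'a measure) \<Otimes>\<^sub>M (lborel :: 'a measure)) = sets (borel \<Otimes>\<^sub>M borel)"
    by (intro sets_pair_measure_cong) auto
  from measurable_cong_sets[OF this refl] measurable_slice_integrand[OF assms]
  show "(\<lambda>(z, x). indicator S (x + \<epsilon> *\<^sub>R z) * ennreal (norm (w x - w (x + \<epsilon> *\<^sub>R z)) powr q) * indicator S x)
    \<in> borel_measurable (borel \<Otimes>\<^sub>M lborel)" by blast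
qed

lemma local_energy_sum_le:
  fixes w :: "'a::euclidean_space \<Rightarrow> 'b::euclidean_space"
  assumes w[measurable]: "w \<in> borel_measurable borel" and fin: "finite I"
    and S: "\<And>i. i \<in> I \<Longrightarrow> S i \<in> sets borel" "\<And>i. i \<in> I \<Longrightarrow> S i \<subseteq> \<Omega>"
    and disj: "disjoint_family_on S I"
  shows "(\<Sum>i\<in>I. local_energy q w (S i) \<epsilon>) \<le> local_energy q w \<Omega> \<epsilon>"
proof -
  let ?g = "\<lambda>S z x. indicator S (x + \<epsilon> *\<^sub>R z) * ennreal (norm (w x - w (x + \<epsilon> *\<^sub>R z)) powr q) * indicator S x"
  note S(1)[measurable]
  note measurable_slice_energy[OF w S(1), unfolded slice_energy_def, measurable]
  have [measurable]: "(ball 0 1 :: 'a set) \<in> sets borel" by simp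
  have "(\<Sum>i\<in>I. local_energy q w (S i) \<epsilon>)
    = (\<integral>\<^sup>+z. (\<Sum>i\<in>I. ennreal (1 / (\<epsilon> * norm z)) * (\<integral>\<^sup>+x. ?g (S i) z x \<partial>lborel) * indicator (ball 0 1) z) \<partial>lborel)"
    unfolding local_energy_def slice_energy_def
    by (rule nn_integral_sum[symmetric]) measurable
  also have "\<dots> \<le> (\<integral>\<^sup>+z. ennreal (1 / (\<epsilon> * norm z)) * (\<integral>\<^sup>+x. ?g \<Omega> z x \<partial>lborel) * indicator (ball 0 1) z \<partial>lborel)"
  proof (rule nn_integral_mono)
    fix z :: 'a
    have "(\<Sum>i\<in>I. (\<integral>\<^sup>+x. ?g (S i) z x \<partial>lborel)) = (\<integral>\<^sup>+x. (\<Sum>i\<in>I. ?g (S i) z x) \<partial>lborel)"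
      by (rule nn_integral_sum[symmetric]) measurable
    also have "\<dots> \<le> (\<integral>\<^sup>+x. ?g \<Omega> z x \<partial>lborel)"
    proof (rule nn_integral_mono)
      fix x
      show "(\<Sum>i\<in>I. ?g (S i) z x) \<le> ?g \<Omega> z x"
      proof (cases "\<exists>i\<in>I. x \<in> S i")
        case True
        then obtain i where i: "i \<in> I" "x \<in> S i" by auto
        have "(\<Sum>j\<in>I. ?g (S j) z x) = (\<Sum>j\<in>I. if j = i then ?g (S j) z x else 0)"
          using disj i by (intro sum.cong) (auto simp: disjoint_family_on_def indicator_def)
        also have "\<dots> = ?g (S i) z x" using fin i by simp
        also have "\<dots> \<le> ?g \<Omega> z x" using S(2)[OF i(1)] by (auto simp: indicator_def)
        finally show ?thesis .
      next
        case False
        then show ?thesis by (simp add: indicator_def)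
      qed
    qed
    finally have "ennreal (1 / (\<epsilon> * norm z)) * (\<Sum>i\<in>I. (\<integral>\<^sup>+x. ?g (S i) z x \<partial>lborel)) * indicator (ball 0 1) z
      \<le> ennreal (1 / (\<epsilon> * norm z)) * (\<integral>\<^sup>+x. ?g \<Omega> z x \<partial>lborel) * indicator (ball 0 1) z"
      by (intro mult_right_mono mult_left_mono) auto
    then show "(\<Sum>i\<in>I. ennreal (1 / (\<epsilon> * norm z)) * (\<integral>\<^sup>+x. ?g (S i) z x \<partial>lborel) * indicator (ball 0 1) z)
      \<le> ennreal (1 / (\<epsilon> * norm z)) * (\<integral>\<^sup>+x. ?g \<Omega> z x \<partial>lborel) * indicator (ball 0 1) z"
      by (simp add: sum_distrib_left sum_distrib_right)
  qed
  finally show ?thesis by (simp add: local_energy_def slice_energy_def)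
qed

lemma nn_integral_lborel_affine:
  fixes x :: "'a::euclidean_space"
  assumes [measurable]: "f \<in> borel_measurable borel" and "0 < c"
  shows "(\<integral>\<^sup>+y. f y \<partial>lborel) = ennreal (c ^ DIM('a)) * (\<integral>\<^sup>+z. f (x + c *\<^sub>R z) \<partial>lborel)"
proof -
  have eq: "lborel = density (distr lborel borel (\<lambda>z. x + c *\<^sub>R z)) (\<lambda>_. ennreal (\<bar>c\<bar> ^ DIM('a)))"
    by (rule lborel_affine) (use \<open>0 < c\<close> in simp)
  have "(\<integral>\<^sup>+y. f y \<partial>lborel) = (\<integral>\<^sup>+y. f y \<partial>density (distr lborel borel (\<lambda>z. x + c *\<^sub>R z)) (\<lambda>_. ennreal (\<bar>c\<bar> ^ DIM('a))))"
    by (rule arg_cong[OF eq, of "\<lambda>M. nn_integral M f"])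
  also have "\<dots> = (\<integral>\<^sup>+y. ennreal (\<bar>c\<bar> ^ DIM('a)) * f y \<partial>distr lborel borel (\<lambda>z. x + c *\<^sub>R z))"
    by (rule nn_integral_density) measurable
  also have "\<dots> = (\<integral>\<^sup>+z. ennreal (\<bar>c\<bar> ^ DIM('a)) * f (x + c *\<^sub>R z) \<partial>lborel)"
    by (rule nn_integral_distr) measurable
  also have "\<dots> = (\<integral>\<^sup>+z. ennreal (c ^ DIM('a)) * f (x + c *\<^sub>R z) \<partial>lborel)"
    using \<open>0 < c\<close> by simp
  also have "\<dots> = ennreal (c ^ DIM('a)) * (\<integral>\<^sup>+z. f (x + c *\<^sub>R z) \<partial>lborel)"
    by (rule nn_integral_cmult) measurable
  finally show ?thesis .
qed

text \<open>The Jacobian cancels \<open>1 / \<epsilon> ^ N\<close> and the distance becomes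
  \<open>\<epsilon> |z|\<close>; Tonelli's theorem then exchanges the integrals. Joint measurability
  in \<open>x\<close> and \<open>z\<close> is the reason for the Borel representative
  \<open>w\<close>.\<close>

lemma BV_energy_eq_local_energy:
  fixes u w :: "real^'n \<Rightarrow> real^'d"
  assumes w[measurable]: "w \<in> borel_measurable borel" and \<Omega>[measurable]: "\<Omega> \<in> sets borel"
    and ae: "AE x in lborel. x \<in> \<Omega> \<longrightarrow> u x = w x" and \<epsilon>: "0 < \<epsilon>"
  shows "BV_energy q \<Omega> u \<epsilon> = local_energy q w \<Omega> \<epsilon>"
proof -
  let ?N = "CARD('n)"
  let ?k = "\<lambda>u x y. ennreal (1 / \<epsilon> ^ ?N * (norm (u x - u y) powr q / norm (x - y)))"
  have [measurable]: "(ball 0 1 :: (real^'n) set) \<in> sets borel" by simp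
  have ae': "AE x in lebesgue. x \<in> \<Omega> \<longrightarrow> u x = w x" using ae by (rule AE_completion)
  have "BV_energy q \<Omega> u \<epsilon> = (\<integral>\<^sup>+x\<in>\<Omega>. (\<integral>\<^sup>+y\<in>\<Omega> \<inter> ball x \<epsilon>. ?k w x y \<partial>lebesgue) \<partial>lebesgue)"
    unfolding BV_energy_def
  proof (rule nn_integral_cong_AE, use ae' in eventually_elim)
    case (elim x)
    show ?case
    proof (cases "x \<in> \<Omega>")
      case True
      have "(\<integral>\<^sup>+y\<in>\<Omega> \<inter> ball x \<epsilon>. ?k u x y \<partial>lebesgue) = (\<integral>\<^sup>+y\<in>\<Omega> \<inter> ball x \<epsilon>. ?k w x y \<partial>lebesgue)"
        by (rule nn_integral_cong_AE, use ae' in eventually_elim) (use elim True in \<open>auto simp: indicator_def\<close>)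
      then show ?thesis by simp
    qed simp
  qed
  also have "\<dots> = (\<integral>\<^sup>+x\<in>\<Omega>. (\<integral>\<^sup>+y\<in>\<Omega> \<inter> ball x \<epsilon>. ?k w x y \<partial>lborel) \<partial>lborel)"
    by (simp add: nn_integral_completion)
  also have "\<dots> = (\<integral>\<^sup>+x. (\<integral>\<^sup>+z. ennreal (1 / (\<epsilon> * norm z)) * (indicator \<Omega> (x + \<epsilon> *\<^sub>R z) *
       ennreal (norm (w x - w (x + \<epsilon> *\<^sub>R z)) powr q) * indicator \<Omega> x) * indicator (ball 0 1) z \<partial>lborel) \<partial>lborel)"
  proof (rule nn_integral_cong)
    fix x :: "real^'n"
    have [measurable]: "(\<Omega> \<inter> ball x \<epsilon>) \<in> sets borel" by simp
    have mf: "(\<lambda>y. ?k w x y * indicator (\<Omega> \<inter> ball x \<epsilon>) y) \<in> borel_measurable borel" by measurable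
    have "(\<integral>\<^sup>+y\<in>\<Omega> \<inter> ball x \<epsilon>. ?k w x y \<partial>lborel)
       = ennreal (\<epsilon> ^ ?N) * (\<integral>\<^sup>+z. ?k w x (x + \<epsilon> *\<^sub>R z) * indicator (\<Omega> \<inter> ball x \<epsilon>) (x + \<epsilon> *\<^sub>R z) \<partial>lborel)"
      by (subst nn_integral_lborel_affine[OF mf \<epsilon>, of x]) simp
    also have "\<dots> = (\<integral>\<^sup>+z. ennreal (\<epsilon> ^ ?N) * (?k w x (x + \<epsilon> *\<^sub>R z) * indicator (\<Omega> \<inter> ball x \<epsilon>) (x + \<epsilon> *\<^sub>R z)) \<partial>lborel)"
      by (rule nn_integral_cmult[symmetric]) measurable
    also have "\<dots> = (\<integral>\<^sup>+z. ennreal (1 / (\<epsilon> * norm z)) * (indicator \<Omega> (x + \<epsilon> *\<^sub>R z) *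
       ennreal (norm (w x - w (x + \<epsilon> *\<^sub>R z)) powr q)) * indicator (ball 0 1) z \<partial>lborel)"
    proof (rule nn_integral_cong)
      fix z :: "real^'n"
      have "indicator (\<Omega> \<inter> ball x \<epsilon>) (x + \<epsilon> *\<^sub>R z) = (indicator \<Omega> (x + \<epsilon> *\<^sub>R z) * indicator (ball 0 1) z :: ennreal)"
      proof -
        have "x + \<epsilon> *\<^sub>R z \<in> ball x \<epsilon> \<longleftrightarrow> z \<in> ball 0 1" using \<epsilon> by (simp add: dist_norm)
        then show ?thesis unfolding indicator_def by (simp only: Int_iff mult_1 split: if_splits) simp
      qed
      \<comment> \<open>At \<open>z = 0\<close> both sides vanish because division by 0 gives
        0.\<close>
      moreover have "ennreal (\<epsilon> ^ ?N) * ?k w x (x + \<epsilon> *\<^sub>R z) = ennreal (1 / (\<epsilon> * norm z)) * ennreal (norm (w x - w (x + \<epsilon> *\<^sub>R z)) powr q)"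
        using \<epsilon> by (simp add: ennreal_mult'[symmetric])
      ultimately show "ennreal (\<epsilon> ^ ?N) * (?k w x (x + \<epsilon> *\<^sub>R z) * indicator (\<Omega> \<inter> ball x \<epsilon>) (x + \<epsilon> *\<^sub>R z))
        = ennreal (1 / (\<epsilon> * norm z)) * (indicator \<Omega> (x + \<epsilon> *\<^sub>R z) *
            ennreal (norm (w x - w (x + \<epsilon> *\<^sub>R z)) powr q)) * indicator (ball 0 1) z"
        by (simp only: mult.assoc[symmetric]) (simp only: mult_ac)
    qed
    finally show "(\<integral>\<^sup>+y\<in>\<Omega> \<inter> ball x \<epsilon>. ?k w x y \<partial>lborel) * indicator \<Omega> x
      = (\<integral>\<^sup>+z. ennreal (1 / (\<epsilon> * norm z)) * (indicator \<Omega> (x + \<epsilon> *\<^sub>R z) *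
       ennreal (norm (w x - w (x + \<epsilon> *\<^sub>R z)) powr q) * indicator \<Omega> x) * indicator (ball 0 1) z \<partial>lborel)"
      by (cases "x \<in> \<Omega>") simp_all
  qed
  also have "\<dots> = (\<integral>\<^sup>+z. (\<integral>\<^sup>+x. ennreal (1 / (\<epsilon> * norm z)) * (indicator \<Omega> (x + \<epsilon> *\<^sub>R z) *
       ennreal (norm (w x - w (x + \<epsilon> *\<^sub>R z)) powr q) * indicator \<Omega> x) * indicator (ball 0 1) z \<partial>lborel) \<partial>lborel)"
    by (rule lborel_pair.Fubini') measurable
  also have "\<dots> = local_energy q w \<Omega> \<epsilon>"
    unfolding local_energy_def slice_energy_def
    by (intro nn_integral_cong) (simp add: nn_integral_cmult nn_integral_multc)
  finally show ?thesis .
qed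

text \<open>The column below a point is the column above it, shifted down by its height; this is the
  source of equal volumes under the change of \<open>\<nu>\<close> to
  \<open>- \<nu>\<close>.\<close>

lemma prism_minus: "prism (- \<nu>) s C = (+) (- (s *\<^sub>R \<nu>)) ` prism \<nu> s C"
proof (intro equalityI subsetI)
  fix y assume "y \<in> prism (- \<nu>) s C"
  then obtain c t where c: "c \<in> C" "0 \<le> t" "t \<le> s" "y = c + t *\<^sub>R (- \<nu>)" by (auto simp: mem_prism)
  then have "c + (s - t) *\<^sub>R \<nu> \<in> prism \<nu> s C"
    unfolding mem_prism by (intro bexI[of _ c] exI[of _ "s - t"]) auto
  then have "- (s *\<^sub>R \<nu>) + (c + (s - t) *\<^sub>R \<nu>) \<in> (+) (- (s *\<^sub>R \<nu>)) ` prism \<nu> s C" by (rule imageI)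
  then show "y \<in> (+) (- (s *\<^sub>R \<nu>)) ` prism \<nu> s C" using c(4) by (simp add: scaleR_diff_left)
next
  fix y assume "y \<in> (+) (- (s *\<^sub>R \<nu>)) ` prism \<nu> s C"
  then obtain c t where c: "c \<in> C" "0 \<le> t" "t \<le> s" "y = - (s *\<^sub>R \<nu>) + (c + t *\<^sub>R \<nu>)" by (auto simp: mem_prism)
  then show "y \<in> prism (- \<nu>) s C"
    unfolding mem_prism by (intro bexI[of _ c] exI[of _ "s - t"]) (auto simp: scaleR_diff_left)
qed

lemma emeasure_prism_minus:
  fixes C :: "'a::euclidean_space set"
  shows "compact C \<Longrightarrow> emeasure lborel (prism (- \<nu>) s C) = emeasure lborel (prism \<nu> s C)"
  unfolding prism_minus by (intro emeasure_lborel_translation prism_borel)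

lemma thicken_translation:
  fixes E :: "'a::real_normed_vector set"
  shows "thicken ((+) a ` E) \<epsilon> = (+) a ` thicken E \<epsilon>"
  unfolding thicken_def image_UN ball_translation[symmetric] by simp

lemma emeasure_thicken_prism_minus:
  fixes C :: "'a::euclidean_space set"
  shows "emeasure lborel (thicken (prism (- \<nu>) s C) \<epsilon>) = emeasure lborel (thicken (prism \<nu> s C) \<epsilon>)"
  unfolding prism_minus thicken_translation by (intro emeasure_lborel_translation thicken_borel)

lemma flat_set_minus: "flat_set \<kappa> (- \<nu>) C \<longleftrightarrow> flat_set \<kappa> \<nu> C"
  by (simp add: flat_set_def)

text \<open>The volume of one exceptional layer, per unit of \<open>\<epsilon>\<close> and of volume
  of the thickened prism. It tends to 0 with \<open>\<kappa>\<close> and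
  \<open>\<eta>\<close>.\<close>

definition layer_const :: "nat \<Rightarrow> real \<Rightarrow> real \<Rightarrow> real" where
  "layer_const N \<kappa> \<eta> = 24 ^ N / unit_ball_vol (real N) * (\<eta> + unit_ball_vol (real (N - 1)) * \<kappa>)"

text \<open>One pair of traces, one normal and one scale serve all points of \<open>C\<close>.
  Within a family \<open>\<rho>0\<close> and \<open>\<tau>\<close> may vary from piece to piece,
  while \<open>\<kappa>\<close> and \<open>\<eta>\<close> are shared, so that the relative error is
  the same for all pieces.\<close>

locale jump_piece =
  fixes w :: "real^'n \<Rightarrow> real^'d" and C :: "(real^'n) set" and \<nu> :: "real^'n" and a b :: "real^'d"
    and \<kappa> \<eta> \<rho>0 \<tau> q :: real
  assumes w[measurable]: "w \<in> borel_measurable borel" and C: "compact C" and \<nu>: "norm \<nu> = 1"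
    and flat: "flat_set \<kappa> \<nu> C" and \<kappa>: "0 \<le> \<kappa>" "\<kappa> \<le> 1/2" and \<eta>: "0 \<le> \<eta>"
    and thin: "\<And>x. x \<in> C \<Longrightarrow> thin_at {y. \<tau> < norm (w y - a)} \<nu> \<eta> \<rho>0 x"
      "\<And>x. x \<in> C \<Longrightarrow> thin_at {y. \<tau> < norm (w y - b)} (- \<nu>) \<eta> \<rho>0 x"
    and \<tau>: "2 * \<tau> \<le> norm (a - b)" and q: "0 \<le> q"
begin

abbreviation "jump_size \<equiv> ennreal ((norm (a - b) - 2 * \<tau>) powr q)"

lemma layer_const_nonneg: "0 \<le> layer_const CARD('n) \<kappa> \<eta>"
  using \<eta> \<kappa> by (simp add: layer_const_def)

text \<open>Exchanging the traces while reversing the normal is the symmetry that reduces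
  displacements with \<open>z \<bullet> \<nu> < 0\<close> to the opposite sign.\<close>

lemma jump_piece_minus: "jump_piece w C (- \<nu>) b a \<kappa> \<eta> \<rho>0 \<tau> q"
proof
  show "thin_at {y. \<tau> < norm (w y - b)} (- \<nu>) \<eta> \<rho>0 x" "thin_at {y. \<tau> < norm (w y - a)} (- (- \<nu>)) \<eta> \<rho>0 x"
    if "x \<in> C" for x
    using thin[OF that] by simp_all
qed (use w C \<nu> flat \<kappa> \<eta> \<tau> q in \<open>simp_all add: flat_set_minus norm_minus_commute\<close>)

lemma slice_lower_bound_nonneg:
  assumes \<epsilon>: "0 < \<epsilon>" "6 * \<epsilon> < \<rho>0" and z: "norm z < 1" "0 \<le> z \<bullet> \<nu>"
  shows "jump_size * (ennreal (\<epsilon> * (z \<bullet> \<nu>) / (1 + \<epsilon>)) * emeasure lborel (prism \<nu> 1 C))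
    \<le> slice_energy q w (thicken C \<epsilon>) \<epsilon> z
     + jump_size * (ennreal (2 * \<epsilon> * layer_const CARD('n) \<kappa> \<eta>) * emeasure lborel (thicken (prism \<nu> 1 C) \<epsilon>))"
proof -
  let ?T = "emeasure lborel (thicken (prism \<nu> 1 C) \<epsilon>)"
  let ?h = "z \<bullet> \<nu>"
  have [measurable]: "{y. \<tau> < norm (w y - a)} \<in> sets borel" "{y. \<tau> < norm (w y - b)} \<in> sets borel" by measurable
  have A: "emeasure lborel ({y. \<tau> < norm (w y - a)} \<inter> upper_layer \<nu> \<epsilon> C) \<le> ennreal (\<epsilon> * layer_const CARD('n) \<kappa> \<eta>) * ?T"
    unfolding layer_const_def
    by (rule emeasure_thin_upper_layer_le[OF _ C \<nu> flat \<kappa> \<eta> thin(1) \<epsilon>]) measurable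
  have B: "emeasure lborel ({y. \<tau> < norm (w y - b)} \<inter> upper_layer (- \<nu>) \<epsilon> C) \<le> ennreal (\<epsilon> * layer_const CARD('n) \<kappa> \<eta>) * ?T"
    unfolding layer_const_def emeasure_thicken_prism_minus[of \<nu>, symmetric]
    by (rule emeasure_thin_upper_layer_le[OF _ C _ _ \<kappa> \<eta> thin(2) \<epsilon>]) (auto simp: \<nu> flat flat_set_minus)
  \<comment> \<open>The prism of height 1 costs at most \<open>1 / (\<epsilon> h) + 1\<close> prisms
    of height \<open>\<epsilon> h\<close>; after multiplication by
    \<open>\<epsilon> h / (1 + \<epsilon>)\<close> this is at most 1, because
    \<open>h \<le> 1\<close>. The denominator \<open>1 + \<epsilon>\<close> is the same for all
    \<open>z\<close> and so can leave the integral.\<close>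
  have M: "ennreal (\<epsilon> * ?h / (1 + \<epsilon>)) * emeasure lborel (prism \<nu> 1 C) \<le> emeasure lborel (prism (- \<nu>) (\<epsilon> * ?h) C)"
  proof (cases "?h = 0")
    case False
    then have h: "0 < ?h" using z by simp
    have h1: "?h \<le> 1" using Cauchy_Schwarz_ineq2[of z \<nu>] \<nu> z by simp
    have "ennreal (\<epsilon> * ?h / (1 + \<epsilon>)) * emeasure lborel (prism \<nu> 1 C)
       \<le> ennreal (\<epsilon> * ?h / (1 + \<epsilon>)) * (ennreal (1 / (\<epsilon> * ?h) + 1) * emeasure lborel (prism \<nu> (\<epsilon> * ?h) C))"
      using emeasure_prism_le[OF C, of "\<epsilon> * ?h" 1 \<nu>] h \<epsilon> by (intro mult_left_mono) auto
    also have "\<dots> = ennreal ((1 + \<epsilon> * ?h) / (1 + \<epsilon>)) * emeasure lborel (prism \<nu> (\<epsilon> * ?h) C)"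
    proof -
      have "\<epsilon> * ?h / (1 + \<epsilon>) * (1 / (\<epsilon> * ?h) + 1) = (1 + \<epsilon> * ?h) / (1 + \<epsilon>)"
      proof -
        have "k / (1 + \<epsilon>) * (1 / k + 1) = (1 + k) / (1 + \<epsilon>)" if "0 < k" for k
        proof -
          have "1 / k + 1 = (1 + k) / k" using that by (simp add: field_simps)
          then show ?thesis using that by simp
        qed
        then show ?thesis using h \<epsilon> by simp
      qed
      then have "ennreal (\<epsilon> * ?h / (1 + \<epsilon>)) * ennreal (1 / (\<epsilon> * ?h) + 1) = ennreal ((1 + \<epsilon> * ?h) / (1 + \<epsilon>))"
        using h \<epsilon> by (subst ennreal_mult'[symmetric]) auto
      then show ?thesis by (simp add: mult.assoc[symmetric])
    qed
    also have "\<dots> \<le> ennreal 1 * emeasure lborel (prism \<nu> (\<epsilon> * ?h) C)"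
    proof (intro mult_right_mono ennreal_leI)
      have "\<epsilon> * ?h \<le> \<epsilon> * 1" using h1 \<epsilon> by (intro mult_left_mono) auto
      then show "(1 + \<epsilon> * ?h) / (1 + \<epsilon>) \<le> 1" using \<epsilon> by simp
    qed simp
    finally show ?thesis by (simp add: emeasure_prism_minus[OF C])
  qed simp
  have "jump_size * (ennreal (\<epsilon> * ?h / (1 + \<epsilon>)) * emeasure lborel (prism \<nu> 1 C))
     \<le> jump_size * emeasure lborel (prism (- \<nu>) (\<epsilon> * ?h) C)"
    using M by (rule mult_left_mono) simp
  also have "\<dots> \<le> slice_energy q w (thicken C \<epsilon>) \<epsilon> z
     + jump_size * (emeasure lborel ({y. \<tau> < norm (w y - b)} \<inter> upper_layer (- \<nu>) \<epsilon> C)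
          + emeasure lborel ({y. \<tau> < norm (w y - a)} \<inter> upper_layer \<nu> \<epsilon> C))"
    by (rule crossing_slice_lower_bound[OF w C \<nu> \<epsilon>(1) z \<tau> q])
  also have "\<dots> \<le> slice_energy q w (thicken C \<epsilon>) \<epsilon> z
     + jump_size * (ennreal (\<epsilon> * layer_const CARD('n) \<kappa> \<eta>) * ?T + ennreal (\<epsilon> * layer_const CARD('n) \<kappa> \<eta>) * ?T)"
    by (intro add_left_mono mult_left_mono add_mono A B) simp
  also have "ennreal (\<epsilon> * layer_const CARD('n) \<kappa> \<eta>) * ?T + ennreal (\<epsilon> * layer_const CARD('n) \<kappa> \<eta>) * ?T = ennreal (2 * \<epsilon> * layer_const CARD('n) \<kappa> \<eta>) * ?T"
  proof -
    have "2 * \<epsilon> * layer_const CARD('n) \<kappa> \<eta> = \<epsilon> * layer_const CARD('n) \<kappa> \<eta> + \<epsilon> * layer_const CARD('n) \<kappa> \<eta>" by simp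
    then have "ennreal (2 * \<epsilon> * layer_const CARD('n) \<kappa> \<eta>) = ennreal (\<epsilon> * layer_const CARD('n) \<kappa> \<eta>) + ennreal (\<epsilon> * layer_const CARD('n) \<kappa> \<eta>)"
      using \<epsilon> layer_const_nonneg by (simp only: ennreal_plus mult_nonneg_nonneg less_imp_le)
    then show ?thesis by (simp only: distrib_right)
  qed
  finally show ?thesis .
qed

lemma slice_lower_bound:
  assumes \<epsilon>: "0 < \<epsilon>" "6 * \<epsilon> < \<rho>0" and z: "norm z < 1"
  shows "jump_size * (ennreal (\<epsilon> * \<bar>z \<bullet> \<nu>\<bar> / (1 + \<epsilon>)) * emeasure lborel (prism \<nu> 1 C))
    \<le> slice_energy q w (thicken C \<epsilon>) \<epsilon> z
     + jump_size * (ennreal (2 * \<epsilon> * layer_const CARD('n) \<kappa> \<eta>) * emeasure lborel (thicken (prism \<nu> 1 C) \<epsilon>))"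
proof (cases "0 \<le> z \<bullet> \<nu>")
  case True
  then show ?thesis using slice_lower_bound_nonneg[OF \<epsilon> z True] by simp
next
  case False
  interpret minus: jump_piece w C "- \<nu>" b a \<kappa> \<eta> \<rho>0 \<tau> q by (rule jump_piece_minus)
  have "0 \<le> z \<bullet> (- \<nu>)" using False by simp
  from minus.slice_lower_bound_nonneg[OF \<epsilon> z this] False show ?thesis
    by (simp add: emeasure_thicken_prism_minus emeasure_prism_minus[OF C] 
        norm_minus_commute[of b a])
qed

text \<open>The weight \<open>1 / (\<epsilon> |z|)\<close> cancels the \<open>\<epsilon>\<close> in
  the error of a slice but leaves \<open>1 / |z|\<close>, which is at most
  \<open>1 / \<theta>\<close> for \<open>|z| \<ge> \<theta>\<close>. For smaller \<open>z\<close>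
  the slice estimate is dropped: the integrand on the left never exceeds \<open>jump_size\<close>
  times the volume of the prism, and that bound is added on the right over the ball of radius
  \<open>\<theta>\<close>.\<close>

lemma local_energy_lower_bound:
  assumes \<epsilon>: "0 < \<epsilon>" "6 * \<epsilon> < \<rho>0" and \<theta>: "0 < \<theta>" "\<theta> < 1"
  defines "\<omega> \<equiv> unit_ball_vol (real CARD('n))"
  shows "jump_size * emeasure lborel (prism \<nu> 1 C) * ennreal (1 / (1 + \<epsilon>)) * crossing_const \<nu>
    \<le> local_energy q w (thicken C \<epsilon>) \<epsilon>
     + jump_size * emeasure lborel (thicken (prism \<nu> 1 C) \<epsilon>) * ennreal (2 * layer_const CARD('n) \<kappa> \<eta> * \<omega> / \<theta>)
     + jump_size * emeasure lborel (prism \<nu> 1 C) * ennreal (\<omega> * \<theta> ^ CARD('n))"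
proof -
  let ?M = "emeasure lborel (prism \<nu> 1 C)" and ?T = "emeasure lborel (thicken (prism \<nu> 1 C) \<epsilon>)"
  define J where "J = slice_energy q w (thicken C \<epsilon>) \<epsilon>"
  have J[measurable]: "J \<in> borel_measurable borel" unfolding J_def by (rule measurable_slice_energy) auto
  have slice_J: "jump_size * (ennreal (\<epsilon> * \<bar>z \<bullet> \<nu>\<bar> / (1 + \<epsilon>)) * ?M)
    \<le> J z + jump_size * (ennreal (2 * \<epsilon> * layer_const CARD('n) \<kappa> \<eta>) * ?T)" if "norm z < 1" for z
    unfolding J_def by (rule slice_lower_bound[OF \<epsilon> that])
  have [measurable]: "(ball 0 r :: (real^'n) set) \<in> sets borel" for r by simp
  have pt: "jump_size * ?M * ennreal (1 / (1 + \<epsilon>)) * (ennreal (\<bar>z \<bullet> \<nu>\<bar> / norm z) * indicator (ball 0 1) z)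
    \<le> ennreal (1 / (\<epsilon> * norm z)) * J z * indicator (ball 0 1) z
      + jump_size * ?T * ennreal (2 * layer_const CARD('n) \<kappa> \<eta> / \<theta>) * indicator (ball 0 1) z + jump_size * ?M * indicator (ball 0 \<theta>) z" for z
  proof (cases "norm z < 1")
    case z: True
    show ?thesis
    proof (cases "norm z < \<theta>")
      case True
      have "\<bar>z \<bullet> \<nu>\<bar> / norm z \<le> 1"
        using Cauchy_Schwarz_ineq2[of z \<nu>] \<nu> by (cases "z = 0") (auto simp: field_simps)
      then have "ennreal (1 / (1 + \<epsilon>)) * (ennreal (\<bar>z \<bullet> \<nu>\<bar> / norm z) * indicator (ball 0 1) z) \<le> 1 * (1 * 1)"
        using \<epsilon> by (intro mult_mono) (auto simp: ennreal_le_1 indicator_def)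
      then have "jump_size * ?M * (ennreal (1 / (1 + \<epsilon>)) * (ennreal (\<bar>z \<bullet> \<nu>\<bar> / norm z) * indicator (ball 0 1) z)) \<le> jump_size * ?M * 1"
        by (intro mult_left_mono) auto
      also have "\<dots> \<le> ennreal (1 / (\<epsilon> * norm z)) * J z * indicator (ball 0 1) z
        + jump_size * ?T * ennreal (2 * layer_const CARD('n) \<kappa> \<eta> / \<theta>) * indicator (ball 0 1) z + jump_size * ?M * indicator (ball 0 \<theta>) z"
        using True by (simp add: add_increasing)
      finally show ?thesis by (simp only: mult.assoc)
    next
      case False
      then have nz: "\<theta> \<le> norm z" "0 < norm z" using \<theta> by auto
      have "jump_size * ?M * ennreal (1 / (1 + \<epsilon>)) * ennreal (\<bar>z \<bullet> \<nu>\<bar> / norm z)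
        = ennreal (1 / (\<epsilon> * norm z)) * (jump_size * (ennreal (\<epsilon> * \<bar>z \<bullet> \<nu>\<bar> / (1 + \<epsilon>)) * ?M))"
      proof -
        have "1 / (1 + \<epsilon>) * (\<bar>z \<bullet> \<nu>\<bar> / norm z) = 1 / (\<epsilon> * norm z) * (\<epsilon> * \<bar>z \<bullet> \<nu>\<bar> / (1 + \<epsilon>))"
          using \<epsilon> nz by (simp add: field_simps)
        then have "ennreal (1 / (1 + \<epsilon>)) * ennreal (\<bar>z \<bullet> \<nu>\<bar> / norm z) = ennreal (1 / (\<epsilon> * norm z)) * ennreal (\<epsilon> * \<bar>z \<bullet> \<nu>\<bar> / (1 + \<epsilon>))"
          using \<epsilon> nz by (simp add: ennreal_mult'[symmetric])
        then have "jump_size * ?M * (ennreal (1 / (1 + \<epsilon>)) * ennreal (\<bar>z \<bullet> \<nu>\<bar> / norm z))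
          = jump_size * ?M * (ennreal (1 / (\<epsilon> * norm z)) * ennreal (\<epsilon> * \<bar>z \<bullet> \<nu>\<bar> / (1 + \<epsilon>)))" by (simp only:)
        then show ?thesis by (simp only: mult_ac)
      qed
      also have "\<dots> \<le> ennreal (1 / (\<epsilon> * norm z)) * (J z + jump_size * (ennreal (2 * \<epsilon> * layer_const CARD('n) \<kappa> \<eta>) * ?T))"
        using slice_J[OF z] by (rule mult_left_mono) simp
      also have "\<dots> = ennreal (1 / (\<epsilon> * norm z)) * J z + jump_size * ?T * (ennreal (1 / (\<epsilon> * norm z)) * ennreal (2 * \<epsilon> * layer_const CARD('n) \<kappa> \<eta>))"
        by (simp only: distrib_left mult_ac)
      also have "ennreal (1 / (\<epsilon> * norm z)) * ennreal (2 * \<epsilon> * layer_const CARD('n) \<kappa> \<eta>) = ennreal (2 * layer_const CARD('n) \<kappa> \<eta> / norm z)"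
        using \<epsilon> nz by (simp add: ennreal_mult'[symmetric])
      also have "ennreal (2 * layer_const CARD('n) \<kappa> \<eta> / norm z) \<le> ennreal (2 * layer_const CARD('n) \<kappa> \<eta> / \<theta>)"
        using nz \<theta> layer_const_nonneg by (intro ennreal_leI divide_left_mono) auto
      finally show ?thesis using z False
        by (simp add: add_left_mono mult_left_mono)
    qed
  qed simp
  have "jump_size * ?M * ennreal (1 / (1 + \<epsilon>)) * crossing_const \<nu>
     = (\<integral>\<^sup>+(z::real^'n). jump_size * ?M * ennreal (1 / (1 + \<epsilon>)) * (ennreal (\<bar>z \<bullet> \<nu>\<bar> / norm z) * indicator (ball 0 1) z) \<partial>lborel)"
    unfolding crossing_const_def by (rule nn_integral_cmult[symmetric]) measurable
  also have "\<dots> \<le> (\<integral>\<^sup>+z. ennreal (1 / (\<epsilon> * norm z)) * J z * indicator (ball 0 1) z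
      + jump_size * ?T * ennreal (2 * layer_const CARD('n) \<kappa> \<eta> / \<theta>) * indicator (ball 0 1) z + jump_size * ?M * indicator (ball 0 \<theta>) z \<partial>lborel)"
    by (rule nn_integral_mono) (rule pt)
  also have "\<dots> = (\<integral>\<^sup>+z. ennreal (1 / (\<epsilon> * norm z)) * J z * indicator (ball 0 1) z
      + jump_size * ?T * ennreal (2 * layer_const CARD('n) \<kappa> \<eta> / \<theta>) * indicator (ball 0 1) z \<partial>lborel)
      + (\<integral>\<^sup>+(z::real^'n). jump_size * ?M * indicator (ball 0 \<theta>) z \<partial>lborel)"
    by (rule nn_integral_add) measurable
  also have "(\<integral>\<^sup>+z. ennreal (1 / (\<epsilon> * norm z)) * J z * indicator (ball 0 1) z
      + jump_size * ?T * ennreal (2 * layer_const CARD('n) \<kappa> \<eta> / \<theta>) * indicator (ball 0 1) z \<partial>lborel)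
    = (\<integral>\<^sup>+z. ennreal (1 / (\<epsilon> * norm z)) * J z * indicator (ball 0 1) z \<partial>lborel)
      + (\<integral>\<^sup>+(z::real^'n). jump_size * ?T * ennreal (2 * layer_const CARD('n) \<kappa> \<eta> / \<theta>) * indicator (ball 0 1) z \<partial>lborel)"
    by (rule nn_integral_add) measurable
  also have "(\<integral>\<^sup>+z. ennreal (1 / (\<epsilon> * norm z)) * J z * indicator (ball 0 1) z \<partial>lborel) = local_energy q w (thicken C \<epsilon>) \<epsilon>"
    by (simp add: local_energy_def J_def)
  also have "(\<integral>\<^sup>+(z::real^'n). jump_size * ?T * ennreal (2 * layer_const CARD('n) \<kappa> \<eta> / \<theta>) * indicator (ball 0 1) z \<partial>lborel)
     = jump_size * ?T * ennreal (2 * layer_const CARD('n) \<kappa> \<eta> * \<omega> / \<theta>)"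
  proof -
    have "(\<integral>\<^sup>+(z::real^'n). jump_size * ?T * ennreal (2 * layer_const CARD('n) \<kappa> \<eta> / \<theta>) * indicator (ball 0 1) z \<partial>lborel)
      = jump_size * ?T * ennreal (2 * layer_const CARD('n) \<kappa> \<eta> / \<theta>) * ennreal \<omega>"
      by (subst nn_integral_cmult_indicator) (auto simp: emeasure_ball \<omega>_def)
    also have "\<dots> = jump_size * ?T * ennreal (2 * layer_const CARD('n) \<kappa> \<eta> * \<omega> / \<theta>)"
      using \<theta> layer_const_nonneg by (simp add: mult.assoc ennreal_mult'[symmetric] \<omega>_def)
    finally show ?thesis .
  qed
  also have "(\<integral>\<^sup>+(z::real^'n). jump_size * ?M * indicator (ball 0 \<theta>) z \<partial>lborel) = jump_size * ?M * ennreal (\<omega> * \<theta> ^ CARD('n))"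
    using \<theta> by (subst nn_integral_cmult_indicator) (auto simp: emeasure_ball \<omega>_def)
  finally show ?thesis .
qed

end

subsection \<open>Energy of finitely many pieces\<close>

lemma eventually_thicken_disjoint:
  fixes A B :: "'a::heine_borel set"
  assumes "compact A" "compact B" "A \<inter> B = {}"
  shows "\<forall>\<^sub>F \<epsilon> in at_right 0. thicken A \<epsilon> \<inter> thicken B \<epsilon> = {}"
proof -
  obtain d where d: "d > 0" "\<And>x y. x \<in> A \<Longrightarrow> y \<in> B \<Longrightarrow> d \<le> dist x y"
    using separate_compact_closed[OF assms(1) compact_imp_closed[OF assms(2)] assms(3)] by auto
  have "thicken A \<epsilon> \<inter> thicken B \<epsilon> = {}" if "\<epsilon> < d / 2" for \<epsilon>
  proof (rule ccontr)
    assume "thicken A \<epsilon> \<inter> thicken B \<epsilon> \<noteq> {}"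
    then obtain x y z where "x \<in> A" "y \<in> B" "dist x z < \<epsilon>" "dist y z < \<epsilon>" by (auto simp: thicken_def)
    then show False using d(2)[of x y] dist_triangle2[of x y z] that by simp
  qed
  then show ?thesis unfolding eventually_at_right_field using d(1) by (intro exI[of _ "d / 2"]) auto
qed

lemma jump_piece_subset:
  assumes "jump_piece w G \<nu> a b \<kappa> \<eta> \<rho>0 \<tau> q" "compact C" "C \<subseteq> G"
  shows "jump_piece w C \<nu> a b \<kappa> \<eta> \<rho>0 \<tau> q"
proof -
  interpret jump_piece w G \<nu> a b \<kappa> \<eta> \<rho>0 \<tau> q by fact
  have "flat_set \<kappa> \<nu> C" using flat \<open>C \<subseteq> G\<close> unfolding flat_set_def by blast
  then show ?thesis
    by unfold_locales (use w \<nu> \<kappa> \<eta> thin \<tau> q assms(2,3) in auto)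
qed

text \<open>Disjoint compact sets have disjoint neighbourhoods inside \<open>\<Omega>\<close> once
  \<open>\<epsilon>\<close> is small, so the energies of the pieces add up to at most the full
  energy. Errors that vanish with \<open>\<epsilon>\<close> are absorbed by an auxiliary
  \<open>\<delta>\<close>; those governed by \<open>K\<close> and \<open>\<theta>\<close> stay in
  the factor next to \<open>X\<close>.\<close>

lemma Liminf_energy_finite_family:
  fixes w :: "real^'n \<Rightarrow> real^'d" and C :: "'i \<Rightarrow> (real^'n) set"
  assumes fin: "finite I" and \<Omega>: "open \<Omega>"
    and C: "\<And>i. i \<in> I \<Longrightarrow> jump_piece w (C i) (\<nu> i) (a i) (b i) \<kappa> \<eta> (\<rho> i) (\<tau> i) q"
    and \<rho>: "\<And>i. i \<in> I \<Longrightarrow> 0 < \<rho> i" and sub: "\<And>i. i \<in> I \<Longrightarrow> C i \<subseteq> \<Omega>"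
    and disj: "disjoint_family_on C I" and w: "w \<in> borel_measurable borel"
    and d: "\<And>\<nu> :: real^'n. norm \<nu> = 1 \<Longrightarrow> crossing_const \<nu> = ennreal d" "0 \<le> d"
    and \<theta>: "0 < \<theta>" "\<theta> < 1"
    and K: "0 \<le> K" "layer_const CARD('n) \<kappa> \<eta> = K"
  defines "X \<equiv> \<Sum>i\<in>I. (norm (a i - b i) - 2 * \<tau> i) powr q * measure lborel (prism (\<nu> i) 1 (C i))"
    and "\<omega> \<equiv> unit_ball_vol (real CARD('n))"
  shows "ennreal (X * (d - (2 * K * \<omega> / \<theta> + \<omega> * \<theta> ^ CARD('n)))) \<le> Liminf (at_right 0) (local_energy q w \<Omega>)"
proof -
  define v where "v i = (norm (a i - b i) - 2 * \<tau> i) powr q" for i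
  define m where "m i = measure lborel (prism (\<nu> i) 1 (C i))" for i
  define c1 where "c1 = 2 * K * \<omega> / \<theta>"
  define c2 where "c2 = \<omega> * \<theta> ^ CARD('n)"
  define V where "V = (\<Sum>i\<in>I. v i)"
  let ?E = "local_energy q w \<Omega>"
  have comp: "compact (C i)" if "i \<in> I" for i using C[OF that] by (rule jump_piece.C)
  have X: "X = (\<Sum>i\<in>I. v i * m i)" by (simp add: X_def v_def m_def)
  have v0: "0 \<le> v i" and m0: "0 \<le> m i" for i by (auto simp: v_def m_def)
  have c0: "0 \<le> c1" "0 \<le> c2" using K \<theta> by (auto simp: c1_def c2_def \<omega>_def)
  have M: "emeasure lborel (prism (\<nu> i) 1 (C i)) = ennreal (m i)" if "i \<in> I" for i
    using emeasure_compact_finite[OF compact_prism[OF comp[OF that], of "\<nu> i" 1]]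
    unfolding m_def by (intro emeasure_eq_ennreal_measure) auto
  \<comment> \<open>\<open>\<delta>\<close> bounds both the excess volume of the thickened prisms
    and, through \<open>1 / (1 + \<epsilon>) \<ge> 1 - \<delta>\<close>, the loss from the
    discretised height.\<close>
  have ev: "\<forall>\<^sub>F \<epsilon> in at_right 0. ennreal (X * (d - (c1 + c2)) - \<delta> * (X * d + V * c1)) \<le> ?E \<epsilon>" if \<delta>: "0 < \<delta>" for \<delta>
  proof -
    have "\<forall>\<^sub>F \<epsilon> in at_right 0. \<forall>i\<in>I. emeasure lborel (thicken (prism (\<nu> i) 1 (C i)) \<epsilon>) \<le> ennreal (m i + \<delta>)"
    proof (intro eventually_ball_finite fin ballI)
      fix i assume i: "i \<in> I"
      show "\<forall>\<^sub>F \<epsilon> in at_right 0. emeasure lborel (thicken (prism (\<nu> i) 1 (C i)) \<epsilon>) \<le> ennreal (m i + \<delta>)"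
        using eventually_emeasure_thicken_le[OF compact_prism[OF comp[OF i], of "\<nu> i" 1] \<delta>] m0[of i] \<delta>
        by (simp add: M[OF i])
    qed
    moreover have "\<forall>\<^sub>F \<epsilon> in at_right 0. \<forall>i\<in>I. 6 * \<epsilon> < \<rho> i"
    proof (intro eventually_ball_finite fin ballI)
      fix i assume i: "i \<in> I"
      show "\<forall>\<^sub>F \<epsilon> in at_right 0. 6 * \<epsilon> < \<rho> i"
        unfolding eventually_at_right_field using \<rho>[OF i] by (intro exI[of _ "\<rho> i / 6"]) auto
    qed
    moreover have "\<forall>\<^sub>F \<epsilon> in at_right 0. \<forall>i\<in>I. thicken (C i) \<epsilon> \<subseteq> \<Omega>"
      by (intro eventually_ball_finite fin ballI eventually_thicken_subset comp \<Omega> sub)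
    moreover have "\<forall>\<^sub>F \<epsilon> in at_right 0. \<forall>i\<in>I. \<forall>j\<in>I. i \<noteq> j \<longrightarrow> thicken (C i) \<epsilon> \<inter> thicken (C j) \<epsilon> = {}"
    proof (intro eventually_ball_finite fin ballI)
      fix i j assume i: "i \<in> I" "j \<in> I"
      show "\<forall>\<^sub>F \<epsilon> in at_right 0. i \<noteq> j \<longrightarrow> thicken (C i) \<epsilon> \<inter> thicken (C j) \<epsilon> = {}"
      proof (cases "i = j")
        case False
        then have "C i \<inter> C j = {}" using disj i by (auto simp: disjoint_family_on_def)
        from eventually_thicken_disjoint[OF comp comp this] i show ?thesis by (auto elim: eventually_mono)
      qed simp
    qed
    moreover have "\<forall>\<^sub>F \<epsilon> in at_right 0. 0 < \<epsilon> \<and> \<epsilon> < \<delta>"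
      unfolding eventually_at_right_field using \<delta> by (intro exI[of _ \<delta>]) auto
    ultimately show ?thesis
    proof eventually_elim
      case (elim \<epsilon>)
      then have \<epsilon>: "0 < \<epsilon>" "\<epsilon> < \<delta>" by auto
      have each: "ennreal (v i * m i * (1 / (1 + \<epsilon>)) * d)
         \<le> local_energy q w (thicken (C i) \<epsilon>) \<epsilon> + ennreal (v i * (m i + \<delta>) * c1 + v i * m i * c2)" if i: "i \<in> I" for i
      proof -
        interpret jump_piece w "C i" "\<nu> i" "a i" "b i" \<kappa> \<eta> "\<rho> i" "\<tau> i" q by (rule C[OF i])
        have *: "ennreal (v i) * ennreal (m i) * ennreal (1 / (1 + \<epsilon>)) * ennreal d
          \<le> local_energy q w (thicken (C i) \<epsilon>) \<epsilon>
             + ennreal (v i) * emeasure lborel (thicken (prism (\<nu> i) 1 (C i)) \<epsilon>) * ennreal c1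
             + ennreal (v i) * ennreal (m i) * ennreal c2"
          using local_energy_lower_bound[of \<epsilon> \<theta>] \<epsilon> elim i \<theta>
          unfolding M[OF i] d(1)[OF \<nu>] K(2) v_def[symmetric] c1_def c2_def \<omega>_def by blast
        also have "\<dots> \<le> local_energy q w (thicken (C i) \<epsilon>) \<epsilon>
             + ennreal (v i) * ennreal (m i + \<delta>) * ennreal c1
             + ennreal (v i) * ennreal (m i) * ennreal c2"
          using elim i by (intro add_mono mult_mono order_refl) auto
        also have "\<dots> = local_energy q w (thicken (C i) \<epsilon>) \<epsilon> + ennreal (v i * (m i + \<delta>) * c1 + v i * m i * c2)"
        proof -
          have "ennreal (v i * (m i + \<delta>) * c1 + v i * m i * c2) = ennreal (v i * (m i + \<delta>) * c1) + ennreal (v i * m i * c2)"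
            using v0[of i] m0[of i] c0 \<delta> by (intro ennreal_plus) auto
          also have "\<dots> = ennreal (v i) * ennreal (m i + \<delta>) * ennreal c1 + ennreal (v i) * ennreal (m i) * ennreal c2"
            using v0[of i] m0[of i] c0 \<delta> by (simp add: ennreal_mult del: ennreal_plus)
          finally show ?thesis by (simp add: add.assoc)
        qed
        finally have "ennreal (v i) * ennreal (m i) * ennreal (1 / (1 + \<epsilon>)) * ennreal d
          \<le> local_energy q w (thicken (C i) \<epsilon>) \<epsilon> + ennreal (v i * (m i + \<delta>) * c1 + v i * m i * c2)" .
        moreover have "ennreal (v i * m i * r * d) = ennreal (v i) * ennreal (m i) * ennreal r * ennreal d" if "0 \<le> r" for r
          using that v0[of i] m0[of i] d(2) by (simp add: ennreal_mult)
        ultimately show ?thesis using \<epsilon> by (metis divide_nonneg_pos zero_le_one add_pos_pos zero_less_one)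
      qed
      have nn: "0 \<le> v i * m i * (1 / (1 + \<epsilon>)) * d" "0 \<le> v i * (m i + \<delta>) * c1 + v i * m i * c2" for i
        using v0[of i] m0[of i] d \<epsilon> c0 \<delta> by auto
      have "(\<Sum>i\<in>I. ennreal (v i * m i * (1 / (1 + \<epsilon>)) * d))
         \<le> (\<Sum>i\<in>I. local_energy q w (thicken (C i) \<epsilon>) \<epsilon>) + (\<Sum>i\<in>I. ennreal (v i * (m i + \<delta>) * c1 + v i * m i * c2))"
        unfolding sum.distrib[symmetric] by (intro sum_mono each)
      also have "(\<Sum>i\<in>I. local_energy q w (thicken (C i) \<epsilon>) \<epsilon>) \<le> ?E \<epsilon>"
        using elim by (intro local_energy_sum_le w fin) (auto simp: disjoint_family_on_def)
      finally have le: "ennreal (\<Sum>i\<in>I. v i * m i * (1 / (1 + \<epsilon>)) * d) \<le> ?E \<epsilon> + ennreal (\<Sum>i\<in>I. v i * (m i + \<delta>) * c1 + v i * m i * c2)"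
        using nn by (simp add: sum_ennreal add_right_mono)
      have s1: "(\<Sum>i\<in>I. v i * m i * (1 / (1 + \<epsilon>)) * d) = X * d / (1 + \<epsilon>)"
        by (simp add: X sum_distrib_right sum_divide_distrib)
      have s2: "(\<Sum>i\<in>I. v i * (m i + \<delta>) * c1 + v i * m i * c2) = (X + \<delta> * V) * c1 + X * c2"
        by (simp add: X V_def sum.distrib sum_distrib_left sum_distrib_right algebra_simps)
      have Xd: "0 \<le> X * d" unfolding X using v0 m0 d by (intro mult_nonneg_nonneg sum_nonneg) auto
      have XV: "0 \<le> X" "0 \<le> V" unfolding X V_def using v0 m0 by (auto intro!: sum_nonneg)
      have "(1 - \<delta>) * (X * d) \<le> X * d / (1 + \<epsilon>)"
      proof -
        have "(1 - \<delta>) * (1 + \<epsilon>) \<le> (1 - \<epsilon>) * (1 + \<epsilon>)" using \<epsilon> by (intro mult_right_mono) auto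
        also have "\<dots> \<le> 1" by (simp add: algebra_simps)
        finally have "1 - \<delta> \<le> 1 / (1 + \<epsilon>)" using \<epsilon> by (simp add: pos_le_divide_eq)
        then have "(1 - \<delta>) * (X * d) \<le> 1 / (1 + \<epsilon>) * (X * d)" using Xd by (rule mult_right_mono)
        then show ?thesis by simp
      qed
      then have "X * (d - (c1 + c2)) - \<delta> * (X * d + V * c1) \<le> X * d / (1 + \<epsilon>) - ((X + \<delta> * V) * c1 + X * c2)"
        by (simp add: algebra_simps)
      then have "ennreal (X * (d - (c1 + c2)) - \<delta> * (X * d + V * c1)) \<le> ennreal (X * d / (1 + \<epsilon>) - ((X + \<delta> * V) * c1 + X * c2))"
        by (rule ennreal_leI)
      also have "\<dots> = ennreal (X * d / (1 + \<epsilon>)) - ennreal ((X + \<delta> * V) * c1 + X * c2)"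
        using XV c0 \<delta> by (intro ennreal_minus[symmetric]) (auto intro!: add_nonneg_nonneg mult_nonneg_nonneg)
      also have "\<dots> \<le> ?E \<epsilon>"
        using le unfolding s1 s2 by (simp add: ennreal_minus_le_iff add.commute)
      finally show ?case .
    qed
  qed
  have lim: "ennreal (X * (d - (c1 + c2)) - \<delta> * (X * d + V * c1)) \<le> Liminf (at_right 0) ?E" if "0 < \<delta>" for \<delta>
    using ev[OF that] by (intro Liminf_bounded) auto
  define Z where "Z = X * d + V * c1"
  have Z: "0 \<le> Z" unfolding Z_def X V_def using v0 m0 d c0
    by (intro add_nonneg_nonneg mult_nonneg_nonneg sum_nonneg) auto
  have "ennreal (X * (d - (c1 + c2))) \<le> Liminf (at_right 0) ?E"
  proof (rule ennreal_le_epsilon)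
    fix e :: real assume e: "0 < e"
    define \<delta> where "\<delta> = e / (Z + 1)"
    have \<delta>: "0 < \<delta>" "\<delta> * Z \<le> e" using e Z by (auto simp: \<delta>_def field_simps)
    \<comment> \<open>\<open>ennreal\<close> sends negative reals to 0, and it is additive on
      nonnegative reals; the maximum covers the case of a negative bound.\<close>
    have "ennreal (X * (d - (c1 + c2))) \<le> ennreal (max 0 (X * (d - (c1 + c2)) - \<delta> * Z) + e)"
      using \<delta> by (intro ennreal_leI) auto
    also have "\<dots> = ennreal (max 0 (X * (d - (c1 + c2)) - \<delta> * Z)) + ennreal e"
      using e by (intro ennreal_plus) auto
    also have "ennreal (max 0 (X * (d - (c1 + c2)) - \<delta> * Z)) = ennreal (X * (d - (c1 + c2)) - \<delta> * Z)"
      by (auto simp: max_def ennreal_neg)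
    also have "\<dots> \<le> Liminf (at_right 0) ?E" using lim[OF \<delta>(1)] by (simp add: Z_def)
    finally show "ennreal (X * (d - (c1 + c2))) \<le> Liminf (at_right 0) ?E + ennreal e" by (simp add: add_right_mono)
  qed
  then show ?thesis by (simp add: c1_def c2_def)
qed

text \<open>Finiteness on \<open>D\<close> makes the restricted measure a finite Borel measure, and
  such measures are inner regular with respect to compact sets.\<close>

lemma hausdorff_outer_inner_regular:
  fixes D :: "'a::euclidean_space set"
  assumes D: "D \<in> sets borel" and fin: "hausdorff_outer s D < \<infinity>" and "0 < \<delta>"
  obtains C where "compact C" "C \<subseteq> D" "hausdorff_outer s D \<le> hausdorff_outer s C + ennreal \<delta>"
proof -
  let ?M = "hausdorff_on s D"
  have em: "emeasure ?M A = hausdorff_outer s (D \<inter> A)" if "A \<in> sets borel" for A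
    using D that by (rule emeasure_hausdorff_on)
  have "space ?M = UNIV" by (simp add: hausdorff_on_def)
  then have "emeasure ?M (space ?M) \<noteq> \<infinity>" using fin em[of UNIV] by auto
  from inner_regular[OF sets_hausdorff_on this D]
  have sup: "hausdorff_outer s D = (SUP C\<in>{C. C \<subseteq> D \<and> compact C}. emeasure ?M C)"
    using em[OF D] by simp
  have "\<exists>C\<in>{C. C \<subseteq> D \<and> compact C}. hausdorff_outer s D < emeasure ?M C + ennreal \<delta>"
    by (rule SUP_approx_ennreal[OF _ _ sup]) (use \<open>0 < \<delta>\<close> fin in auto)
  then obtain C where C: "C \<subseteq> D" "compact C" "hausdorff_outer s D < emeasure ?M C + ennreal \<delta>" by auto
  moreover have "emeasure ?M C = hausdorff_outer s C"
    using C em[of C] by (simp add: Int_absorb1 borel_closed compact_imp_closed)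
  ultimately show ?thesis using that[of C] by auto
qed

text \<open>Disjoint Borel sets need not have disjoint neighbourhoods, so each \<open>D i\<close> is
  replaced by a compact subset of almost full Hausdorff measure. The finiteness required for this
  comes from the prism over the compact set \<open>G i\<close>. The factor on the right is the loss
  in passing from projected area to the measure of a graph.\<close>

lemma Liminf_energy_Borel_family:
  fixes w :: "real^'n \<Rightarrow> real^'d" and G D :: "'i \<Rightarrow> (real^'n) set"
  assumes fin: "finite I" and \<Omega>: "open \<Omega>"
    and G: "\<And>i. i \<in> I \<Longrightarrow> jump_piece w (G i) (\<nu> i) (a i) (b i) \<kappa> \<eta> (\<rho> i) (\<tau> i) q"
    and \<rho>: "\<And>i. i \<in> I \<Longrightarrow> 0 < \<rho> i" and sub: "\<And>i. i \<in> I \<Longrightarrow> G i \<subseteq> \<Omega>"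
    and D: "\<And>i. i \<in> I \<Longrightarrow> D i \<in> sets borel" "\<And>i. i \<in> I \<Longrightarrow> D i \<subseteq> G i"
    and disj: "disjoint_family_on D I" and w: "w \<in> borel_measurable borel"
    and d: "\<And>\<nu> :: real^'n. norm \<nu> = 1 \<Longrightarrow> crossing_const \<nu> = ennreal d" "0 \<le> d"
    and \<theta>: "0 < \<theta>" "\<theta> < 1"
    and K: "0 \<le> K" "layer_const CARD('n) \<kappa> \<eta> = K"
    and e: "2 * K * unit_ball_vol (real CARD('n)) / \<theta> + unit_ball_vol (real CARD('n)) * \<theta> ^ CARD('n) \<le> e" "e \<le> d"
  shows "ennreal (d - e) * (\<Sum>i\<in>I. ennreal ((norm (a i - b i) - 2 * \<tau> i) powr q) * hausdorff_outer (real CARD('n) - 1) (D i))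
    \<le> ennreal ((1 / sqrt (1 - \<kappa>\<^sup>2)) powr (real CARD('n) - 1)) * Liminf (at_right 0) (local_energy q w \<Omega>)"
proof -
  let ?H = "hausdorff_outer (real CARD('n) - 1) :: (real^'n) set \<Rightarrow> ennreal"
  let ?L = "Liminf (at_right 0) (local_energy q w \<Omega>)"
  define L where "L = (1 / sqrt (1 - \<kappa>\<^sup>2)) powr (real CARD('n) - 1)"
  define v where "v i = (norm (a i - b i) - 2 * \<tau> i) powr q" for i
  have v0: "0 \<le> v i" for i by (simp add: v_def)
  have HC: "?H C \<le> ennreal L * emeasure lborel (prism (\<nu> i) 1 C)" if "i \<in> I" "compact C" "C \<subseteq> G i" for i C
  proof -
    interpret jump_piece w C "\<nu> i" "a i" "b i" \<kappa> \<eta> "\<rho> i" "\<tau> i" q by (rule jump_piece_subset[OF G that(2,3)]) fact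
    show ?thesis unfolding L_def using \<kappa> by (intro hausdorff_outer_flat_le_prism \<nu> C flat) auto
  qed
  have Hfin: "?H (D i) < \<infinity>" if i: "i \<in> I" for i
  proof -
    have "compact (G i)" using G[OF i] by (rule jump_piece.C)
    then have "?H (G i) \<le> ennreal L * emeasure lborel (prism (\<nu> i) 1 (G i))" by (intro HC i) auto
    also have "\<dots> < \<infinity>"
      using emeasure_compact_finite[OF compact_prism[OF \<open>compact (G i)\<close>, of "\<nu> i" 1]] by (simp add: ennreal_mult_less_top)
    finally show ?thesis using hausdorff_outer_mono[OF D(2)[OF i]] by (rule le_less_trans[rotated])
  qed
  define V where "V = (\<Sum>i\<in>I. v i)"
  have V: "0 \<le> V" unfolding V_def using v0 by (intro sum_nonneg) auto
  have "ennreal (d - e) * (\<Sum>i\<in>I. ennreal (v i) * ?H (D i)) \<le> ennreal L * ?L"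
  proof (rule ennreal_le_epsilon)
    fix e' :: real assume e': "0 < e'"
    \<comment> \<open>All pieces together lose \<open>(d - e) * (V * \<delta>)\<close>, which is to
      be at most \<open>e'\<close>; the summand 1 keeps the denominator positive.\<close>
    define \<delta> where "\<delta> = e' / ((d - e) * V + 1)"
    have dV: "0 \<le> (d - e) * V" using e V by auto
    have \<delta>: "0 < \<delta>" "(d - e) * (V * \<delta>) \<le> e'" using e' dV by (auto simp: \<delta>_def field_simps add_pos_nonneg)
    have "\<exists>C. compact C \<and> C \<subseteq> D i \<and> ?H (D i) \<le> ?H C + ennreal \<delta>" if i: "i \<in> I" for i
      using hausdorff_outer_inner_regular[OF D(1)[OF i] Hfin[OF i] \<delta>(1)] by metis
    then obtain C where C: "\<And>i. i \<in> I \<Longrightarrow> compact (C i)" "\<And>i. i \<in> I \<Longrightarrow> C i \<subseteq> D i"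
        "\<And>i. i \<in> I \<Longrightarrow> ?H (D i) \<le> ?H (C i) + ennreal \<delta>" by metis
    have CG: "C i \<subseteq> G i" if "i \<in> I" for i using C(2) D(2) that by blast
    have piece: "jump_piece w (C i) (\<nu> i) (a i) (b i) \<kappa> \<eta> (\<rho> i) (\<tau> i) q" if "i \<in> I" for i
      by (rule jump_piece_subset[OF G[OF that] C(1)[OF that] CG[OF that]])
    define m where "m i = measure lborel (prism (\<nu> i) 1 (C i))" for i
    have M: "emeasure lborel (prism (\<nu> i) 1 (C i)) = ennreal (m i)" if "i \<in> I" for i
      using emeasure_compact_finite[OF compact_prism[OF C(1)[OF that], of "\<nu> i" 1]]
      unfolding m_def by (intro emeasure_eq_ennreal_measure) auto
    have m0: "0 \<le> m i" for i by (simp add: m_def)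
    define X where "X = (\<Sum>i\<in>I. v i * m i)"
    have X0: "0 \<le> X" unfolding X_def using v0 m0 by (intro sum_nonneg) auto
    have L0: "0 \<le> L" by (simp add: L_def)
    have disjC: "disjoint_family_on C I" using disj C(2) unfolding disjoint_family_on_def by blast
    have "ennreal (X * (d - (2 * K * unit_ball_vol (real CARD('n)) / \<theta> + unit_ball_vol (real CARD('n)) * \<theta> ^ CARD('n)))) \<le> ?L"
      unfolding X_def v_def m_def
      by (rule Liminf_energy_finite_family[OF fin \<Omega> piece \<rho> _ disjC w d \<theta> K]) (use CG sub in blast)+
    moreover have "X * (d - e) \<le> X * (d - (2 * K * unit_ball_vol (real CARD('n)) / \<theta> + unit_ball_vol (real CARD('n)) * \<theta> ^ CARD('n)))"
      using e X0 by (intro mult_left_mono) auto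
    ultimately have XL: "ennreal (X * (d - e)) \<le> ?L" by (meson ennreal_leI order_trans)
    have "(\<Sum>i\<in>I. ennreal (v i) * ?H (D i)) \<le> (\<Sum>i\<in>I. ennreal (v i) * (ennreal L * ennreal (m i) + ennreal \<delta>))"
    proof (intro sum_mono mult_left_mono)
      fix i assume i: "i \<in> I"
      have "?H (D i) \<le> ?H (C i) + ennreal \<delta>" by (rule C(3)[OF i])
      also have "?H (C i) \<le> ennreal L * ennreal (m i)" using HC[OF i C(1)[OF i] CG[OF i]] by (simp add: M[OF i])
      finally show "?H (D i) \<le> ennreal L * ennreal (m i) + ennreal \<delta>" by (simp add: add_right_mono)
    qed simp
    also have "\<dots> = (\<Sum>i\<in>I. ennreal (v i * (L * m i + \<delta>)))"
      using v0 m0 L0 \<delta> by (intro sum.cong) (auto simp: ennreal_mult[symmetric] ennreal_plus[symmetric] simp del: ennreal_plus)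
    also have "\<dots> = ennreal (\<Sum>i\<in>I. v i * (L * m i + \<delta>))"
      using v0 m0 L0 \<delta> by (intro sum_ennreal) auto
    also have "(\<Sum>i\<in>I. v i * (L * m i + \<delta>)) = L * X + V * \<delta>"
      by (simp add: X_def V_def sum.distrib sum_distrib_left sum_distrib_right algebra_simps)
    finally have "ennreal (d - e) * (\<Sum>i\<in>I. ennreal (v i) * ?H (D i)) \<le> ennreal (d - e) * ennreal (L * X + V * \<delta>)"
      by (rule mult_left_mono) simp
    also have "\<dots> = ennreal ((d - e) * (L * X + V * \<delta>))"
      using e X0 L0 V \<delta> by (intro ennreal_mult[symmetric]) auto
    also have "\<dots> \<le> ennreal (L * (X * (d - e)) + e')"
      using \<delta> by (intro ennreal_leI) (simp add: algebra_simps)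
    also have "\<dots> = ennreal L * ennreal (X * (d - e)) + ennreal e'"
      using e e' X0 L0 by (simp add: ennreal_mult)
    also have "\<dots> \<le> ennreal L * ?L + ennreal e'"
      by (intro add_right_mono mult_left_mono XL) simp
    finally show "ennreal (d - e) * (\<Sum>i\<in>I. ennreal (v i) * ?H (D i)) \<le> ennreal L * ?L + ennreal e'" .
  qed
  then show ?thesis by (simp add: v_def L_def)
qed

subsection \<open>Decomposition of the jump set\<close>

text \<open>After extension by 0 each coordinate has a Borel representative, and finitely many null
  sets are discarded.\<close>

lemma lebesgue_on_ex_borel_measurable:
  fixes u :: "real^'n \<Rightarrow> real^'d"
  assumes u: "u \<in> borel_measurable (lebesgue_on \<Omega>)" and \<Omega>: "\<Omega> \<in> sets borel"
  obtains w where "w \<in> borel_measurable borel" "AE x in lborel. x \<in> \<Omega> \<longrightarrow> u x = w x"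
proof -
  define v where "v x = (if x \<in> \<Omega> then u x else 0)" for x
  have v: "v \<in> borel_measurable lebesgue"
    unfolding v_def using u \<Omega> by (intro borel_measurable_if_I) auto
  have "\<exists>g\<in>borel_measurable lborel. AE x in lborel. v x \<bullet> b = g x" if "b \<in> Basis" for b
    using v by (intro completion_ex_borel_measurable_real borel_measurable_inner) auto
  then obtain g where g: "\<And>b. b \<in> Basis \<Longrightarrow> g b \<in> borel_measurable lborel"
      "\<And>b. b \<in> Basis \<Longrightarrow> AE x in lborel. v x \<bullet> b = g b x" by metis
  define w where "w x = (\<Sum>b\<in>Basis. g b x *\<^sub>R b)" for x
  have "w \<in> borel_measurable borel"
    unfolding w_def using g(1) by (intro borel_measurable_sum borel_measurable_scaleR) auto
  moreover have "AE x in lborel. \<forall>b\<in>Basis. v x \<bullet> b = g b x"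
    using g(2) by (intro AE_finite_allI) auto
  then have "AE x in lborel. x \<in> \<Omega> \<longrightarrow> u x = w x"
  proof eventually_elim
    case (elim x)
    then have "w x = (\<Sum>b\<in>Basis. (v x \<bullet> b) *\<^sub>R b)" by (simp add: w_def)
    then have "w x = v x" by (simp add: euclidean_representation)
    then show ?case by (simp add: v_def)
  qed
  ultimately show ?thesis by (rule that)
qed

text \<open>Half balls are open, so their indicators are lower semicontinuous in the centre, and
  Fatou's lemma carries the volume bound to limits of centres. Closedness is what makes the cells
  compact.\<close>

lemma closed_thin_at:
  fixes A :: "(real^'n) set"
  assumes A: "A \<in> sets borel"
  shows "closed {x. thin_at A \<nu> \<eta> \<rho>0 x}"
  unfolding closed_sequential_limits
proof (intro allI impI, elim conjE)
  fix X l assume X: "\<forall>n. X n \<in> {x. thin_at A \<nu> \<eta> \<rho>0 x}" and lim: "X \<longlonglongrightarrow> l"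
  show "l \<in> {x. thin_at A \<nu> \<eta> \<rho>0 x}"
    unfolding mem_Collect_eq thin_at_def
  proof (intro allI impI)
    fix \<rho> assume \<rho>: "0 < \<rho>" "\<rho> < \<rho>0"
    have sets: "A \<inter> half_ball x \<nu> \<rho> \<in> sets borel" for x using A by (intro sets.Int half_ball_borel)
    have "emeasure lborel (A \<inter> half_ball l \<nu> \<rho>) = (\<integral>\<^sup>+y. indicator (A \<inter> half_ball l \<nu> \<rho>) y \<partial>lborel)"
      using sets by simp
    also have "\<dots> \<le> (\<integral>\<^sup>+y. liminf (\<lambda>n. indicator (A \<inter> half_ball (X n) \<nu> \<rho>) y) \<partial>lborel)"
    proof (rule nn_integral_mono)
      fix y
      show "indicator (A \<inter> half_ball l \<nu> \<rho>) y \<le> liminf (\<lambda>n. indicator (A \<inter> half_ball (X n) \<nu> \<rho>) y :: ennreal)"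
      proof (cases "y \<in> A \<inter> half_ball l \<nu> \<rho>")
        case True
        then have y: "y \<in> A" "dist l y < \<rho>" "0 < (y - l) \<bullet> \<nu>" by (auto simp: half_ball_def)
        have "(\<lambda>n. dist (X n) y) \<longlonglongrightarrow> dist l y" using lim by (intro tendsto_dist tendsto_const)
        then have "\<forall>\<^sub>F n in sequentially. dist (X n) y < \<rho>" using y by (intro order_tendstoD) auto
        moreover have "(\<lambda>n. (y - X n) \<bullet> \<nu>) \<longlonglongrightarrow> (y - l) \<bullet> \<nu>" using lim by (intro tendsto_inner tendsto_diff tendsto_const)
        then have "\<forall>\<^sub>F n in sequentially. 0 < (y - X n) \<bullet> \<nu>" using y by (intro order_tendstoD) auto
        ultimately have "\<forall>\<^sub>F n in sequentially. (1::ennreal) \<le> indicator (A \<inter> half_ball (X n) \<nu> \<rho>) y"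
          by eventually_elim (use y in \<open>auto simp: half_ball_def indicator_def\<close>)
        then have "1 \<le> liminf (\<lambda>n. indicator (A \<inter> half_ball (X n) \<nu> \<rho>) y :: ennreal)" by (rule Liminf_bounded)
        then show ?thesis using True by simp
      qed simp
    qed
    also have "\<dots> \<le> liminf (\<lambda>n. \<integral>\<^sup>+y. indicator (A \<inter> half_ball (X n) \<nu> \<rho>) y \<partial>lborel)"
      using sets by (intro nn_integral_liminf) auto
    also have "\<dots> \<le> limsup (\<lambda>n. \<integral>\<^sup>+y. indicator (A \<inter> half_ball (X n) \<nu> \<rho>) y \<partial>lborel)"
      by (rule Liminf_le_Limsup) simp
    also have "\<dots> \<le> ennreal (\<eta> * \<rho> ^ CARD('n))"
      using X \<rho> sets by (intro Limsup_bounded always_eventually allI) (auto simp: thin_at_def)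
    finally show "emeasure lborel (A \<inter> half_ball l \<nu> \<rho>) \<le> ennreal (\<eta> * \<rho> ^ CARD('n))" .
  qed
qed

text \<open>A parameter \<open>(a, b, \<nu>, \<rho>, p)\<close> collects approximate traces, an approximate normal, a scale and a location.\<close>

type_synonym ('n, 'd) jump_param = "(real^'d) \<times> (real^'d) \<times> (real^'n) \<times> real \<times> (real^'n)"

text \<open>Two points of a cell are at most \<open>\<rho> / 4\<close> apart, as the flatness
  argument asks for distances small against the scale. The tolerance is proportional to the size of
  the jump, so the relative loss is the same in all cells.\<close>

definition jump_cell :: "(real^'n \<Rightarrow> real^'d) \<Rightarrow> real \<Rightarrow> real \<Rightarrow> ('n, 'd) jump_param \<Rightarrow> (real^'n) set" where
  "jump_cell w \<kappa> \<eta> = (\<lambda>(a, b, \<nu>, \<rho>, p).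
     {x \<in> cball p (\<rho> / 8). thin_at {y. \<kappa> * norm (a - b) < norm (w y - a)} \<nu> \<eta> \<rho> x \<and>
        thin_at {y. \<kappa> * norm (a - b) < norm (w y - b)} (- \<nu>) \<eta> \<rho> x})"

lemma jump_piece_jump_cell:
  fixes w :: "real^'n \<Rightarrow> real^'d"
  assumes w[measurable]: "w \<in> borel_measurable borel" and "a \<noteq> b" "norm \<nu> = 1" "0 < \<rho>"
    and \<kappa>: "0 < \<kappa>" "\<kappa> < 1/2" and \<eta>: "0 \<le> \<eta>" "2 * 4 ^ CARD('n) * \<eta> < unit_ball_vol (real CARD('n)) * \<kappa> ^ CARD('n)"
    and "0 \<le> q"
  shows "jump_piece w (jump_cell w \<kappa> \<eta> (a, b, \<nu>, \<rho>, p)) \<nu> a b \<kappa> \<eta> \<rho> (\<kappa> * norm (a - b)) q"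
proof
  let ?C = "jump_cell w \<kappa> \<eta> (a, b, \<nu>, \<rho>, p)"
  let ?A = "\<lambda>a'. {y. \<kappa> * norm (a - b) < norm (w y - a')}"
  have A: "?A a' \<in> sets borel" for a' by measurable
  have C: "?C = cball p (\<rho> / 8) \<inter> ({x. thin_at (?A a) \<nu> \<eta> \<rho> x} \<inter> {x. thin_at (?A b) (- \<nu>) \<eta> \<rho> x})"
    by (auto simp: jump_cell_def)
  show "compact ?C" unfolding C by (intro compact_Int_closed closed_Int closed_thin_at A compact_cball)
  show thin: "thin_at (?A a) \<nu> \<eta> \<rho> x" "thin_at (?A b) (- \<nu>) \<eta> \<rho> x" if "x \<in> ?C" for x
    using that by (auto simp: C)
  show "flat_set \<kappa> \<nu> ?C"
  proof (rule thin_at_imp_flat_set[OF A A _ \<open>norm \<nu> = 1\<close> _ _ \<eta>(1) thin _ \<eta>(2)])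
    \<comment> \<open>Because \<open>2 * \<kappa> < 1\<close>, no value lies within the tolerance of
      both \<open>a\<close> and \<open>b\<close>.\<close>
    show "?A a \<union> ?A b = UNIV"
    proof (rule ccontr)
      assume "?A a \<union> ?A b \<noteq> UNIV"
      then obtain y where "y \<notin> ?A a \<union> ?A b" by blast
      then have y: "norm (w y - a) \<le> \<kappa> * norm (a - b)" "norm (w y - b) \<le> \<kappa> * norm (a - b)" by auto
      have "norm (a - b) \<le> norm (w y - b) + norm (w y - a)"
        using norm_triangle_ineq4[of "w y - b" "w y - a"] by simp
      then have "norm (a - b) \<le> 2 * \<kappa> * norm (a - b)" using y by linarith
      moreover have "2 * \<kappa> * norm (a - b) < 1 * norm (a - b)" using \<kappa> \<open>a \<noteq> b\<close> by (intro mult_strict_right_mono) auto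
      ultimately show False by simp
    qed
    fix x y assume "x \<in> ?C" "y \<in> ?C"
    then have "dist p x \<le> \<rho> / 8" "dist p y \<le> \<rho> / 8" by (auto simp: C)
    then show "2 * dist x y < \<rho>" using dist_triangle3[of x y p] \<open>0 < \<rho>\<close> by linarith
  qed (use \<kappa> in auto)
  have "2 * \<kappa> * norm (a - b) \<le> 1 * norm (a - b)" using \<kappa> by (intro mult_right_mono) auto
  then show "2 * (\<kappa> * norm (a - b)) \<le> norm (a - b)" by simp
qed (use assms in auto)

lemma jump_cell_subset: "jump_cell w \<kappa> \<eta> (a, b, \<nu>, \<rho>, p) \<subseteq> cball p (\<rho> / 8)"
  by (auto simp: jump_cell_def)

section \<open>From one-sided averages to membership in a cell\<close>

lemma nn_average_less_imp:
  fixes E :: "(real^'n) set"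
  assumes "nn_average E f < c" "emeasure lebesgue E < \<infinity>"
  shows "(\<integral>\<^sup>+y\<in>E. ennreal (f y) \<partial>lebesgue) \<le> c * emeasure lebesgue E"
proof (cases "emeasure lebesgue E = 0")
  \<comment> \<open>Division by 0 sends a nonzero numerator to \<open>\<infinity>\<close>, so a
    small average forces the integral to vanish.\<close>
  case True
  have "(\<integral>\<^sup>+y\<in>E. ennreal (f y) \<partial>lebesgue) = 0"
  proof (rule ccontr)
    assume "(\<integral>\<^sup>+y\<in>E. ennreal (f y) \<partial>lebesgue) \<noteq> 0"
    then have "nn_average E f = \<infinity>" by (simp add: nn_average_def True ennreal_divide_zero)
    then show False using assms by simp
  qed
  then show ?thesis by simp
next
  case False
  have "(\<integral>\<^sup>+y\<in>E. ennreal (f y) \<partial>lebesgue) = nn_average E f * emeasure lebesgue E"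
    unfolding nn_average_def using False assms(2) by (simp add: ennreal_divide_times mult_divide_eq_ennreal less_top)
  also have "\<dots> \<le> c * emeasure lebesgue E" using assms by (intro mult_right_mono) auto
  finally show ?thesis .
qed

text \<open>Chebyshev's inequality: the set where \<open>w\<close> is more than
  \<open>\<delta>\<close> away from \<open>a\<close> has at most \<open>1 / \<delta>\<close> times
  the integral as volume. The threshold \<open>c\<close> for the average is tuned to the volume of
  the full ball, which dominates that of the half ball.\<close>

lemma trace_imp_eventually_thin:
  fixes u w :: "real^'n \<Rightarrow> real^'d"
  assumes w[measurable]: "w \<in> borel_measurable borel" and ae: "AE x in lborel. x \<in> \<Omega> \<longrightarrow> u x = w x"
    and \<Omega>: "open \<Omega>" "x \<in> \<Omega>" and "0 < \<delta>" "0 < \<eta>"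
    and lim: "((\<lambda>\<rho>. nn_average (half_ball x \<nu> \<rho>) (\<lambda>y. norm (u y - a))) \<longlongrightarrow> 0) (at_right 0)"
  shows "\<forall>\<^sub>F \<rho> in at_right 0. emeasure lborel ({y. \<delta> < norm (w y - a)} \<inter> half_ball x \<nu> \<rho>) \<le> ennreal (\<eta> * \<rho> ^ CARD('n))"
proof -
  let ?\<omega> = "unit_ball_vol (real CARD('n))"
  have \<omega>: "0 < ?\<omega>" by simp
  define c where "c = \<delta> * \<eta> / ?\<omega>"
  have c: "0 < c" using \<open>0 < \<delta>\<close> \<open>0 < \<eta>\<close> \<omega> by (simp add: c_def)
  obtain r where r: "0 < r" "ball x r \<subseteq> \<Omega>" using \<Omega> open_contains_ball by blast
  have "\<forall>\<^sub>F \<rho> in at_right 0. nn_average (half_ball x \<nu> \<rho>) (\<lambda>y. norm (u y - a)) < ennreal c"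
    using lim c by (intro order_tendstoD) auto
  moreover have "\<forall>\<^sub>F \<rho> in at_right 0. 0 < \<rho> \<and> \<rho> < r"
    unfolding eventually_at_right_field using r by (intro exI[of _ r]) auto
  ultimately show ?thesis
  proof eventually_elim
    case (elim \<rho>)
    let ?H = "half_ball x \<nu> \<rho>"
    let ?S = "{y. \<delta> < norm (w y - a)} \<inter> ?H"
    have H[measurable]: "?H \<in> sets borel" by (rule half_ball_borel)
    have S[measurable]: "?S \<in> sets borel" by measurable
    have H_ball: "?H \<subseteq> ball x \<rho>" by (auto simp: half_ball_def)
    have vol: "emeasure lebesgue ?H \<le> ennreal (?\<omega> * \<rho> ^ CARD('n))"
    proof -
      have "emeasure lebesgue ?H = emeasure lborel ?H" using H by simp
      also have "\<dots> \<le> emeasure lborel (ball x \<rho>)" using H_ball by (intro emeasure_mono) auto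
      also have "\<dots> = ennreal (?\<omega> * \<rho> ^ CARD('n))" using elim by (simp add: emeasure_ball)
      finally show ?thesis .
    qed
    have H\<Omega>: "?H \<subseteq> \<Omega>" using H_ball r elim by (auto simp: subset_iff)
    have "ennreal \<delta> * emeasure lborel ?S = (\<integral>\<^sup>+y. ennreal \<delta> * indicator ?S y \<partial>lborel)"
      by (subst nn_integral_cmult_indicator) auto
    also have "\<dots> \<le> (\<integral>\<^sup>+y\<in>?H. ennreal (norm (w y - a)) \<partial>lborel)"
      by (intro nn_integral_mono) (auto simp: indicator_def intro!: ennreal_leI)
    also have "\<dots> = (\<integral>\<^sup>+y\<in>?H. ennreal (norm (u y - a)) \<partial>lborel)"
      by (rule nn_integral_cong_AE, use ae in eventually_elim) (use H\<Omega> in \<open>auto simp: indicator_def\<close>)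
    also have "\<dots> = (\<integral>\<^sup>+y\<in>?H. ennreal (norm (u y - a)) \<partial>lebesgue)" by (simp add: nn_integral_completion)
    also have "\<dots> \<le> ennreal c * emeasure lebesgue ?H"
      using elim(1) by (rule nn_average_less_imp) (rule le_less_trans[OF vol], simp)
    also have "\<dots> \<le> ennreal c * ennreal (?\<omega> * \<rho> ^ CARD('n))" using vol by (rule mult_left_mono) simp
    also have "\<dots> = ennreal \<delta> * ennreal (\<eta> * \<rho> ^ CARD('n))"
    proof -
      have "c * (?\<omega> * \<rho> ^ CARD('n)) = \<delta> * (\<eta> * \<rho> ^ CARD('n))"
        unfolding c_def using \<omega> by (metis (no_types, opaque_lifting) less_irrefl mult.assoc nonzero_eq_divide_eq)
      then show ?thesis using elim c \<open>0 < \<delta>\<close> \<open>0 < \<eta>\<close> \<omega> by (subst (1 2) ennreal_mult[symmetric]) auto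
    qed
    finally show ?case using \<open>0 < \<delta>\<close> by (subst (asm) ennreal_mult_le_mult_iff) auto
  qed
qed

text \<open>Tilting the normal adds to the half ball at most a slab of thickness
  \<open>norm (\<nu> - \<nu>0) * \<rho>\<close>, whose volume is covered by the second
  \<open>\<eta> / 2\<close>. Normals can thus be restricted to a countable dense set.\<close>

lemma eventually_thin_perturb:
  fixes A A' :: "(real^'n) set" and \<nu> \<nu>0 :: "real^'n"
  assumes A: "A \<in> sets borel" "A' \<in> sets borel" "A' \<subseteq> A" and \<nu>: "norm \<nu> = 1"
    and close: "unit_ball_vol (real (CARD('n) - 1)) * norm (\<nu> - \<nu>0) \<le> \<eta> / 2" and "0 \<le> \<eta>"
    and thin: "\<forall>\<^sub>F \<rho> in at_right 0. emeasure lborel (A \<inter> half_ball x \<nu> \<rho>) \<le> ennreal (\<eta> / 2 * \<rho> ^ CARD('n))"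
  shows "\<forall>\<^sub>F \<rho> in at_right 0. emeasure lborel (A' \<inter> half_ball x \<nu>0 \<rho>) \<le> ennreal (\<eta> * \<rho> ^ CARD('n))"
proof -
  let ?W = "unit_ball_vol (real (CARD('n) - 1))"
  have N: "Suc (CARD('n) - 1) = CARD('n)" using zero_less_card_finite[where 'a = 'n] by simp
  have "\<forall>\<^sub>F \<rho> :: real in at_right 0. 0 < \<rho>" by (simp add: eventually_at_right_less)
  with thin show ?thesis
  proof eventually_elim
    case (elim \<rho>)
    define g where "g = norm (\<nu> - \<nu>0)"
    define S where "S = {y. y \<bullet> \<nu> \<in> {-(g * \<rho>)..0} \<and> norm (proj_perp \<nu> y) \<le> \<rho>}"
    have S: "S \<in> sets borel" unfolding S_def by measurable
    have xS: "(+) x ` S \<in> sets borel" using S by (rule translation_borel)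
    have "A' \<inter> half_ball x \<nu>0 \<rho> \<subseteq> (A \<inter> half_ball x \<nu> \<rho>) \<union> (+) x ` S"
    proof
      fix y assume y: "y \<in> A' \<inter> half_ball x \<nu>0 \<rho>"
      then have ny: "norm (y - x) < \<rho>" and pos: "0 < (y - x) \<bullet> \<nu>0" by (auto simp: half_ball_def dist_norm norm_minus_commute)
      show "y \<in> (A \<inter> half_ball x \<nu> \<rho>) \<union> (+) x ` S"
      proof (cases "0 < (y - x) \<bullet> \<nu>")
        case True
        then show ?thesis using y A(3) by (auto simp: half_ball_def)
      next
        case False
        have "(y - x) \<bullet> \<nu>0 = (y - x) \<bullet> \<nu> - (y - x) \<bullet> (\<nu> - \<nu>0)" by (simp add: inner_diff_right)
        moreover have "\<bar>(y - x) \<bullet> (\<nu> - \<nu>0)\<bar> \<le> norm (y - x) * g" unfolding g_def by (rule Cauchy_Schwarz_ineq2)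
        moreover have "norm (y - x) * g \<le> \<rho> * g" using ny by (intro mult_right_mono) (auto simp: g_def)
        ultimately have low: "- (g * \<rho>) \<le> (y - x) \<bullet> \<nu>" using pos by (simp add: mult.commute)
        have "norm (proj_perp \<nu> (y - x)) \<le> \<rho>" using norm_proj_perp_le[OF \<nu>, of "y - x"] ny by linarith
        then have "y - x \<in> S" using False low by (simp add: S_def)
        then have "x + (y - x) \<in> (+) x ` S" by (rule imageI)
        then show ?thesis by simp
      qed
    qed
    then have "emeasure lborel (A' \<inter> half_ball x \<nu>0 \<rho>) \<le> emeasure lborel ((A \<inter> half_ball x \<nu> \<rho>) \<union> (+) x ` S)"
      using A xS by (intro emeasure_mono) auto
    also have "\<dots> \<le> emeasure lborel (A \<inter> half_ball x \<nu> \<rho>) + emeasure lborel ((+) x ` S)"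
      using A xS by (intro emeasure_subadditive) auto
    also have "emeasure lborel ((+) x ` S) = emeasure lborel S" using S by (rule emeasure_lborel_translation)
    also have "emeasure lborel S = ennreal (g * \<rho> * (?W * \<rho> ^ (CARD('n) - 1)))"
      using emeasure_cylinder[OF \<nu> elim(2), of "-(g * \<rho>)" 0] elim(2) by (simp add: S_def g_def)
    also have "g * \<rho> * (?W * \<rho> ^ (CARD('n) - 1)) = (?W * g) * \<rho> ^ Suc (CARD('n) - 1)" by (simp only: power_Suc mult_ac)
    also have "\<dots> = (?W * g) * \<rho> ^ CARD('n)" by (simp only: N)
    also have "ennreal \<dots> \<le> ennreal (\<eta> / 2 * \<rho> ^ CARD('n))"
      using close elim(2) by (intro ennreal_leI mult_right_mono) (auto simp: g_def)
    also have "emeasure lborel (A \<inter> half_ball x \<nu> \<rho>) \<le> ennreal (\<eta> / 2 * \<rho> ^ CARD('n))" by (rule elim(1))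
    finally have "emeasure lborel (A' \<inter> half_ball x \<nu>0 \<rho>) \<le> ennreal (\<eta> / 2 * \<rho> ^ CARD('n)) + ennreal (\<eta> / 2 * \<rho> ^ CARD('n))"
      by (simp add: add_mono)
    also have "\<dots> = ennreal (\<eta> / 2 * \<rho> ^ CARD('n) + \<eta> / 2 * \<rho> ^ CARD('n))"
      using \<open>0 \<le> \<eta>\<close> elim(2) by (intro ennreal_plus[symmetric]) auto
    also have "\<eta> / 2 * \<rho> ^ CARD('n) + \<eta> / 2 * \<rho> ^ CARD('n) = \<eta> * \<rho> ^ CARD('n)" by simp
    finally show ?case .
  qed
qed

lemma eventually_imp_thin_at:
  assumes "\<forall>\<^sub>F \<rho> in at_right 0. emeasure lborel (A \<inter> half_ball x \<nu> \<rho>) \<le> ennreal (\<eta> * \<rho> ^ CARD('n))"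
  shows "\<forall>\<^sub>F \<rho>0 in at_right 0. thin_at A \<nu> \<eta> \<rho>0 (x :: real^'n)"
proof -
  obtain r where r: "0 < r" "\<And>\<rho>. 0 < \<rho> \<Longrightarrow> \<rho> < r \<Longrightarrow> emeasure lborel (A \<inter> half_ball x \<nu> \<rho>) \<le> ennreal (\<eta> * \<rho> ^ CARD('n))"
    using assms unfolding eventually_at_right_field by auto
  show ?thesis unfolding eventually_at_right_field thin_at_def
    by (rule exI[of _ r]) (use r in auto)
qed

text \<open>The exact data of a jump point are replaced by members of countable sets, within the
  slack left by the tolerance \<open>\<kappa> * norm (a0 - b0)\<close> and by proving thinness with
  \<open>\<eta> / 2\<close> first.\<close>

lemma jump_triple_imp_jump_cell:
  fixes u w :: "real^'n \<Rightarrow> real^'d"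
  assumes w: "w \<in> borel_measurable borel" and ae: "AE x in lborel. x \<in> \<Omega> \<longrightarrow> u x = w x"
    and \<Omega>: "open \<Omega>" "x \<in> \<Omega>" and \<kappa>: "0 < \<kappa>" "\<kappa> < 1/2" and \<eta>: "0 < \<eta>"
    and jump: "is_jump_triple u x (a, b, \<nu>)"
    and dense: "closure V = (UNIV :: (real^'d) set)" "sphere 0 1 \<subseteq> closure S" "closure P = (UNIV :: (real^'n) set)"
  obtains a0 b0 \<nu>0 n p where "a0 \<in> V" "b0 \<in> V" "\<nu>0 \<in> S" "p \<in> P" "a0 \<noteq> b0"
    "cball p (inverse (real (Suc n))) \<subseteq> \<Omega>" "x \<in> jump_cell w \<kappa> \<eta> (a0, b0, \<nu>0, inverse (real (Suc n)), p)"
    "(1 - \<kappa>) * norm (a - b) \<le> norm (a0 - b0)"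
proof -
  let ?W = "unit_ball_vol (real (CARD('n) - 1))"
  have ab: "a \<noteq> b" and \<nu>: "norm \<nu> = 1"
    and lim: "((\<lambda>\<rho>. nn_average (half_ball x \<nu> \<rho>) (\<lambda>y. norm (u y - a))) \<longlongrightarrow> 0) (at_right 0)"
      "((\<lambda>\<rho>. nn_average (half_ball x (- \<nu>) \<rho>) (\<lambda>y. norm (u y - b))) \<longlongrightarrow> 0) (at_right 0)"
    using jump by (auto simp: is_jump_triple_def)
  define j where "j = norm (a - b)"
  \<comment> \<open>The replaced jump loses at most \<open>2 * \<delta>\<close>, hence keeps at
    least half of \<open>j\<close>. The tolerance \<open>\<kappa> * norm (a0 - b0)\<close> is then
    at least \<open>4 * \<delta>\<close>, which leaves more than \<open>\<delta>\<close> after the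
    shift from the approximate to the exact trace.\<close>
  define \<delta> where "\<delta> = \<kappa> * j / 8"
  have j: "0 < j" using ab by (simp add: j_def)
  have \<delta>: "0 < \<delta>" using \<kappa> j by (simp add: \<delta>_def)
  obtain a0 where a0: "a0 \<in> V" "dist a0 a < \<delta>" using closure_approachable[of a V] dense(1) \<delta> by auto
  obtain b0 where b0: "b0 \<in> V" "dist b0 b < \<delta>" using closure_approachable[of b V] dense(1) \<delta> by auto
  have "\<nu> \<in> closure S" using \<nu> dense(2) by auto
  moreover have "0 < \<eta> / (2 * (?W + 1))" using \<eta> by (simp add: add_nonneg_pos)
  ultimately obtain \<nu>0 where \<nu>0: "\<nu>0 \<in> S" "dist \<nu>0 \<nu> < \<eta> / (2 * (?W + 1))" by (meson closure_approachable)
  have close: "?W * norm (\<nu> - \<nu>0) \<le> \<eta> / 2"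
  proof -
    have W: "0 \<le> ?W" by simp
    have "?W * norm (\<nu> - \<nu>0) \<le> (?W + 1) * (\<eta> / (2 * (?W + 1)))"
      using \<nu>0(2) W by (intro mult_mono) (auto simp: dist_norm norm_minus_commute)
    also have "\<dots> = \<eta> / 2"
    proof -
      have "c * (\<eta> / (2 * c)) = \<eta> / 2" if "0 < c" for c using that by simp
      then show ?thesis using W by (metis add_nonneg_pos zero_less_one)
    qed
    finally show ?thesis .
  qed
  have "j \<le> norm (a0 - b0) + norm (a0 - a) + norm (b0 - b)"
  proof -
    have "a - b = (a0 - b0) - (a0 - a) + (b0 - b)" by simp
    then have "j \<le> norm ((a0 - b0) - (a0 - a)) + norm (b0 - b)" unfolding j_def by (metis norm_triangle_ineq)
    also have "norm ((a0 - b0) - (a0 - a)) \<le> norm (a0 - b0) + norm (a0 - a)" by (rule norm_triangle_ineq4)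
    finally show ?thesis by simp
  qed
  then have "j - 2 * \<delta> \<le> norm (a0 - b0)" using a0 b0 by (simp add: dist_norm)
  moreover have "(1 - \<kappa>) * j \<le> j - 2 * \<delta>" using \<kappa> j by (simp add: \<delta>_def algebra_simps)
  ultimately have j0: "(1 - \<kappa>) * j \<le> norm (a0 - b0)" by simp
  have half: "1/2 * j \<le> (1 - \<kappa>) * j" using \<kappa> j by (intro mult_right_mono) auto
  then have "0 < norm (a0 - b0)" using j0 j by linarith
  then have "a0 \<noteq> b0" by auto
  have "\<kappa> * (1/2 * j) \<le> \<kappa> * norm (a0 - b0)" using half j0 \<kappa> by (intro mult_left_mono) auto
  then have tol: "4 * \<delta> \<le> \<kappa> * norm (a0 - b0)" by (simp add: \<delta>_def)
  have sub: "{y. \<kappa> * norm (a0 - b0) < norm (w y - c0)} \<subseteq> {y. \<delta> < norm (w y - c)}" if "dist c0 c < \<delta>" for c0 c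
  proof (intro subsetI CollectI)
    fix y assume "y \<in> {y. \<kappa> * norm (a0 - b0) < norm (w y - c0)}"
    moreover have "norm (w y - c0) \<le> norm (w y - c) + norm (c0 - c)" using norm_triangle_ineq4[of "w y - c" "c0 - c"] by simp
    ultimately show "\<delta> < norm (w y - c)" using tol that \<delta> by (simp add: dist_norm)
  qed
  have meas: "{y. t < norm (w y - c)} \<in> sets borel" for t c using w by measurable
  have "\<forall>\<^sub>F r in at_right 0. thin_at {y. \<kappa> * norm (a0 - b0) < norm (w y - a0)} \<nu>0 \<eta> r x"
    by (intro eventually_imp_thin_at eventually_thin_perturb[OF meas meas sub[OF a0(2)] \<nu> close]
        trace_imp_eventually_thin[OF w ae \<Omega> \<delta> _ lim(1)]) (use \<eta> in auto)
  moreover have "\<forall>\<^sub>F r in at_right 0. thin_at {y. \<kappa> * norm (a0 - b0) < norm (w y - b0)} (- \<nu>0) \<eta> r x"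
    by (intro eventually_imp_thin_at eventually_thin_perturb[OF meas meas sub[OF b0(2)], of "- \<nu>"]
        trace_imp_eventually_thin[OF w ae \<Omega> \<delta> _ lim(2)]) (use \<eta> \<nu> close in \<open>auto simp: norm_minus_commute\<close>)
  moreover obtain r1 where r1: "0 < r1" "ball x r1 \<subseteq> \<Omega>" using \<Omega> open_contains_ball by blast
  \<comment> \<open>Twice the scale, since the ball of that radius will be centred at a point
    \<open>p\<close> that is merely close to \<open>x\<close>.\<close>
  then have "\<forall>\<^sub>F r in at_right 0. 2 * r < r1"
    unfolding eventually_at_right_field by (intro exI[of _ "r1 / 2"]) auto
  ultimately have "\<forall>\<^sub>F r in at_right 0. thin_at {y. \<kappa> * norm (a0 - b0) < norm (w y - a0)} \<nu>0 \<eta> r x \<and>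
      thin_at {y. \<kappa> * norm (a0 - b0) < norm (w y - b0)} (- \<nu>0) \<eta> r x \<and> 2 * r < r1"
    by eventually_elim auto
  moreover have "filterlim (\<lambda>n. inverse (real (Suc n))) (at_right 0) sequentially"
    unfolding at_within_def filterlim_inf
    by (intro conjI LIMSEQ_inverse_real_of_nat) (simp add: filterlim_principal)
  ultimately have "\<forall>\<^sub>F n in sequentially. thin_at {y. \<kappa> * norm (a0 - b0) < norm (w y - a0)} \<nu>0 \<eta> (inverse (real (Suc n))) x \<and>
      thin_at {y. \<kappa> * norm (a0 - b0) < norm (w y - b0)} (- \<nu>0) \<eta> (inverse (real (Suc n))) x \<and> 2 * inverse (real (Suc n)) < r1"
    by (rule eventually_compose_filterlim)
  then obtain n where n: "thin_at {y. \<kappa> * norm (a0 - b0) < norm (w y - a0)} \<nu>0 \<eta> (inverse (real (Suc n))) x"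
      "thin_at {y. \<kappa> * norm (a0 - b0) < norm (w y - b0)} (- \<nu>0) \<eta> (inverse (real (Suc n))) x" "2 * inverse (real (Suc n)) < r1"
    by (auto simp: eventually_sequentially simp del: of_nat_Suc)
  define \<rho> where "\<rho> = inverse (real (Suc n))"
  have \<rho>: "0 < \<rho>" "2 * \<rho> < r1" using n(3) by (auto simp: \<rho>_def)
  obtain p where p: "p \<in> P" "dist p x < \<rho> / 8" using closure_approachable[of x P] dense(3) \<rho>(1) by (metis UNIV_I divide_pos_pos zero_less_numeral)
  have "cball p \<rho> \<subseteq> \<Omega>"
  proof
    fix y assume "y \<in> cball p \<rho>"
    then have "dist x y < r1" using p(2) \<rho> dist_triangle[of x y p] by (simp add: dist_commute)
    then show "y \<in> \<Omega>" using r1 by auto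
  qed
  moreover have "x \<in> jump_cell w \<kappa> \<eta> (a0, b0, \<nu>0, \<rho>, p)"
    using n p by (simp add: jump_cell_def \<rho>_def less_imp_le)
  ultimately show ?thesis
    using that[OF a0(1) b0(1) \<nu>0(1) p(1) \<open>a0 \<noteq> b0\<close>] j0 by (simp add: \<rho>_def j_def)
qed

text \<open>Cells overlap, and adding over all of them would count the same energy repeatedly. The
  maximum of the weighted indicators is represented by disjoint sets instead: each point goes to a
  cell of largest weight among those containing it.\<close>

lemma max_eq_disjoint_sum:
  fixes G :: "nat \<Rightarrow> 'a::metric_space set" and v :: "nat \<Rightarrow> ennreal"
  assumes G: "\<And>i. G i \<in> sets borel"
  shows "\<exists>D. (\<forall>i. D i \<in> sets borel \<and> D i \<subseteq> G i) \<and> disjoint_family_on D {..<n} \<and>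
    (\<forall>x. \<forall>i<n. v i * indicator (G i) x \<le> (\<Sum>i<n. v i * indicator (D i) x))"
proof (induction n)
  case 0
  show ?case by (intro exI[of _ "\<lambda>_. {}"]) (auto simp: disjoint_family_on_def)
next
  case (Suc n)
  then obtain D where D: "\<And>i. D i \<in> sets borel" "\<And>i. D i \<subseteq> G i" "disjoint_family_on D {..<n}"
      "\<And>x i. i < n \<Longrightarrow> v i * indicator (G i) x \<le> (\<Sum>i<n. v i * indicator (D i) x)" by blast
  define g where "g x = (\<Sum>i<n. v i * indicator (D i) x)" for x
  have [measurable]: "g \<in> borel_measurable borel"
    unfolding g_def using D(1) by measurable
  \<comment> \<open>The new cell takes over the points where its weight beats the maximum reached so
    far.\<close>
  define B where "B = {x \<in> G n. g x < v n}"
  have B: "B \<in> sets borel" unfolding B_def using G[of n] by measurable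
  define D' where "D' i = (if i = n then B else D i - B)" for i
  have g': "(\<Sum>i<Suc n. v i * indicator (D' i) x) = (if x \<in> B then v n else g x)" for x
    by (auto simp: D'_def g_def intro!: sum.neutral sum.cong split: split_indicator)
  show ?case
  proof (intro exI[of _ D'] conjI allI impI)
    show "D' i \<in> sets borel" "D' i \<subseteq> G i" for i using B D(1,2)[of i] by (auto simp: D'_def B_def)
    show "disjoint_family_on D' {..<Suc n}"
    proof (unfold disjoint_family_on_def, intro ballI impI)
      fix i j assume ij: "i \<in> {..<Suc n}" "j \<in> {..<Suc n}" "i \<noteq> j"
      show "D' i \<inter> D' j = {}"
      proof (cases "i = n \<or> j = n")
        case True
        then show ?thesis using ij(3) by (auto simp: D'_def)
      next
        case False
        then have "i \<in> {..<n}" "j \<in> {..<n}" using ij by auto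
        then have "D i \<inter> D j = {}" using D(3) ij(3) by (auto simp: disjoint_family_on_def)
        then show ?thesis using False by (auto simp: D'_def)
      qed
    qed
    fix x i assume i: "i < Suc n"
    show "v i * indicator (G i) x \<le> (\<Sum>i<Suc n. v i * indicator (D' i) x)"
    proof (cases "i = n")
      case True
      then show ?thesis unfolding g' by (auto simp: B_def indicator_def)
    next
      case False
      then have "v i * indicator (G i) x \<le> g x" using D(4)[of i x] i by (simp add: g_def)
      then show ?thesis unfolding g' by (auto simp: B_def)
    qed
  qed
qed

subsection \<open>The main inequality\<close>

text \<open>Up to a factor the integrand is dominated by the supremum of weighted cell indicators,
  an increasing limit of Borel functions whose integrals are all controlled by the energy. In that
  factor \<open>1 - \<kappa>\<close> comes from replacing the traces by nearby parameters, and
  \<open>1 - 2 * \<kappa>\<close> from the tolerance on both sides of the jump.\<close>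

lemma jump_integral_le_Liminf:
  fixes u w :: "real^'n \<Rightarrow> real^'d"
  assumes w: "w \<in> borel_measurable borel" and ae: "AE x in lborel. x \<in> \<Omega> \<longrightarrow> u x = w x"
    and \<Omega>: "open \<Omega>" and q: "0 \<le> q" and \<kappa>: "0 < \<kappa>" "\<kappa> < 1/2"
    and \<eta>: "0 < \<eta>" "2 * 4 ^ CARD('n) * \<eta> < unit_ball_vol (real CARD('n)) * \<kappa> ^ CARD('n)"
    and d: "\<And>\<nu> :: real^'n. norm \<nu> = 1 \<Longrightarrow> crossing_const \<nu> = ennreal d" "0 \<le> d"
    and \<theta>: "0 < \<theta>" "\<theta> < 1"
    and e: "2 * layer_const CARD('n) \<kappa> \<eta> * unit_ball_vol (real CARD('n)) / \<theta> + unit_ball_vol (real CARD('n)) * \<theta> ^ CARD('n) \<le> e" "e \<le> d"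
  shows "ennreal ((d - e) * ((1 - 2 * \<kappa>) * (1 - \<kappa>)) powr q) *
      (\<integral>\<^sup>+x\<in>jump_set \<Omega> u. ennreal (norm (trace_plus u x - trace_minus u x) powr q) \<partial>hausdorff_measure (real CARD('n) - 1))
    \<le> ennreal ((1 / sqrt (1 - \<kappa>\<^sup>2)) powr (real CARD('n) - 1)) * Liminf (at_right 0) (local_energy q w \<Omega>)"
proof -
  let ?H = "hausdorff_measure (real CARD('n) - 1) :: (real^'n) measure"
  let ?L = "Liminf (at_right 0) (local_energy q w \<Omega>)"
  define f where "f x = ennreal (norm (trace_plus u x - trace_minus u x) powr q)" for x
  define t where "t = ((1 - 2 * \<kappa>) * (1 - \<kappa>)) powr q"
  define L where "L = (1 / sqrt (1 - \<kappa>\<^sup>2)) powr (real CARD('n) - 1)"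
  have t: "0 < t" using \<kappa> by (simp add: t_def)
  obtain V :: "(real^'d) set" where V: "countable V" "UNIV \<subseteq> closure V" using separable[of UNIV] by metis
  obtain S :: "(real^'n) set" where S: "countable S" "S \<subseteq> sphere 0 1" "sphere 0 1 \<subseteq> closure S"
    using separable[of "sphere 0 1"] by metis
  obtain P :: "(real^'n) set" where P: "countable P" "UNIV \<subseteq> closure P" using separable[of UNIV] by metis
  define Par where "Par = {(a, b, \<nu>, \<rho>, p). a \<in> V \<and> b \<in> V \<and> \<nu> \<in> S \<and> p \<in> P \<and> a \<noteq> b \<and>
      \<rho> \<in> range (\<lambda>n. inverse (real (Suc n))) \<and> cball p \<rho> \<subseteq> \<Omega>}"
  have "countable Par"
    by (rule countable_subset[of _ "V \<times> V \<times> S \<times> range (\<lambda>n. inverse (real (Suc n))) \<times> P"])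
       (use V S P in \<open>auto simp: Par_def simp del: of_nat_Suc\<close>)
  define sz where "sz = (\<lambda>(a :: real^'d, b :: real^'d, \<nu> :: real^'n, \<rho> :: real, p :: real^'n).
      ennreal ((norm (a - b) - 2 * (\<kappa> * norm (a - b))) powr q))"
  have cover: "\<exists>c\<in>Par. x \<in> jump_cell w \<kappa> \<eta> c \<and> ennreal t * f x \<le> sz c" if x: "x \<in> jump_set \<Omega> u" for x
  proof -
    obtain a b \<nu> where tr: "jump_triple u x = (a, b, \<nu>)" by (cases "jump_triple u x")
    have "is_jump_triple u x (jump_triple u x)"
      using x unfolding jump_triple_def jump_set_def by (auto intro: someI_ex)
    then have jump: "is_jump_triple u x (a, b, \<nu>)" by (simp add: tr)
    have x\<Omega>: "x \<in> \<Omega>" using x by (simp add: jump_set_def)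
    obtain a0 b0 \<nu>0 n p where c: "a0 \<in> V" "b0 \<in> V" "\<nu>0 \<in> S" "p \<in> P" "a0 \<noteq> b0"
      "cball p (inverse (real (Suc n))) \<subseteq> \<Omega>" "x \<in> jump_cell w \<kappa> \<eta> (a0, b0, \<nu>0, inverse (real (Suc n)), p)"
      "(1 - \<kappa>) * norm (a - b) \<le> norm (a0 - b0)"
      using jump_triple_imp_jump_cell[OF w ae \<Omega> x\<Omega> \<kappa> \<eta>(1) jump, of V S P] V S P by (metis top.extremum_uniqueI)
    have "((1 - 2 * \<kappa>) * (1 - \<kappa>)) powr q * norm (a - b) powr q = ((1 - 2 * \<kappa>) * ((1 - \<kappa>) * norm (a - b))) powr q"
      by (simp add: powr_mult mult.assoc)
    also have "\<dots> \<le> ((1 - 2 * \<kappa>) * norm (a0 - b0)) powr q"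
      using c(8) \<kappa> q by (intro powr_mono2 mult_left_mono mult_nonneg_nonneg) auto
    also have "(1 - 2 * \<kappa>) * norm (a0 - b0) = norm (a0 - b0) - 2 * (\<kappa> * norm (a0 - b0))" by (simp add: algebra_simps)
    finally have "ennreal (t * norm (a - b) powr q) \<le> sz (a0, b0, \<nu>0, inverse (real (Suc n)), p)"
      unfolding t_def sz_def prod.case by (rule ennreal_leI)
    moreover have "ennreal (t * norm (a - b) powr q) = ennreal t * f x"
      using t by (simp add: f_def trace_plus_def trace_minus_def tr ennreal_mult)
    moreover have "(a0, b0, \<nu>0, inverse (real (Suc n)), p) \<in> Par" using c(1-6) unfolding Par_def by blast
    ultimately show ?thesis using c(7) by (intro bexI[of _ "(a0, b0, \<nu>0, inverse (real (Suc n)), p)"]) auto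
  qed
  have "ennreal ((d - e) * t) * (\<integral>\<^sup>+x\<in>jump_set \<Omega> u. f x \<partial>?H) \<le> ennreal L * ?L"
  proof (cases "Par = {}")
    case True
    then have "jump_set \<Omega> u = {}" using cover by blast
    then show ?thesis by simp
  next
    case False
    define c where "c = from_nat_into Par"
    have cP: "c i \<in> Par" for i using False by (simp add: c_def from_nat_into)
    have surj: "\<exists>i. c i = y" if "y \<in> Par" for y
      using from_nat_into_surj[OF \<open>countable Par\<close> that] by (simp add: c_def)
    define a where "a i = fst (c i)" for i
    define b where "b i = fst (snd (c i))" for i
    define \<nu> where "\<nu> i = fst (snd (snd (c i)))" for i
    define \<rho> where "\<rho> i = fst (snd (snd (snd (c i))))" for i
    define p where "p i = snd (snd (snd (snd (c i))))" for i
    have ceq: "c i = (a i, b i, \<nu> i, \<rho> i, p i)" for i by (simp add: a_def b_def \<nu>_def \<rho>_def p_def)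
    have par: "a i \<noteq> b i" "norm (\<nu> i) = 1" "0 < \<rho> i" "cball (p i) (\<rho> i) \<subseteq> \<Omega>" for i
      using cP[of i] S(2) unfolding ceq Par_def by auto
    define G where "G i = jump_cell w \<kappa> \<eta> (c i)" for i
    have piece: "jump_piece w (G i) (\<nu> i) (a i) (b i) \<kappa> \<eta> (\<rho> i) (\<kappa> * norm (a i - b i)) q" for i
      unfolding G_def ceq using par \<kappa> \<eta> q by (intro jump_piece_jump_cell w) auto
    have G: "G i \<in> sets borel" for i
      using jump_piece.C[OF piece[of i]] by (intro borel_closed compact_imp_closed)
    have G\<Omega>: "G i \<subseteq> \<Omega>" for i
    proof -
      have "G i \<subseteq> cball (p i) (\<rho> i / 8)" unfolding G_def ceq by (rule jump_cell_subset)
      also have "\<dots> \<subseteq> cball (p i) (\<rho> i)" using par(3)[of i] by (intro subset_cball) auto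
      finally show ?thesis using par(4) by blast
    qed
    define v where "v i = ennreal ((norm (a i - b i) - 2 * (\<kappa> * norm (a i - b i))) powr q)" for i
    have sz: "sz (c i) = v i" for i by (simp add: sz_def ceq v_def)
    define F where "F n x = (SUP i\<in>{..<n}. v i * indicator (G i) x)" for n :: nat and x
    have F[measurable]: "F n \<in> borel_measurable borel" for n
      unfolding F_def using G by (intro borel_measurable_SUP) auto
    have Fn: "ennreal (d - e) * (\<integral>\<^sup>+x. F n x \<partial>?H) \<le> ennreal L * ?L" for n
    proof -
      obtain D where D: "\<And>i. D i \<in> sets borel" "\<And>i. D i \<subseteq> G i" "disjoint_family_on D {..<n}"
          "\<And>x i. i < n \<Longrightarrow> v i * indicator (G i) x \<le> (\<Sum>i<n. v i * indicator (D i) x)"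
        using max_eq_disjoint_sum[of G n v] G by blast
      have DH: "D i \<in> sets ?H" for i using D(1)[of i] borel_subset_hausdorff by blast
      have "(\<integral>\<^sup>+x. F n x \<partial>?H) \<le> (\<integral>\<^sup>+x. (\<Sum>i<n. v i * indicator (D i) x) \<partial>?H)"
        unfolding F_def by (intro nn_integral_mono SUP_least D(4)) auto
      also have "\<dots> = (\<Sum>i<n. (\<integral>\<^sup>+x. v i * indicator (D i) x \<partial>?H))"
        using DH by (intro nn_integral_sum) auto
      also have "\<dots> = (\<Sum>i<n. v i * hausdorff_outer (real CARD('n) - 1) (D i))"
        using DH D(1) by (intro sum.cong refl) (simp add: nn_integral_cmult_indicator emeasure_hausdorff_borel)
      finally have "ennreal (d - e) * (\<integral>\<^sup>+x. F n x \<partial>?H)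
        \<le> ennreal (d - e) * (\<Sum>i<n. v i * hausdorff_outer (real CARD('n) - 1) (D i))" by (rule mult_left_mono) simp
      also have "\<dots> \<le> ennreal L * ?L"
        unfolding v_def L_def
      proof (rule Liminf_energy_Borel_family[OF _ \<Omega> piece _ G\<Omega> D(1,2,3) w d \<theta> _ refl e])
        show "0 \<le> layer_const CARD('n) \<kappa> \<eta>" using \<kappa> \<eta> by (simp add: layer_const_def)
      qed (use par in auto)
      finally show ?thesis .
    qed
    have inc: "incseq F" unfolding F_def incseq_def le_fun_def by (auto intro!: SUP_subset_mono)
    have "ennreal t * (\<integral>\<^sup>+x\<in>jump_set \<Omega> u. f x \<partial>?H) \<le> (\<integral>\<^sup>+x. (SUP n. F n x) \<partial>?H)"
    proof -
      \<comment> \<open>Measurability of the trace difference on the jump set is not established.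
        Monotonicity of the integral holds for arbitrary functions, so the factor \<open>t\<close>
        is moved to the Borel side before it is taken out of the integral.\<close>
      have tinv: "ennreal (1 / t) * (ennreal t * y) = y" "ennreal t * (ennreal (1 / t) * y) = y" for y
        using t by (simp_all add: mult.assoc[symmetric] ennreal_mult'[symmetric])
      have "f x * indicator (jump_set \<Omega> u) x \<le> ennreal (1 / t) * (SUP n. F n x)" for x
      proof (cases "x \<in> jump_set \<Omega> u")
        case True
        then obtain y where y: "y \<in> Par" "x \<in> jump_cell w \<kappa> \<eta> y" "ennreal t * f x \<le> sz y" using cover by blast
        then obtain i where i: "c i = y" using surj by blast
        have "ennreal t * f x \<le> v i * indicator (G i) x" using y i sz[of i] by (simp add: G_def)
        also have "\<dots> \<le> F (Suc i) x" unfolding F_def by (intro SUP_upper) auto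
        also have "\<dots> \<le> (SUP n. F n x)" by (rule SUP_upper) simp
        finally have "ennreal (1 / t) * (ennreal t * f x) \<le> ennreal (1 / t) * (SUP n. F n x)" by (rule mult_left_mono) simp
        then show ?thesis using True by (simp add: tinv)
      qed simp
      then have "(\<integral>\<^sup>+x\<in>jump_set \<Omega> u. f x \<partial>?H) \<le> (\<integral>\<^sup>+x. ennreal (1 / t) * (SUP n. F n x) \<partial>?H)"
        by (intro nn_integral_mono)
      also have "\<dots> = ennreal (1 / t) * (\<integral>\<^sup>+x. (SUP n. F n x) \<partial>?H)"
        by (intro nn_integral_cmult measurable_hausdorff_borel borel_measurable_SUP F) auto
      finally have "ennreal t * (\<integral>\<^sup>+x\<in>jump_set \<Omega> u. f x \<partial>?H) \<le> ennreal t * (ennreal (1 / t) * (\<integral>\<^sup>+x. (SUP n. F n x) \<partial>?H))"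
        by (rule mult_left_mono) simp
      then show ?thesis by (simp add: tinv)
    qed
    also have "(\<integral>\<^sup>+x. (SUP n. F n x) \<partial>?H) = (SUP n. \<integral>\<^sup>+x. F n x \<partial>?H)"
      using inc measurable_hausdorff_borel[OF F] by (intro nn_integral_monotone_convergence_SUP) auto
    finally have "ennreal (d - e) * (ennreal t * (\<integral>\<^sup>+x\<in>jump_set \<Omega> u. f x \<partial>?H)) \<le> ennreal (d - e) * (SUP n. \<integral>\<^sup>+x. F n x \<partial>?H)"
      by (rule mult_left_mono) simp
    also have "\<dots> = (SUP n. ennreal (d - e) * (\<integral>\<^sup>+x. F n x \<partial>?H))" by (rule SUP_mult_left_ennreal)
    also have "\<dots> \<le> ennreal L * ?L" by (intro SUP_least Fn)
    finally show ?thesis using t e by (simp add: ennreal_mult mult.assoc)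
  qed
  then show ?thesis by (simp add: f_def t_def L_def)
qed

text \<open>The choice \<open>\<theta> = sqrt \<kappa>\<close> balances the errors of order
  \<open>(\<eta> + \<kappa>) / \<theta>\<close> and \<open>\<theta> ^ N\<close>: with
  \<open>\<eta> \<le> \<kappa>\<close> both are at most a multiple of \<open>sqrt \<kappa>\<close>,
  and \<open>\<kappa>\<close> is the only parameter left to send to 0.\<close>

lemma crossing_const_le_Liminf:
  fixes u w :: "real^'n \<Rightarrow> real^'d" and \<nu> :: "real^'n"
  assumes w: "w \<in> borel_measurable borel" and ae: "AE x in lborel. x \<in> \<Omega> \<longrightarrow> u x = w x"
    and \<Omega>: "open \<Omega>" and q: "0 \<le> q" and \<nu>: "norm \<nu> = 1"
  shows "crossing_const \<nu> *
      (\<integral>\<^sup>+x\<in>jump_set \<Omega> u. ennreal (norm (trace_plus u x - trace_minus u x) powr q) \<partial>hausdorff_measure (real CARD('n) - 1))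
    \<le> Liminf (at_right 0) (local_energy q w \<Omega>)"
proof -
  let ?I = "\<integral>\<^sup>+x\<in>jump_set \<Omega> u. ennreal (norm (trace_plus u x - trace_minus u x) powr q) \<partial>hausdorff_measure (real CARD('n) - 1)"
  let ?L = "Liminf (at_right 0) (local_energy q w \<Omega>)"
  let ?N = "CARD('n)"
  define \<omega> where "\<omega> = unit_ball_vol (real ?N)"
  define W where "W = unit_ball_vol (real (?N - 1))"
  have \<omega>: "0 < \<omega>" and W: "0 \<le> W" by (simp_all add: \<omega>_def W_def)
  define d where "d = enn2real (crossing_const \<nu>)"
  have "crossing_const \<nu> < top"
    using crossing_const_le_ball[OF \<nu>] emeasure_bounded_finite[of "ball 0 1 :: (real^'n) set"] by (simp add: le_less_trans)
  then have d\<nu>: "crossing_const \<nu> = ennreal d" by (simp add: d_def)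
  have d: "crossing_const \<mu> = ennreal d" if "norm \<mu> = 1" for \<mu> :: "real^'n"
    using crossing_const_rotation[of \<mu> \<nu>] that \<nu> d\<nu> by simp
  have d0: "0 \<le> d" by (simp add: d_def)
  show ?thesis
  proof (cases "d = 0")
    case True
    then show ?thesis by (simp add: d\<nu>)
  next
    case False
    then have dpos: "0 < d" using d0 by simp
    \<comment> \<open>\<open>c\<close> collects the constants of both errors, so that
      \<open>c * sqrt \<kappa>\<close> is an admissible total error.\<close>
    define c where "c = 2 * 24 ^ ?N * (1 + W) + \<omega>"
    have c: "0 < c" using \<omega> W by (simp add: c_def add_nonneg_pos)
    define \<Lambda> where "\<Lambda> \<kappa> = (1 / sqrt (1 - \<kappa>\<^sup>2)) powr (real ?N - 1)" for \<kappa> :: real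
    define F where "F \<kappa> = (d - c * sqrt \<kappa>) * ((1 - 2 * \<kappa>) * (1 - \<kappa>)) powr q / \<Lambda> \<kappa>" for \<kappa>
    have lim0: "((\<lambda>\<kappa>. c * sqrt \<kappa>) \<longlongrightarrow> c * sqrt 0) (at_right 0)" by (intro tendsto_intros)
    have "((\<lambda>\<kappa>. \<Lambda> \<kappa>) \<longlongrightarrow> (1 / sqrt (1 - 0\<^sup>2)) powr (real ?N - 1)) (at_right 0)"
      unfolding \<Lambda>_def by (intro tendsto_intros) auto
    then have "(F \<longlongrightarrow> (d - c * sqrt 0) * ((1 - 2 * 0) * (1 - 0)) powr q / (1 / sqrt (1 - 0\<^sup>2)) powr (real ?N - 1)) (at_right 0)"
      unfolding F_def by (intro tendsto_intros) auto
    then have F: "(F \<longlongrightarrow> d) (at_right 0)" by simp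
    have "\<forall>\<^sub>F \<kappa> in at_right 0. c * sqrt \<kappa> < d" using lim0 dpos by (intro order_tendstoD) auto
    moreover have "\<forall>\<^sub>F \<kappa> :: real in at_right 0. 0 < \<kappa> \<and> \<kappa> < 1/2"
      unfolding eventually_at_right_field by (intro exI[of _ "1/2"]) auto
    ultimately have ev: "\<forall>\<^sub>F \<kappa> in at_right 0. ?I * ennreal (F \<kappa>) \<le> ?L"
    proof eventually_elim
      case (elim \<kappa>)
      then have \<kappa>: "0 < \<kappa>" "\<kappa> < 1/2" by auto
      \<comment> \<open>The second argument ensures the smallness condition behind flatness; 4 in
        place of 2 in the denominator makes it strict.\<close>
      define \<eta> where "\<eta> = min \<kappa> (\<omega> * \<kappa> ^ ?N / (4 * 4 ^ ?N))"
      have \<eta>: "0 < \<eta>" "\<eta> \<le> \<kappa>" using \<kappa> \<omega> by (auto simp: \<eta>_def)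
      have "\<eta> \<le> \<omega> * \<kappa> ^ ?N / (4 * 4 ^ ?N)" by (simp add: \<eta>_def)
      then have "2 * 4 ^ ?N * \<eta> \<le> \<omega> * \<kappa> ^ ?N / 2" by (simp add: field_simps)
      also have "\<dots> < \<omega> * \<kappa> ^ ?N" using \<omega> \<kappa> by simp
      finally have \<eta>2: "2 * 4 ^ ?N * \<eta> < \<omega> * \<kappa> ^ ?N" .
      have s: "0 < sqrt \<kappa>" "sqrt \<kappa> < 1" "sqrt \<kappa> * sqrt \<kappa> = \<kappa>" using \<kappa> by auto
      have "\<eta> + W * \<kappa> \<le> (1 + W) * \<kappa>" using \<eta> by (simp add: algebra_simps)
      then have "2 * 24 ^ ?N * (\<eta> + W * \<kappa>) / sqrt \<kappa> \<le> 2 * 24 ^ ?N * ((1 + W) * \<kappa>) / sqrt \<kappa>"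
        using s by (intro divide_right_mono mult_left_mono) auto
      also have "\<dots> = 2 * 24 ^ ?N * (1 + W) * sqrt \<kappa>"
      proof -
        have "\<kappa> / sqrt \<kappa> = sqrt \<kappa>" using s by (simp add: divide_eq_eq)
        then show ?thesis by (metis (no_types, opaque_lifting) mult.assoc times_divide_eq_right)
      qed
      finally have e1: "2 * 24 ^ ?N * (\<eta> + W * \<kappa>) / sqrt \<kappa> \<le> 2 * 24 ^ ?N * (1 + W) * sqrt \<kappa>" .
      have "sqrt \<kappa> ^ ?N \<le> sqrt \<kappa> ^ 1" using s by (intro power_decreasing) (auto simp: Suc_leI)
      then have e2: "\<omega> * sqrt \<kappa> ^ ?N \<le> \<omega> * sqrt \<kappa>" using \<omega> by simp
      have e3: "2 * layer_const CARD('n) \<kappa> \<eta> * \<omega> / sqrt \<kappa> = 2 * 24 ^ ?N * (\<eta> + W * \<kappa>) / sqrt \<kappa>"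
        unfolding layer_const_def \<omega>_def[symmetric] W_def[symmetric] using \<omega> by simp
      have "2 * layer_const CARD('n) \<kappa> \<eta> * \<omega> / sqrt \<kappa> + \<omega> * sqrt \<kappa> ^ ?N \<le> c * sqrt \<kappa>"
        unfolding e3 using e1 e2 by (simp add: c_def algebra_simps)
      then have main: "ennreal ((d - c * sqrt \<kappa>) * ((1 - 2 * \<kappa>) * (1 - \<kappa>)) powr q) * ?I \<le> ennreal (\<Lambda> \<kappa>) * ?L"
        unfolding \<Lambda>_def \<omega>_def
        by (intro jump_integral_le_Liminf[OF w ae \<Omega> q \<kappa> \<eta>(1) _ d d0 s(1,2)]) (use \<eta>2 elim in \<open>auto simp: \<omega>_def\<close>)
      have "\<kappa>\<^sup>2 < 1" using \<kappa> by (simp add: power_less_one_iff)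
      then have \<Lambda>: "0 < \<Lambda> \<kappa>" by (simp add: \<Lambda>_def)
      define G where "G = (d - c * sqrt \<kappa>) * ((1 - 2 * \<kappa>) * (1 - \<kappa>)) powr q"
      have "F \<kappa> = 1 / \<Lambda> \<kappa> * G" by (simp add: F_def G_def)
      then have FG: "ennreal (F \<kappa>) = ennreal (1 / \<Lambda> \<kappa>) * ennreal G"
        using \<Lambda> by (simp only: ennreal_mult' divide_nonneg_pos zero_le_one)
      have "?I * ennreal (F \<kappa>) = ennreal (1 / \<Lambda> \<kappa>) * (ennreal G * ?I)" unfolding FG by (simp only: mult_ac)
      also have "\<dots> \<le> ennreal (1 / \<Lambda> \<kappa>) * (ennreal (\<Lambda> \<kappa>) * ?L)"
        using main unfolding G_def by (rule mult_left_mono) simp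
      also have "\<dots> = (ennreal (1 / \<Lambda> \<kappa>) * ennreal (\<Lambda> \<kappa>)) * ?L" by (simp only: mult.assoc)
      also have "ennreal (1 / \<Lambda> \<kappa>) * ennreal (\<Lambda> \<kappa>) = 1" using \<Lambda> by (simp add: ennreal_mult'[symmetric])
      finally show ?case by simp
    qed
    \<comment> \<open>If the integral is infinite, one positive value of \<open>F\<close> already
      forces the limit inferior to be infinite; otherwise the product with the integral passes to
      the limit.\<close>
    have "?I * ennreal d \<le> ?L"
    proof (cases "?I = top")
      case True
      have "\<forall>\<^sub>F \<kappa> in at_right 0. 0 < F \<kappa>" using F dpos by (intro order_tendstoD) auto
      with ev have "\<forall>\<^sub>F \<kappa> in at_right (0::real). top \<le> ?L"
        by eventually_elim (simp add: True ennreal_top_mult)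
      then have "top \<le> ?L" by (simp add: eventually_const_iff trivial_limit_at_right_real)
      then show ?thesis by (simp add: top_unique)
    next
      case False
      then have "((\<lambda>\<kappa>. ?I * ennreal (F \<kappa>)) \<longlongrightarrow> ?I * ennreal d) (at_right 0)"
        using F by (intro ennreal_tendsto_cmult tendsto_ennrealI) (auto simp: less_top)
      then show ?thesis using ev by (rule tendsto_upperbound) simp
    qed
    then show ?thesis by (simp add: d\<nu> mult.commute)
  qed
qed

theorem theorem1p3:
  fixes q :: real and \<Omega> :: "(real^'n) set" and u :: "real^'n \<Rightarrow> real^'d" and k :: 'n
  assumes "1 \<le> q" and "open \<Omega>" and "u \<in> BV_space q \<Omega>"
  shows "jump_const k *
           (\<integral>\<^sup>+x\<in>jump_set \<Omega> u. ennreal (norm (trace_plus u x - trace_minus u x) powr q)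
              \<partial>hausdorff_measure (real CARD('n) - 1))
         \<le> Liminf (at_right 0) (BV_energy q \<Omega> u)"
proof -
  have \<Omega>: "\<Omega> \<in> sets borel" using assms(2) by simp
  have "u \<in> borel_measurable (lebesgue_on \<Omega>)" using assms(3) by (simp add: BV_space_def)
  \<comment> \<open>The energy and the one-sided averages do not see null sets, so \<open>w\<close>
    can serve in the estimates while the traces remain those of \<open>u\<close>.\<close>
  then obtain w where w: "w \<in> borel_measurable borel" and ae: "AE x in lborel. x \<in> \<Omega> \<longrightarrow> u x = w x"
    using lebesgue_on_ex_borel_measurable[OF _ \<Omega>] by blast
  \<comment> \<open>The two energies are identified for positive \<open>\<epsilon>\<close> only, and
    these are all that the limit from the right sees.\<close>
  have "\<forall>\<^sub>F \<epsilon> :: real in at_right 0. 0 < \<epsilon>" by (simp add: eventually_at_right_less)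
  then have "Liminf (at_right 0) (BV_energy q \<Omega> u) = Liminf (at_right 0) (local_energy q w \<Omega>)"
    by (intro Liminf_eq) (auto elim!: eventually_mono intro: BV_energy_eq_local_energy[OF w \<Omega> ae])
  moreover have "jump_const k *
      (\<integral>\<^sup>+x\<in>jump_set \<Omega> u. ennreal (norm (trace_plus u x - trace_minus u x) powr q) \<partial>hausdorff_measure (real CARD('n) - 1))
    \<le> crossing_const (axis k 1 :: real^'n) *
      (\<integral>\<^sup>+x\<in>jump_set \<Omega> u. ennreal (norm (trace_plus u x - trace_minus u x) powr q) \<partial>hausdorff_measure (real CARD('n) - 1))"
    by (rule mult_right_mono[OF jump_const_le_crossing_const]) simp
  moreover have "\<dots> \<le> Liminf (at_right 0) (local_energy q w \<Omega>)"
    using assms(1) by (intro crossing_const_le_Liminf w ae assms(2)) auto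
  ultimately show ?thesis by simp
qed

end
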